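(* Let $G$ be a planar graph on $n$ vertices and let $\varphi$ be a proper coloring of $G$ with $|\varphi(V(G))|=k$. Let $U \subseteq V(G)$ be a set of vertices that induces a clique of size $|U| \le 3$. Then there exists a $U$-acyclic $2$CC transversal $E_U \subseteq E(G)$ with respect to $\varphi$ such that $|E_U| = m(G,\varphi) \le n-k$.
   Context: All graphs are finite and simple. A coloring $\varphi$ of $G$ assigns a positive integer (color) to each vertex; it is proper if adjacent vertices receive distinct colors. $\varphi(V(G))$ is the set of colors used. A $2$-colored cycle of $G$ (with respect to $\varphi$) is a cycle whose vertices use only two colors. A $2$CC transversal with respect to a proper coloring $\varphi$ is a set $E' \subseteq E(G)$ that intersects (the edge set of) every $2$-colored cycle of $G$, i.e. $G-E'$ contains no $2$-colored cycle. $m(G,\varphi)$ denotes the minimum size of a $2$CC transversal with respect to $\varphi$. For $U \subseteq V(G)$, an edge set $E' \subseteq E(G)$ is $U$-acyclic if the graph induced by $E'$ is a forest and contains no path joining two distinct vertices of $U$. *)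

theory Defs
  imports "HOL-Analysis.Analysis" "HOL-Library.Ramsey"
begin

definition simple_graph :: "'a set \<Rightarrow> 'a set set \<Rightarrow> bool" where
  "simple_graph V E \<longleftrightarrow> finite V \<and> (\<forall>e\<in>E. e \<subseteq> V \<and> card e = 2)"

(* Drawings with arbitrary (not necessarily polygonal) Jordan arcs. An arc meets the drawn
   vertices exactly in its two ends, and two distinct arcs meet only in common ends. *)
definition plane_drawing ::
  "'a set \<Rightarrow> 'a set set \<Rightarrow> ('a \<Rightarrow> complex) \<Rightarrow> ('a set \<Rightarrow> real \<Rightarrow> complex) \<Rightarrow> bool" where
  "plane_drawing V E p \<gamma> \<longleftrightarrow>
     inj_on p V \<and>
     (\<forall>e\<in>E. arc (\<gamma> e) \<and> {pathstart (\<gamma> e), pathfinish (\<gamma> e)} = p ` e \<and>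
             path_image (\<gamma> e) \<inter> p ` V = p ` e) \<and>
     (\<forall>e\<in>E. \<forall>f\<in>E. e \<noteq> f \<longrightarrow> path_image (\<gamma> e) \<inter> path_image (\<gamma> f) = p ` (e \<inter> f))"

definition planar_graph :: "'a set \<Rightarrow> 'a set set \<Rightarrow> bool" where
  "planar_graph V E \<longleftrightarrow> simple_graph V E \<and> (\<exists>p \<gamma>. plane_drawing V E p \<gamma>)"

definition proper_coloring :: "'a set \<Rightarrow> 'a set set \<Rightarrow> ('a \<Rightarrow> nat) \<Rightarrow> bool" where
  "proper_coloring V E \<phi> \<longleftrightarrow>
     (\<forall>v\<in>V. 0 < \<phi> v) \<and> (\<forall>u v. {u, v} \<in> E \<longrightarrow> \<phi> u \<noteq> \<phi> v)"

(* Cycles and paths are given by the list of their vertices, without repetition;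
   the edge closing a cycle is implicit. *)
definition cycle_edges :: "'a list \<Rightarrow> 'a set set" where
  "cycle_edges xs = {{xs ! i, xs ! (Suc i mod length xs)} | i. i < length xs}"

definition is_cycle :: "'a set set \<Rightarrow> 'a list \<Rightarrow> bool" where
  "is_cycle E xs \<longleftrightarrow> 3 \<le> length xs \<and> distinct xs \<and> cycle_edges xs \<subseteq> E"

definition is_path :: "'a set set \<Rightarrow> 'a list \<Rightarrow> bool" where
  "is_path E xs \<longleftrightarrow> xs \<noteq> [] \<and> distinct xs \<and> (\<forall>i. Suc i < length xs \<longrightarrow> {xs ! i, xs ! Suc i} \<in> E)"

definition two_colored_cycle :: "'a set set \<Rightarrow> ('a \<Rightarrow> nat) \<Rightarrow> 'a list \<Rightarrow> bool" where
  "two_colored_cycle E \<phi> xs \<longleftrightarrow> is_cycle E xs \<and> card (\<phi> ` set xs) = 2"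

definition transversal_2CC :: "'a set set \<Rightarrow> ('a \<Rightarrow> nat) \<Rightarrow> 'a set set \<Rightarrow> bool" where
  "transversal_2CC E \<phi> E' \<longleftrightarrow>
     E' \<subseteq> E \<and> (\<forall>xs. two_colored_cycle E \<phi> xs \<longrightarrow> E' \<inter> cycle_edges xs \<noteq> {})"

definition min_2CC :: "'a set set \<Rightarrow> ('a \<Rightarrow> nat) \<Rightarrow> nat" where
  "min_2CC E \<phi> = (LEAST m. \<exists>E'. transversal_2CC E \<phi> E' \<and> card E' = m)"

definition forest :: "'a set set \<Rightarrow> bool" where
  "forest E \<longleftrightarrow> (\<nexists>xs. is_cycle E xs)"

definition U_acyclic :: "'a set \<Rightarrow> 'a set set \<Rightarrow> bool" where
  "U_acyclic U E' \<longleftrightarrow>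
     forest E' \<and> (\<nexists>xs. is_path E' xs \<and> hd xs \<in> U \<and> last xs \<in> U \<and> hd xs \<noteq> last xs)"

lemma transversal_2CC_all_edges: "transversal_2CC E \<phi> E"
proof -
  have "E \<inter> cycle_edges xs \<noteq> {}" if "two_colored_cycle E \<phi> xs" for xs
  proof -
    have "{xs ! 0, xs ! (Suc 0 mod length xs)} \<in> cycle_edges xs"
      using that unfolding two_colored_cycle_def is_cycle_def cycle_edges_def by fastforce
    then show ?thesis
      using that unfolding two_colored_cycle_def is_cycle_def by blast
  qed
  then show ?thesis
    unfolding transversal_2CC_def by blast
qed

lemma min_2CC_attained: "\<exists>E'. transversal_2CC E \<phi> E' \<and> card E' = min_2CC E \<phi>"
  unfolding min_2CC_def by (rule LeastI_ex) (use transversal_2CC_all_edges in blast)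

end

theory Submission
  imports Defs
begin

text \<open>
  Split each vertex into one copy for each colour, so that two-coloured cycles become the cycles of the
  split graph. Complements of transversals are then the independent sets of a graphic matroid with rank
  function \<open>r\<^sub>1\<close>, and \<open>m(G, \<phi>) = |E| - r\<^sub>1(E)\<close>.

  The bound \<open>m \<le> n - k\<close> is proved for all minors of triangulated spheres by induction on the number of
  vertices. A sphere with a separating triangle is cut along it; otherwise every edge of a sphere with at
  least five vertices can be contracted. An edge inside a fibre of the minor is contracted at once. If
  there is none, take a vertex of degree at most five: either some colour occurs only once among its
  neighbours and the vertex is contracted into that neighbour, or two neighbours of equal colour are merged
  with each other through it, which a combinatorial Jordan curve theorem allows for one of two crossing
  pairs. A plane drawing, rastered on a sufficiently fine grid, exhibits the graph as an induced minor of a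
  triangulated sphere.

  For the clique \<open>U\<close> let \<open>K\<close> be a spanning star of \<open>U\<close>, and let \<open>r\<close> be the rank in the graphic matroid of
  the graph. Applying the bound to each subgraph \<open>(V, B)\<close>, with \<open>\<phi>\<close> refined by the components of \<open>B \<union> K\<close>,
  gives \<open>|B| \<le> r\<^sub>1(B) + (r(B \<union> K) - |K|)\<close>. By matroid union \<open>E\<close> is the disjoint union of \<open>X\<close>, independent
  for \<open>r\<^sub>1\<close>, and a set that stays acyclic together with \<open>K\<close>. If \<open>F\<close> is a basis for \<open>r\<^sub>1\<close> containing \<open>X\<close>,
  then \<open>E - F\<close> is a minimum transversal and \<open>U\<close>-acyclic.
\<close>

section \<open>Connectivity, acyclic edge sets and rank\<close>

definition conn :: "'a set set \<Rightarrow> 'a \<Rightarrow> 'a \<Rightarrow> bool" where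
  "conn X = (\<lambda>x y. {x, y} \<in> X)\<^sup>*\<^sup>*"

lemma conn_refl [simp, intro]: "conn X x x"
  by (simp add: conn_def)

lemma conn_edge: "{x, y} \<in> X \<Longrightarrow> conn X x y"
  by (simp add: conn_def r_into_rtranclp)

lemma conn_trans [trans]: "conn X x y \<Longrightarrow> conn X y z \<Longrightarrow> conn X x z"
  unfolding conn_def by (rule rtranclp_trans)

lemma conn_sym: "conn X x y \<Longrightarrow> conn X y x"
  unfolding conn_def
proof (induction rule: rtranclp_induct)
  case (step y z)
  then have "{z, y} \<in> X" by (simp add: insert_commute)
  then show ?case using step.IH by (meson converse_rtranclp_into_rtranclp)
qed simp

lemma conn_induct [consumes 1, case_names refl step]:
  assumes "conn X x y" "P x"
    and "\<And>y z. conn X x y \<Longrightarrow> {y, z} \<in> X \<Longrightarrow> P y \<Longrightarrow> P z"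
  shows "P y"
  using assms(1)[unfolded conn_def]
proof (induction rule: rtranclp_induct)
  case base
  then show ?case by (rule assms(2))
next
  case (step y z)
  then show ?case using assms(3)[of y z] by (simp add: conn_def)
qed

lemma conn_hom:
  assumes "conn X x y" and "\<And>a b. {a, b} \<in> X \<Longrightarrow> conn Y (h a) (h b)"
  shows "conn Y (h x) (h y)"
  using assms(1)
proof (induction rule: conn_induct)
  case (step y z)
  then show ?case using assms(2) conn_trans by metis
qed simp

lemma conn_mono: "conn X x y \<Longrightarrow> X \<subseteq> Y \<Longrightarrow> conn Y x y"
  by (rule conn_hom[of X x y Y "\<lambda>x. x"]) (auto intro: conn_edge)

lemma conn_isolated:
  assumes "conn X x y" "x \<notin> \<Union>X"
  shows "x = y"
  using assms(1)
proof (induction rule: conn_induct)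
  case (step y z)
  then show ?case using assms(2) by auto
qed simp

lemma conn_Union_mem:
  assumes "conn X x y" "x \<noteq> y"
  shows "x \<in> \<Union>X" "y \<in> \<Union>X"
  using assms conn_isolated conn_sym by metis+

lemma conn_insert:
  "conn (insert {a, b} X) x y \<longleftrightarrow>
     conn X x y \<or> (conn X x a \<and> conn X b y) \<or> (conn X x b \<and> conn X a y)" (is "?L \<longleftrightarrow> ?R")
proof
  assume ?L
  then show ?R
  proof (induction rule: conn_induct)
    case (step y z)
    show ?case
    proof (cases "{y, z} \<in> X")
      case True
      then show ?thesis using step.IH conn_edge conn_trans by metis
    next
      case False
      then have "{y, z} = {a, b}" using step.hyps by auto
      then show ?thesis using step.IH conn_refl conn_sym conn_trans by (metis doubleton_eq_iff)
    qed
  qed simp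
next
  have ab: "conn (insert {a, b} X) a b" by (simp add: conn_edge)
  have mono: "conn X u v \<Longrightarrow> conn (insert {a, b} X) u v" for u v
    by (erule conn_mono) auto
  show "?R \<Longrightarrow> ?L"
    using ab mono conn_trans conn_sym by metis
qed

definition acy :: "'a set set \<Rightarrow> bool" where
  "acy X \<longleftrightarrow> (\<forall>a b. {a, b} \<in> X \<longrightarrow> \<not> conn (X - {{a, b}}) a b)"

lemma acy_empty [simp]: "acy {}"
  by (simp add: acy_def)

lemma acy_subset: "acy Y \<Longrightarrow> X \<subseteq> Y \<Longrightarrow> acy X"
  unfolding acy_def by (meson Diff_mono conn_mono order_refl subsetD)

lemma acy_insert:
  assumes "acy X" "\<not> conn X a b"
  shows "acy (insert {a, b} X)"
  unfolding acy_def
proof (intro allI impI notI)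
  fix u w
  assume uw: "{u, w} \<in> insert {a, b} X" and c: "conn (insert {a, b} X - {{u, w}}) u w"
  have nab: "{a, b} \<notin> X" using assms(2) conn_edge by metis
  show False
  proof (cases "{u, w} = {a, b}")
    case True
    then have "conn X u w" using c nab by (metis Diff_insert_absorb)
    then show False using True assms(2) conn_sym by (metis doubleton_eq_iff)
  next
    case False
    then have uwX: "{u, w} \<in> X" using uw by auto
    have "insert {a, b} X - {{u, w}} = insert {a, b} (X - {{u, w}})" using False by auto
    then have "conn (X - {{u, w}}) u w \<or> (conn (X - {{u, w}}) u a \<and> conn (X - {{u, w}}) b w)
        \<or> (conn (X - {{u, w}}) u b \<and> conn (X - {{u, w}}) a w)"
      using c conn_insert by metis
    moreover have mono: "conn X s t" if "conn (X - {{u, w}}) s t" for s t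
      using that by (rule conn_mono) auto
    moreover have uwc: "conn X u w" using uwX by (rule conn_edge)
    moreover have "\<not> conn (X - {{u, w}}) u w" using assms(1) uwX unfolding acy_def by blast
    moreover have "\<not> (conn X u a \<and> conn X b w)"
      using assms(2) conn_trans[OF conn_sym[of X u a] conn_trans[OF uwc conn_sym[of X b w]]] by blast
    moreover have "\<not> (conn X u b \<and> conn X a w)"
      using assms(2) conn_trans[OF _ conn_trans[OF conn_sym[OF uwc]], of a b] by blast
    ultimately show False by blast
  qed
qed

lemma acy_insertD:
  assumes "acy (insert {a, b} X)" "{a, b} \<notin> X"
  shows "\<not> conn X a b"
  using assms unfolding acy_def by (metis Diff_insert_absorb insertI1)

lemma acy_lift:
  assumes "acy (image h ` X)" "inj_on (image h) X"
  shows "acy X"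
  unfolding acy_def
proof (intro allI impI notI)
  fix a b assume ab: "{a, b} \<in> X" and c: "conn (X - {{a, b}}) a b"
  have "conn (image h ` X - {{h a, h b}}) (h a) (h b)"
    using c
  proof (rule conn_hom)
    fix s t assume st: "{s, t} \<in> X - {{a, b}}"
    then have "h ` {s, t} \<noteq> h ` {a, b}" using ab assms(2) unfolding inj_on_def by blast
    then have "{h s, h t} \<in> image h ` X - {{h a, h b}}" using st by (auto intro!: rev_image_eqI[of "{s,t}"])
    then show "conn (image h ` X - {{h a, h b}}) (h s) (h t)" by (rule conn_edge)
  qed
  moreover have "{h a, h b} \<in> image h ` X" using ab by (auto intro!: rev_image_eqI[of "{a,b}"])
  ultimately show False using assms(1) unfolding acy_def by blast
qed

text \<open>A path between two points of the same fibre would close up to a cycle in the image.\<close>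
lemma acy_lift_not_conn:
  assumes "acy (image h ` X)" "inj_on (image h) X" "conn X x y" "h x = h y"
  shows "x = y"
proof (rule ccontr)
  assume "x \<noteq> y"
  have aX: "acy X" using acy_lift assms by blast
  have "\<not> conn X x y \<or> (\<exists>u. {x, u} \<in> X \<and> conn (X - {{x, u}}) u y)" if "x \<noteq> y"
  proof -
    have "conn X x y \<Longrightarrow> x \<noteq> y \<Longrightarrow> \<exists>u. {x, u} \<in> X \<and> conn (X - {{x, u}}) u y"
    proof (induction rule: conn_induct)
      case (step y z)
      show ?case
      proof (cases "x = y")
        case True
        then show ?thesis using step by auto
      next
        case False
        then obtain u where u: "{x, u} \<in> X" "conn (X - {{x, u}}) u y" using step by auto
        show ?thesis
        proof (cases "{y, z} = {x, u}")
          case True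
          then show ?thesis using False step.prems by (auto simp: doubleton_eq_iff)
        next
          case ne: False
          then have "{y, z} \<in> X - {{x, u}}" using step by auto
          then show ?thesis using u conn_edge conn_trans by metis
        qed
      qed
    qed simp
    then show ?thesis using that by blast
  qed
  then obtain u where u: "{x, u} \<in> X" "conn (X - {{x, u}}) u y" using \<open>x \<noteq> y\<close> assms(3) by blast
  have "conn (image h ` X - {{h x, h u}}) (h u) (h y)"
    using u(2)
  proof (rule conn_hom)
    fix s t assume st: "{s, t} \<in> X - {{x, u}}"
    then have "h ` {s, t} \<noteq> h ` {x, u}" using u assms(2) unfolding inj_on_def by blast
    then have "{h s, h t} \<in> image h ` X - {{h x, h u}}" using st by (auto intro!: rev_image_eqI[of "{s,t}"])
    then show "conn (image h ` X - {{h x, h u}}) (h s) (h t)" by (rule conn_edge)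
  qed
  moreover have "{h x, h u} \<in> image h ` X" using u by (auto intro!: rev_image_eqI[of "{x,u}"])
  ultimately show False using assms(1,4) conn_sym unfolding acy_def by metis
qed

lemma acy_union:
  assumes "acy X" "acy Y" "finite X" and sh: "\<And>s t. s \<in> \<Union>X \<inter> \<Union>Y \<Longrightarrow> t \<in> \<Union>X \<inter> \<Union>Y \<Longrightarrow> conn Y s t \<Longrightarrow> s = t"
    and two: "\<And>e. e \<in> X \<Longrightarrow> \<exists>a b. e = {a, b}"
  shows "acy (X \<union> Y)"
proof -
  have "acy (X' \<union> Y)" if "X' \<subseteq> X" for X'
    using finite_subset[OF that assms(3)] that
  proof (induction X' rule: finite_induct)
    case empty
    then show ?case using assms(2) by simp
  next
    case (insert e X')
    then obtain a b where e: "e = {a, b}" using two by blast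
    have aX: "a \<in> \<Union>X" "b \<in> \<Union>X" using e insert.prems by auto
    have "acy (insert {a, b} X')" using insert.prems e acy_subset[OF assms(1)] by metis
    then have nc: "\<not> conn X' a b" using acy_insertD insert.hyps(2) e by metis
    have key: "\<exists>s\<in>\<Union>X. conn X' a s \<and> conn Y s z" if "conn (X' \<union> Y) a z" for z
      using that
    proof (induction rule: conn_induct)
      case refl
      then show ?case using aX by auto
    next
      case (step y z)
      then obtain s where s: "s \<in> \<Union>X" "conn X' a s" "conn Y s y" by blast
      show ?case
      proof (cases "{y, z} \<in> Y")
        case True
        then show ?thesis using s conn_edge conn_trans by metis
      next
        case False
        then have yz: "{y, z} \<in> X'" using step by auto
        then have yX: "y \<in> \<Union>X" "z \<in> \<Union>X" using insert.prems by auto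
        have "s = y"
        proof (rule ccontr)
          assume "s \<noteq> y"
          then show False using sh[of s y] s yX conn_Union_mem[OF s(3)] by blast
        qed
        then show ?thesis using s yX yz conn_edge conn_trans conn_refl by metis
      qed
    qed
    have "\<not> conn (X' \<union> Y) a b"
    proof
      assume "conn (X' \<union> Y) a b"
      from key[OF this] obtain s where s: "s \<in> \<Union>X" "conn X' a s" "conn Y s b" by (elim bexE conjE)
      have "s = b"
        using sh[of s b] s aX conn_Union_mem[OF s(3)] by blast
      then show False using s nc by simp
    qed
    then have "acy (insert {a, b} (X' \<union> Y))" using acy_insert insert.IH insert.prems by auto
    then show ?case using e by simp
  qed
  then show ?thesis by blast
qed

definition cc :: "'a set \<Rightarrow> 'a set set \<Rightarrow> nat" where
  "cc V X = card ((\<lambda>x. {y \<in> V. conn X x y}) ` V)"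

definition rk :: "'a set \<Rightarrow> 'a set set \<Rightarrow> nat" where
  "rk V X = card V - cc V X"

lemma cc_le: "finite V \<Longrightarrow> cc V X \<le> card V"
  unfolding cc_def by (rule card_image_le)

lemma cc_empty: "cc V {} = card V"
proof -
  have "conn {} x y \<longleftrightarrow> x = y" for x y :: 'a
    using conn_isolated[of "{}" x y] by auto
  then have "{y \<in> V. conn {} x y} = {x}" if "x \<in> V" for x using that by auto
  then have "(\<lambda>x. {y \<in> V. conn {} x y}) ` V = (\<lambda>x. {x}) ` V" by auto
  then show ?thesis unfolding cc_def by (simp add: card_image)
qed

lemma comp_eq_iff:
  assumes "x \<in> V" "y \<in> V"
  shows "{z \<in> V. conn X x z} = {z \<in> V. conn X y z} \<longleftrightarrow> conn X x y"
  using assms conn_sym conn_trans conn_refl by (smt (verit) Collect_cong mem_Collect_eq)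

lemma cc_insert_conn:
  assumes "conn X a b"
  shows "cc V (insert {a, b} X) = cc V X"
proof -
  have "conn (insert {a, b} X) x y \<longleftrightarrow> conn X x y" for x y
    using assms conn_insert conn_sym conn_trans by metis
  then show ?thesis unfolding cc_def by simp
qed

lemma card_image_eqI:
  assumes "\<And>x y. x \<in> U \<Longrightarrow> y \<in> U \<Longrightarrow> f x = f y \<longleftrightarrow> g x = g y"
  shows "card (f ` U) = card (g ` U)"
proof -
  define h where "h = (\<lambda>S. g (inv_into U f S))"
  have h: "h (f x) = g x" if "x \<in> U" for x
  proof -
    have "f x \<in> f ` U" using that by simp
    then show ?thesis unfolding h_def
      using assms[of "inv_into U f (f x)" x] inv_into_into[of "f x" f U] f_inv_into_f[of "f x" f U] that by blast
  qed
  have "inj_on h (f ` U)" using assms h by (auto simp: inj_on_def)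
  moreover have "h ` f ` U = g ` U" using h by (simp add: image_image)
  ultimately show ?thesis using card_image by fastforce
qed

lemma cc_insert_not_conn:
  assumes "\<not> conn X a b" "a \<in> V" "b \<in> V" "finite V"
  shows "cc V (insert {a, b} X) + 1 = cc V X"
proof -
  let ?Y = "insert {a, b} X"
  let ?f = "\<lambda>x. {y \<in> V. conn X x y}" and ?g = "\<lambda>x. {y \<in> V. conn ?Y x y}"
  let ?U = "{x \<in> V. \<not> conn X x b}"
  have XY: "conn X x y \<Longrightarrow> conn ?Y x y" for x y by (erule conn_mono) auto
  have nb: "\<not> conn X a b" "\<not> conn X b a" using assms conn_sym by metis+
  have 1: "?f ` V = insert (?f b) (?f ` ?U)"
  proof -
    have "?f x = ?f b" if "x \<in> V" "conn X x b" for x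
      using comp_eq_iff[of x V b X] that assms(3) by simp
    then have "?f x \<in> insert (?f b) (?f ` ?U)" if "x \<in> V" for x
      using that by (cases "conn X x b") simp_all
    then have "?f ` V \<subseteq> insert (?f b) (?f ` ?U)" by (rule image_subsetI)
    moreover have "insert (?f b) (?f ` ?U) \<subseteq> ?f ` V" using assms(3) by (intro insert_subsetI image_mono) auto
    ultimately show ?thesis by (rule equalityI)
  qed
  have 2: "?f b \<notin> ?f ` ?U"
  proof
    assume "?f b \<in> ?f ` ?U"
    then obtain x where x: "x \<in> V" "\<not> conn X x b" "?f b = ?f x" by blast
    then show False using comp_eq_iff[of b V x X] assms(3) conn_sym[of X b x] by simp
  qed
  have 3: "?g ` V = ?g ` ?U"
  proof -
    have a: "a \<in> ?U" using assms nb by simp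
    have "?g x = ?g a" if "x \<in> V" "conn X x b" for x
    proof -
      have "conn ?Y b a" by (rule conn_sym) (simp add: conn_edge)
      then have "conn ?Y x a" using conn_trans[OF XY[OF that(2)]] by blast
      then show ?thesis using comp_eq_iff[of x V a ?Y] that assms(2) by simp
    qed
    then have "?g x \<in> ?g ` ?U" if "x \<in> V" for x
      using that a by (cases "conn X x b") (simp_all add: rev_image_eqI)
    then have "?g ` V \<subseteq> ?g ` ?U" by (rule image_subsetI)
    moreover have "?g ` ?U \<subseteq> ?g ` V" by (intro image_mono) auto
    ultimately show ?thesis by (rule equalityI)
  qed
  have 4: "?g x = ?g y \<longleftrightarrow> ?f x = ?f y" if "x \<in> ?U" "y \<in> ?U" for x y
  proof -
    have "conn ?Y x y \<longleftrightarrow> conn X x y"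
      using that conn_insert[of a b X x y] conn_sym[of X] by blast
    then show ?thesis using comp_eq_iff[of x V y X] comp_eq_iff[of x V y ?Y] that by simp
  qed
  have 5: "card (?g ` ?U) = card (?f ` ?U)"
    by (rule card_image_eqI) (use 4 in simp)
  show ?thesis unfolding cc_def using 1 2 3 5 assms(4) by simp
qed

lemma rk_empty: "rk V {} = 0"
  by (simp add: rk_def cc_empty)

lemma rk_insert:
  assumes "a \<in> V" "b \<in> V" "finite V"
  shows "rk V (insert {a, b} X) = rk V X + (if conn X a b then 0 else 1)"
proof (cases "conn X a b")
  case True
  then show ?thesis by (simp add: rk_def cc_insert_conn)
next
  case False
  then show ?thesis
    using cc_insert_not_conn[OF False assms] cc_le[OF assms(3), of X] by (simp add: rk_def)
qed

definition edges_on :: "'a set \<Rightarrow> 'a set set \<Rightarrow> bool" where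
  "edges_on V X \<longleftrightarrow> (\<forall>e\<in>X. \<exists>a\<in>V. \<exists>b\<in>V. e = {a, b})"

lemma edges_on_subset: "edges_on V Y \<Longrightarrow> X \<subseteq> Y \<Longrightarrow> edges_on V X"
  unfolding edges_on_def by blast

lemma edges_on_insert: "edges_on V (insert e X) \<longleftrightarrow> (\<exists>a\<in>V. \<exists>b\<in>V. e = {a, b}) \<and> edges_on V X"
  unfolding edges_on_def by auto

lemma edges_on_finite: "edges_on V X \<Longrightarrow> finite V \<Longrightarrow> finite X"
  by (rule finite_subset[of X "Pow V"]) (auto simp: edges_on_def)

lemma rk_card_acy:
  assumes "edges_on V X" "finite V"
  shows "rk V X \<le> card X" "rk V X = card X \<longleftrightarrow> acy X"
proof -
  have "finite X" using assms edges_on_finite by blast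
  then have "rk V X \<le> card X \<and> (rk V X = card X \<longleftrightarrow> acy X)" using assms(1)
  proof (induction X rule: finite_induct)
    case empty
    then show ?case by (simp add: rk_empty)
  next
    case (insert e X)
    then obtain a b where ab: "a \<in> V" "b \<in> V" "e = {a, b}" by (auto simp: edges_on_insert)
    have eX: "edges_on V X" using insert.prems by (simp add: edges_on_insert)
    have IH: "rk V X \<le> card X" "rk V X = card X \<longleftrightarrow> acy X" using insert.IH eX by auto
    have r: "rk V (insert e X) = rk V X + (if conn X a b then 0 else 1)"
      using rk_insert[OF ab(1,2) assms(2)] ab(3) by simp
    have "acy (insert e X) \<longleftrightarrow> acy X \<and> \<not> conn X a b"
      using acy_insert acy_insertD acy_subset ab insert.hyps(2) by (metis subset_insertI)
    then show ?case using IH r insert.hyps by auto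
  qed
  then show "rk V X \<le> card X" "rk V X = card X \<longleftrightarrow> acy X" by auto
qed

lemma rk_mono_acy_extend:
  assumes "edges_on V Y" "finite V" "X \<subseteq> Y" "acy X"
  shows "\<exists>Z. X \<subseteq> Z \<and> Z \<subseteq> Y \<and> acy Z \<and> card Z = rk V Y"
proof -
  have fY: "finite Y" using assms edges_on_finite by blast
  let ?P = "\<lambda>Z. X \<subseteq> Z \<and> Z \<subseteq> Y \<and> acy Z"
  have "?P X" using assms by simp
  moreover have "\<forall>Z. ?P Z \<longrightarrow> card Z < Suc (card Y)" using fY by (simp add: card_mono le_imp_less_Suc)
  ultimately have "\<exists>Z. ?P Z \<and> (\<forall>Z'. ?P Z' \<longrightarrow> card Z' \<le> card Z)"
    by (rule ex_has_greatest_nat)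
  then obtain Z where PZ: "?P Z \<and> (\<forall>Z'. ?P Z' \<longrightarrow> card Z' \<le> card Z)"
    by (rule exE)
  then have Z: "X \<subseteq> Z" "Z \<subseteq> Y" "acy Z" and mx': "\<forall>Z'. ?P Z' \<longrightarrow> card Z' \<le> card Z"
    by simp_all
  have mx: "card Z' \<le> card Z" if "X \<subseteq> Z'" "Z' \<subseteq> Y" "acy Z'" for Z'
    using mx' that by simp
  have fZ: "finite Z" using Z fY finite_subset by blast
  have sp: "conn Z a b" if "{a, b} \<in> Y" for a b
  proof (rule ccontr)
    assume n: "\<not> conn Z a b"
    then have "acy (insert {a, b} Z)" "{a, b} \<notin> Z" using acy_insert Z conn_edge by metis+
    then show False using mx[of "insert {a, b} Z"] Z that fZ by auto
  qed
  have "rk V (Z \<union> W) = rk V Z" if "W \<subseteq> Y" for W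
    using finite_subset[OF that fY] that
  proof (induction W rule: finite_induct)
    case (insert e W)
    then obtain a b where ab: "a \<in> V" "b \<in> V" "e = {a, b}" using assms(1) unfolding edges_on_def by blast
    have "conn (Z \<union> W) a b" using sp[of a b] ab insert.prems by (auto intro: conn_mono)
    then have "rk V (insert {a, b} (Z \<union> W)) = rk V (Z \<union> W)"
      using rk_insert[OF ab(1,2) assms(2)] by simp
    then show ?case using insert ab by simp
  qed simp
  from this[OF order_refl] have "rk V Y = rk V Z" using Z by (simp add: Un_absorb1)
  moreover have "edges_on V Z" using edges_on_subset assms(1) Z by blast
  ultimately have "card Z = rk V Y" using rk_card_acy[of V Z] Z assms by simp
  then show ?thesis using Z by blast
qed

lemma rk_submodular:
  assumes "edges_on V X" "edges_on V Y" "finite V"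
  shows "rk V (X \<union> Y) + rk V (X \<inter> Y) \<le> rk V X + rk V Y"
proof -
  have "rk V (X \<union> (X \<inter> Y \<union> W)) + rk V (X \<inter> Y) \<le> rk V X + rk V (X \<inter> Y \<union> W)" if "W \<subseteq> Y - X" for W
  proof -
    have "finite W" using that assms edges_on_finite by (metis finite_Diff finite_subset)
    then show ?thesis using that
    proof (induction W rule: finite_induct)
      case empty
      then show ?case by (simp add: Un_absorb2)
    next
      case (insert e W)
      then obtain a b where ab: "a \<in> V" "b \<in> V" "e = {a, b}" using assms(2) unfolding edges_on_def by blast
      have 1: "rk V (insert e (X \<union> (X \<inter> Y \<union> W))) =
          rk V (X \<union> (X \<inter> Y \<union> W)) + (if conn (X \<union> (X \<inter> Y \<union> W)) a b then 0 else 1)"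
        using rk_insert[OF ab(1,2) assms(3)] ab(3) by simp
      have 2: "rk V (insert e (X \<inter> Y \<union> W)) = rk V (X \<inter> Y \<union> W) + (if conn (X \<inter> Y \<union> W) a b then 0 else 1)"
        using rk_insert[OF ab(1,2) assms(3)] ab(3) by simp
      have "conn (X \<inter> Y \<union> W) a b \<Longrightarrow> conn (X \<union> (X \<inter> Y \<union> W)) a b" by (erule conn_mono) auto
      then show ?case using 1 2 insert by (auto split: if_splits)
    qed
  qed
  moreover have "X \<union> (X \<inter> Y \<union> (Y - X)) = X \<union> Y" "X \<inter> Y \<union> (Y - X) = Y" by auto
  ultimately show ?thesis by (metis order_refl)
qed

lemma connected_card_le:
  assumes "edges_on V X" "finite V" "V \<noteq> {}" "\<And>x y. x \<in> V \<Longrightarrow> y \<in> V \<Longrightarrow> conn X x y"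
  shows "card V \<le> card X + 1" "card V = card X + 1 \<longleftrightarrow> acy X"
proof -
  obtain v where v: "v \<in> V" using assms(3) by blast
  have "(\<lambda>x. {y \<in> V. conn X x y}) ` V = {V}" using assms(4) v by auto
  then have "cc V X = 1" unfolding cc_def by simp
  moreover have "card V > 0" using assms by (simp add: card_gt_0_iff)
  ultimately have "rk V X + 1 = card V" unfolding rk_def by simp
  then show "card V \<le> card X + 1" "card V = card X + 1 \<longleftrightarrow> acy X"
    using rk_card_acy[OF assms(1,2)] by auto
qed

text \<open>Rado's shrinking argument: an undecided element can always be moved to one of the two sides.\<close>
lemma submodular_partition:
  fixes r1 r2 :: "'e set \<Rightarrow> nat"
  assumes fin: "finite E"
    and s1: "\<And>X Y. X \<subseteq> E \<Longrightarrow> Y \<subseteq> E \<Longrightarrow> r1 (X \<union> Y) + r1 (X \<inter> Y) \<le> r1 X + r1 Y"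
    and s2: "\<And>X Y. X \<subseteq> E \<Longrightarrow> Y \<subseteq> E \<Longrightarrow> r2 (X \<union> Y) + r2 (X \<inter> Y) \<le> r2 X + r2 Y"
    and cov: "\<And>B. B \<subseteq> E \<Longrightarrow> card B \<le> r1 B + r2 B"
    and z: "r1 {} = 0" "r2 {} = 0"
  shows "\<exists>X\<subseteq>E. card X \<le> r1 X \<and> card (E - X) \<le> r2 (E - X)"
proof -
  have "\<exists>X1 X2. X1 \<union> X2 = D \<and> X1 \<inter> X2 = {} \<and> (\<forall>B\<subseteq>E. card B \<le> r1 (B - X2) + r2 (B - X1))" if "D \<subseteq> E" for D
    using finite_subset[OF that fin] that
  proof (induction D rule: finite_induct)
    case empty
    then show ?case using cov by auto
  next
    case (insert e D)
    then obtain X1 X2 where X: "X1 \<union> X2 = D" "X1 \<inter> X2 = {}"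
      and c: "\<And>B. B \<subseteq> E \<Longrightarrow> card B \<le> r1 (B - X2) + r2 (B - X1)" by auto
    show ?case
    proof (rule ccontr)
      assume no: "\<not> ?case"
      have "\<not> (\<forall>B\<subseteq>E. card B \<le> r1 (B - insert e X2) + r2 (B - X1))"
      proof
        assume "\<forall>B\<subseteq>E. card B \<le> r1 (B - insert e X2) + r2 (B - X1)"
        moreover have "X1 \<union> insert e X2 = insert e D" "X1 \<inter> insert e X2 = {}" using X insert.hyps by auto
        ultimately show False using no by blast
      qed
      then obtain I where I: "I \<subseteq> E" "card I > r1 (I - insert e X2) + r2 (I - X1)"
        by (metis not_le)
      have "\<not> (\<forall>B\<subseteq>E. card B \<le> r1 (B - X2) + r2 (B - insert e X1))"
      proof
        assume "\<forall>B\<subseteq>E. card B \<le> r1 (B - X2) + r2 (B - insert e X1)"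
        moreover have "insert e X1 \<union> X2 = insert e D" "insert e X1 \<inter> X2 = {}" using X insert.hyps by auto
        ultimately show False using no by blast
      qed
      then obtain J where J: "J \<subseteq> E" "card J > r1 (J - X2) + r2 (J - insert e X1)"
        by (metis not_le)
      have eI: "e \<in> I"
      proof (rule ccontr)
        assume "e \<notin> I"
        then have "I - insert e X2 = I - X2" by auto
        then show False using I c[of I] by auto
      qed
      have eJ: "e \<in> J"
      proof (rule ccontr)
        assume "e \<notin> J"
        then have "J - insert e X1 = J - X1" by auto
        then show False using J c[of J] by auto
      qed
      have eq: "(I - insert e X2) \<union> (J - X2) = I \<union> J - X2" "(I - insert e X2) \<inter> (J - X2) = (I \<inter> J - {e}) - X2"
         "(I - X1) \<union> (J - insert e X1) = I \<union> J - X1" "(I - X1) \<inter> (J - insert e X1) = (I \<inter> J - {e}) - X1"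
        using eI eJ by auto
      have a: "r1 (I \<union> J - X2) + r1 ((I \<inter> J - {e}) - X2) \<le> r1 (I - insert e X2) + r1 (J - X2)"
        using s1[of "I - insert e X2" "J - X2", unfolded eq] I J by blast
      have b: "r2 (I \<union> J - X1) + r2 ((I \<inter> J - {e}) - X1) \<le> r2 (I - X1) + r2 (J - insert e X1)"
        using s2[of "I - X1" "J - insert e X1", unfolded eq] I J by blast
      have "card (I \<union> J) \<le> r1 (I \<union> J - X2) + r2 (I \<union> J - X1)"
           "card (I \<inter> J - {e}) \<le> r1 (I \<inter> J - {e} - X2) + r2 (I \<inter> J - {e} - X1)"
        using c[of "I \<union> J"] c[of "I \<inter> J - {e}"] I J by auto
      moreover have fIJ: "finite I" "finite J" using I(1) J(1) fin finite_subset by auto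
      moreover have "card (I \<inter> J - {e}) + 1 = card (I \<inter> J)"
        using card_Suc_Diff1[of "I \<inter> J" e] eI eJ fIJ by simp
      moreover have "card (I \<union> J) + card (I \<inter> J) = card I + card J"
        using card_Un_Int[OF fIJ] by simp
      ultimately show False using a b I J by linarith
    qed
  qed
  from this[OF order_refl] obtain X1 X2 where
    XX: "X1 \<union> X2 = E \<and> X1 \<inter> X2 = {} \<and> (\<forall>B\<subseteq>E. card B \<le> r1 (B - X2) + r2 (B - X1))"
    by (elim exE)
  then have X: "X1 \<union> X2 = E" "X1 \<inter> X2 = {}"
    and c: "\<And>B. B \<subseteq> E \<Longrightarrow> card B \<le> r1 (B - X2) + r2 (B - X1)" by simp_all
  have "X1 - X2 = X1" "X1 - X1 = {}" "X2 - X2 = {}" "X2 - X1 = X2" "E - X1 = X2" using X by auto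
  then have "card X1 \<le> r1 X1" "card (E - X1) \<le> r2 (E - X1)" using c[of X1] c[of X2] X z by auto
  then show ?thesis using X by blast
qed

section \<open>Two-coloured cycles and the splitting of a graph\<close>

text \<open>Every vertex \<open>u\<close> is split into copies \<open>(u, j)\<close>, one for each colour \<open>j\<close>, and an edge joins the two copies
  indexed by the colour of the opposite end. For a proper \<open>c\<close> the cycles of the split graph are exactly the
  two-coloured cycles.\<close>
definition spl :: "('a \<Rightarrow> 'c) \<Rightarrow> 'a set \<Rightarrow> ('a \<times> 'c) set" where
  "spl c e = {(u, c v) | u v. e = {u, v}}"

lemma spl_pair [simp]: "spl c {u, v} = {(u, c v), (v, c u)}"
  unfolding spl_def by (auto simp: doubleton_eq_iff)

lemma mem_spl: "(x, j) \<in> spl c e \<longleftrightarrow> (\<exists>y. e = {x, y} \<and> j = c y)"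
  unfolding spl_def by auto

lemma mem_Union_spl: "(x, j) \<in> \<Union> (spl c ` F) \<longleftrightarrow> (\<exists>y. {x, y} \<in> F \<and> j = c y)"
  by (auto simp: mem_spl)

lemma spl_edgeD:
  assumes "{(a, i), (b, k)} \<in> spl c ` F"
  shows "{a, b} \<in> F" "i = c b" "k = c a"
proof -
  obtain e where e: "e \<in> F" "spl c e = {(a, i), (b, k)}" using assms by auto
  then have "(a, i) \<in> spl c e" by simp
  then obtain y where y: "e = {a, y}" "i = c y" unfolding mem_spl by blast
  then have "{(a, c y), (y, c a)} = {(a, i), (b, k)}" using e by simp
  then have "b = y" "k = c a" using y by (auto simp: doubleton_eq_iff)
  then show "{a, b} \<in> F" "i = c b" "k = c a" using y e by auto
qed

lemma fst_spl:
  assumes "card e = 2"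
  shows "fst ` spl c e = e"
proof -
  obtain x y where "e = {x, y}" using assms unfolding card_2_iff by (elim exE conjE)
  then show ?thesis by simp
qed

lemma spl_inj: "inj_on (spl c) {e. card e = 2}"
proof (rule inj_onI)
  fix d e :: "'a set"
  assume de: "d \<in> {e. card e = 2}" "e \<in> {e. card e = 2}" and eq: "spl c d = spl c e"
  have "fst ` spl c d = d" "fst ` spl c e = e" using de by (simp_all add: fst_spl)
  then show "d = e" using eq by metis
qed

lemma conn_spl_pair:
  assumes "conn (spl c ` F) (u, j) (w, l)"
  shows "{c u, j} = {c w, l}"
proof -
  have "conn (spl c ` F) s t \<Longrightarrow> {c (fst s), snd s} = {c (fst t), snd t}" for s t
  proof (induction rule: conn_induct)
    case (step y z)
    obtain a i b k where "y = (a, i)" "z = (b, k)" by (cases y, cases z)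
    then show ?case using step spl_edgeD[of a i b k c F] by auto
  qed simp
  from this[OF assms] show ?thesis by simp
qed

definition col_acy :: "('a \<Rightarrow> 'c) \<Rightarrow> 'a set set \<Rightarrow> bool" where
  "col_acy c F \<longleftrightarrow> acy (spl c ` F)"

lemma col_acy_subset: "col_acy c F \<Longrightarrow> F' \<subseteq> F \<Longrightarrow> col_acy c F'"
  unfolding col_acy_def by (erule acy_subset) (rule image_mono)

lemma col_acy_insert:
  assumes "col_acy c F" "\<not> conn (spl c ` F) (u, c v) (v, c u)"
  shows "col_acy c (insert {u, v} F)"
  using acy_insert[OF assms[unfolded col_acy_def]] unfolding col_acy_def by simp

lemma col_acy_insert_isolated:
  assumes "col_acy c F" "\<And>y. {u, y} \<in> F \<Longrightarrow> c y \<noteq> c v" "u \<noteq> v"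
  shows "col_acy c (insert {u, v} F)"
proof (rule col_acy_insert[OF assms(1)])
  have "(u, c v) \<notin> \<Union> (spl c ` F)"
  proof
    assume "(u, c v) \<in> \<Union> (spl c ` F)"
    then obtain y where "{u, y} \<in> F" "c v = c y" unfolding mem_Union_spl by (elim exE conjE)
    then show False using assms(2)[of y] by simp
  qed
  then show "\<not> conn (spl c ` F) (u, c v) (v, c u)"
    using conn_isolated[of "spl c ` F" "(u, c v)" "(v, c u)"] assms(3) by auto
qed

lemma col_acy_star:
  assumes "finite N" "col_acy c F" "inj_on c N" "v \<notin> N"
    and "\<And>u y. u \<in> N \<Longrightarrow> {v, y} \<in> F \<Longrightarrow> c y \<noteq> c u"
  shows "col_acy c (F \<union> (\<lambda>u. {v, u}) ` N)"
  using assms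
proof (induction N rule: finite_induct)
  case (insert u N)
  have "col_acy c (F \<union> (\<lambda>u. {v, u}) ` N)" using insert.prems by (intro insert.IH) auto
  moreover have "c y \<noteq> c u" if "{v, y} \<in> F \<union> (\<lambda>u. {v, u}) ` N" for y
    using that insert.prems insert.hyps by (auto simp: doubleton_eq_iff inj_on_def)
  ultimately have "col_acy c (insert {v, u} (F \<union> (\<lambda>u. {v, u}) ` N))"
    using insert.prems by (intro col_acy_insert_isolated) auto
  then show ?case by simp
qed simp

lemma col_acy_star_unique:
  assumes "finite N" "col_acy c F" "\<And>u. u \<in> N \<Longrightarrow> c u \<noteq> c v" "\<And>x. x \<in> \<Union>F \<Longrightarrow> c x \<noteq> c v"
  shows "col_acy c (F \<union> (\<lambda>u. {v, u}) ` N)"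
  using assms
proof (induction N rule: finite_induct)
  case (insert u N)
  have "col_acy c (F \<union> (\<lambda>u. {v, u}) ` N)" using insert.prems by (intro insert.IH) auto
  moreover have "c y \<noteq> c v" if "{u, y} \<in> F \<union> (\<lambda>u. {v, u}) ` N" for y
  proof (cases "{u, y} \<in> F")
    case True
    then have "y \<in> \<Union>F" by blast
    then show ?thesis by (rule insert.prems(3))
  next
    case False
    then show ?thesis using that insert.prems(2) insert.hyps by (auto simp: doubleton_eq_iff)
  qed
  ultimately have "col_acy c (insert {u, v} (F \<union> (\<lambda>u. {v, u}) ` N))"
    using insert.prems by (intro col_acy_insert_isolated) auto
  then show ?case by (simp add: insert_commute)
qed simp

lemma col_acy_inj:
  assumes "inj_on c K" "\<And>e. e \<in> X \<Longrightarrow> e \<subseteq> K \<and> card e = 2"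
  shows "col_acy c X"
  unfolding col_acy_def acy_def
proof (intro allI impI)
  fix s t assume st: "{s, t} \<in> spl c ` X"
  obtain u i v j where "s = (u, i)" "t = (v, j)" by (cases s, cases t)
  note [simp] = this
  have uv: "{u, v} \<in> X" "i = c v" "j = c u" using spl_edgeD[of u i v j c X] st by auto
  then have "u \<noteq> v" using assms(2)[of "{u, v}"] by auto
  have "s \<notin> \<Union> (spl c ` X - {{s, t}})"
  proof
    assume "s \<in> \<Union> (spl c ` X - {{s, t}})"
    then obtain e where e: "e \<in> X" "(u, i) \<in> spl c e" "spl c e \<noteq> {s, t}"
      unfolding \<open>s = (u, i)\<close> by blast
    then obtain y where y: "e = {u, y}" "i = c y" unfolding mem_spl by blast
    then have "y = v" using assms uv e(1) inj_onD[OF assms(1), of y v] by force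
    then show False using e y uv by simp
  qed
  then show "\<not> conn (spl c ` X - {{s, t}}) s t"
    using conn_isolated[of _ s t] \<open>u \<noteq> v\<close> by auto
qed

lemma spl_hom:
  assumes "inj_on (image h) F" "\<And>x. x \<in> \<Union>F \<Longrightarrow> c' (h x) = c x"
    and "\<And>e. e \<in> F \<Longrightarrow> card e = 2 \<and> card (h ` e) = 2"
  shows "image (\<lambda>(u, j). (h u, j)) ` (spl c ` F) = spl c' ` (image h ` F)"
    and "inj_on (image (\<lambda>(u, j). (h u, j))) (spl c ` F)"
proof -
  let ?hh = "image (\<lambda>(u, j). (h u, j))"
  have eq: "?hh (spl c e) = spl c' (h ` e)" if eF: "e \<in> F" for e
  proof -
    obtain u v where e: "e = {u, v}" using assms(3)[OF eF] by (auto simp: card_2_iff)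
    have "u \<in> \<Union>F" "v \<in> \<Union>F" using eF e by auto
    then have "c' (h u) = c u" "c' (h v) = c v" using assms(2) by simp_all
    then show ?thesis using e by simp
  qed
  show "?hh ` (spl c ` F) = spl c' ` (image h ` F)"
    unfolding image_image[of ?hh] image_image[of "spl c'"] by (rule image_cong) (use eq in auto)
  show "inj_on ?hh (spl c ` F)"
  proof (rule inj_onI)
    fix s t assume "s \<in> spl c ` F" "t \<in> spl c ` F" and st: "?hh s = ?hh t"
    then obtain d e where de: "d \<in> F" "e \<in> F" "s = spl c d" "t = spl c e" by auto
    then have "spl c' (h ` d) = spl c' (h ` e)" using st eq by simp
    moreover have "h ` d \<in> {e. card e = 2}" "h ` e \<in> {e. card e = 2}" using assms(3) de by simp_all
    ultimately have "h ` d = h ` e" by (rule inj_onD[OF spl_inj])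
    then have "d = e" using de by (intro inj_onD[OF assms(1)])
    then show "s = t" using de by simp
  qed
qed

lemma col_acy_lift:
  assumes "col_acy c' (image h ` F)" "inj_on (image h) F" "\<And>x. x \<in> \<Union>F \<Longrightarrow> c' (h x) = c x"
    and "\<And>e. e \<in> F \<Longrightarrow> card e = 2 \<and> card (h ` e) = 2"
  shows "col_acy c F"
  unfolding col_acy_def
  by (rule acy_lift[of "\<lambda>(u, j). (h u, j)"])
    (use assms(1) spl_hom[of h F c' c, OF assms(2,3,4)] in \<open>simp_all add: col_acy_def\<close>)

lemma col_acy_lift_not_conn:
  assumes "col_acy c' (image h ` F)" "inj_on (image h) F" "\<And>x. x \<in> \<Union>F \<Longrightarrow> c' (h x) = c x"
    and "\<And>e. e \<in> F \<Longrightarrow> card e = 2 \<and> card (h ` e) = 2"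
    and "x \<noteq> y" "h x = h y"
  shows "\<not> conn (spl c ` F) (x, j) (y, j)"
  using acy_lift_not_conn[of "\<lambda>(u, j). (h u, j)" "spl c ` F" "(x, j)" "(y, j)"]
    assms(1,5,6) spl_hom[of h F c' c, OF assms(2,3,4)] by (auto simp: col_acy_def)

text \<open>With \<^term>\<open>H\<close> the edge set of a graph on \<^term>\<open>W\<close>, this says \<open>m(G, c) \<le> n - k\<close>.\<close>
definition good :: "'a set \<Rightarrow> 'a set set \<Rightarrow> ('a \<Rightarrow> 'c) \<Rightarrow> bool" where
  "good W H c \<longleftrightarrow> (\<exists>F\<subseteq>H. col_acy c F \<and> card H + card (c ` W) \<le> card F + card W)"

lemma good_subset:
  assumes "good W H c" "H' \<subseteq> H" "finite H"
  shows "good W H' c"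
proof -
  obtain F where F: "F \<subseteq> H" "col_acy c F" "card H + card (c ` W) \<le> card F + card W"
    using assms(1) unfolding good_def by blast
  have fF: "finite F" "finite H'" using F assms finite_subset by auto
  have "F - H' \<subseteq> H - H'" using F by auto
  then have "card (F - H') \<le> card (H - H')" using assms by (simp add: card_mono)
  moreover have "card (F - H') = card F - card (F \<inter> H')" "card (F \<inter> H') \<le> card F"
    using fF by (simp_all add: card_Diff_subset_Int card_mono)
  moreover have "card (H - H') = card H - card H'" "card H' \<le> card H"
    using assms fF by (simp_all add: card_Diff_subset card_mono)
  ultimately have "card H' + card (c ` W) \<le> card (F \<inter> H') + card W" using F by linarith
  moreover have "col_acy c (F \<inter> H')" using F col_acy_subset by blast
  ultimately show ?thesis unfolding good_def by blast
qed

lemma good_transport: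
  assumes "good V E (c \<circ> h)" "inj_on h V" "\<And>e. e \<in> E \<Longrightarrow> e \<subseteq> V \<and> card e = 2"
  shows "good (h ` V) (image h ` E) c"
proof -
  obtain F where F: "F \<subseteq> E" "col_acy (c \<circ> h) F" "card E + card ((c \<circ> h) ` V) \<le> card F + card V"
    using assms(1) unfolding good_def by blast
  have injE: "inj_on (image h) E"
    using assms(2,3) by (meson PowI inj_on_image_Pow inj_on_subset subsetI)
  let ?g = "inv_into V h"
  have gh: "?g ` (h ` e) = e" if "e \<in> E" for e
    using assms(2) assms(3)[OF that] by (simp add: inv_into_image_cancel)
  have c2: "card (h ` e) = 2" if "e \<in> E" for e
    using assms(3)[OF that] card_image inj_on_subset[OF assms(2)] by metis
  have gF: "image ?g ` image h ` F = F"
  proof -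
    have "image ?g ` image h ` F = (\<lambda>e. e) ` F"
      unfolding image_image[of "image ?g"] by (rule image_cong) (use gh F(1) in auto)
    then show ?thesis by simp
  qed
  have "col_acy c (image h ` F)"
  proof (rule col_acy_lift[where h = ?g and c' = "c \<circ> h"])
    show "col_acy (c \<circ> h) (image ?g ` image h ` F)" using F gF by simp
    show "inj_on (image ?g) (image h ` F)"
      using gh F(1) by (intro inj_onI) (metis imageE subsetD)
    show "(c \<circ> h) (?g x) = c x" if "x \<in> \<Union> (image h ` F)" for x
    proof -
      have "x \<in> h ` V" using that F(1) assms(3) by auto
      then show ?thesis by (simp add: f_inv_into_f)
    qed
    show "card e = 2 \<and> card (?g ` e) = 2" if "e \<in> image h ` F" for e
      using that c2 gh assms(3) F(1) by auto
  qed
  moreover have "image h ` F \<subseteq> image h ` E" using F by auto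
  moreover have "card (image h ` E) = card E" "card (image h ` F) = card F" "card (h ` V) = card V"
    using injE assms(2) F(1) card_image inj_on_subset by metis+
  moreover have "c ` h ` V = (c \<circ> h) ` V" by auto
  ultimately show ?thesis unfolding good_def using F(3) by (metis (no_types, lifting))
qed

lemma good_add_vertex:
  assumes "finite V" "v \<in> V" "\<And>e. e \<in> E' \<Longrightarrow> e \<subseteq> V - {v} \<and> card e = 2" "good (V - {v}) E' c"
    and N: "N \<subseteq> V - {v}" "\<And>u. u \<in> N \<Longrightarrow> c u \<noteq> c v"
    and N': "N' \<subseteq> N" "inj_on c N'" "card N \<le> card N' + 1"
  shows "good V (E' \<union> (\<lambda>u. {v, u}) ` N) c"
proof -
  obtain F where F: "F \<subseteq> E'" "col_acy c F" "card E' + card (c ` (V - {v})) \<le> card F + card (V - {v})"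
    using assms(4) unfolding good_def by blast
  have fE: "finite E'" using assms(1,3) finite_subset[of E' "Pow V"] by blast
  have fN: "finite N" using finite_subset[OF N(1)] assms(1) by simp
  have fN: "finite N" "finite N'" "finite F"
    using fN finite_subset[OF N'(1)] finite_subset[OF F(1) fE] by simp_all
  have inj: "inj_on (\<lambda>u. {v, u}) M" for M by (auto simp: inj_on_def doubleton_eq_iff)
  have card_star: "card (X \<union> (\<lambda>u. {v, u}) ` M) = card X + card M" if "X \<subseteq> E'" "M \<subseteq> N" for X M
  proof -
    have "X \<inter> (\<lambda>u. {v, u}) ` M = {}" using that assms(3) by blast
    moreover have "finite X" "finite M" using that fE fN finite_subset by auto
    ultimately show ?thesis using card_image[OF inj] by (simp add: card_Un_disjoint)
  qed
  have vF: "v \<notin> \<Union>F" using F(1) assms(3) by blast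
  have cV: "card V = card (V - {v}) + 1" using assms(1,2) by (metis Suc_eq_plus1 card_Suc_Diff1)
  show ?thesis
  proof (cases "c v \<in> c ` (V - {v})")
    case True
    then have "c ` V = c ` (V - {v})" using assms(2) by auto
    moreover have "col_acy c (F \<union> (\<lambda>u. {v, u}) ` N')"
      using N N' vF F fN by (intro col_acy_star) auto
    moreover have "F \<union> (\<lambda>u. {v, u}) ` N' \<subseteq> E' \<union> (\<lambda>u. {v, u}) ` N" using F N' by auto
    ultimately show ?thesis
      unfolding good_def using card_star[of E' N] card_star[of F N'] F N' cV
      by (intro exI[of _ "F \<union> (\<lambda>u. {v, u}) ` N'"]) auto
  next
    case False
    have "c ` V = insert (c v) (c ` (V - {v}))" using assms(2) by auto
    then have "card (c ` V) = card (c ` (V - {v})) + 1" using False assms(1) by simp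
    moreover have "col_acy c (F \<union> (\<lambda>u. {v, u}) ` N)"
    proof (rule col_acy_star_unique[OF fN(1) F(2) N(2)])
      show "c x \<noteq> c v" if "x \<in> \<Union>F" for x
      proof -
        have "x \<in> V - {v}" using that F(1) assms(3) by blast
        then show ?thesis using False by (metis imageI)
      qed
    qed
    moreover have "F \<union> (\<lambda>u. {v, u}) ` N \<subseteq> E' \<union> (\<lambda>u. {v, u}) ` N" using F by auto
    ultimately show ?thesis
      unfolding good_def using card_star[of E' N] card_star[of F N] F cV
      by (intro exI[of _ "F \<union> (\<lambda>u. {v, u}) ` N"]) auto
  qed
qed

lemma good_clique_sum:
  assumes fin: "finite W1" "finite W2"
    and H1: "\<And>e. e \<in> H1 \<Longrightarrow> e \<subseteq> W1 \<and> card e = 2" and H2: "\<And>e. e \<in> H2 \<Longrightarrow> e \<subseteq> W2 \<and> card e = 2"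
    and good: "good W1 H1 c" "good W2 H2 c"
    and inj: "inj_on c (W1 \<inter> W2)"
    and K: "\<And>e. e \<subseteq> W1 \<inter> W2 \<Longrightarrow> card e = 2 \<Longrightarrow> e \<in> H1 \<inter> H2"
  shows "good (W1 \<union> W2) (H1 \<union> H2) c"
proof -
  let ?K = "H1 \<inter> H2"
  obtain F1 where F1: "F1 \<subseteq> H1" "col_acy c F1" "card H1 + card (c ` W1) \<le> card F1 + card W1"
    using good(1) unfolding good_def by blast
  obtain F2 where F2: "F2 \<subseteq> H2" "col_acy c F2" "card H2 + card (c ` W2) \<le> card F2 + card W2"
    using good(2) unfolding good_def by blast
  have fH: "finite H1" "finite H2"
    using finite_subset[of H1 "Pow W1"] finite_subset[of H2 "Pow W2"] H1 H2 fin by blast+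
  have fF: "finite F1" "finite F2" using finite_subset[OF F1(1)] finite_subset[OF F2(1)] fH by simp_all
  have KK: "e \<subseteq> W1 \<inter> W2 \<and> card e = 2" if "e \<in> ?K" for e using H1 H2 that by blast
  have cK: "col_acy c ?K" by (rule col_acy_inj[OF inj KK])
  let ?S = "W2 \<times> c ` W2"
  have eS: "edges_on ?S (spl c ` H2)"
    unfolding edges_on_def
  proof
    fix s assume "s \<in> spl c ` H2"
    then obtain e where e: "e \<in> H2" "s = spl c e" by blast
    have "card e = 2" "e \<subseteq> W2" using H2 e by auto
    then obtain x y where "e = {x, y}" "x \<in> W2" "y \<in> W2" by (auto simp: card_2_iff)
    then show "\<exists>a\<in>?S. \<exists>b\<in>?S. s = {a, b}"
      using e by (intro bexI[of _ "(x, c y)"] bexI[of _ "(y, c x)"]) auto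
  qed
  have fS: "finite ?S" using fin by simp
  have spl_inj_H2: "inj_on (spl c) H2" by (rule inj_on_subset[OF spl_inj]) (use H2 in auto)
  obtain Z where Z: "spl c ` ?K \<subseteq> Z" "Z \<subseteq> spl c ` H2" "acy Z" "card Z = rk ?S (spl c ` H2)"
    using rk_mono_acy_extend[OF eS fS, of "spl c ` ?K"] cK unfolding col_acy_def by blast
  obtain Z' where Z': "spl c ` F2 \<subseteq> Z'" "Z' \<subseteq> spl c ` H2" "card Z' = rk ?S (spl c ` H2)"
    using rk_mono_acy_extend[OF eS fS, of "spl c ` F2"] F2 unfolding col_acy_def by blast
  have "card F2 \<le> card Z"
  proof -
    have "card (spl c ` F2) = card F2" by (rule card_image) (rule inj_on_subset[OF spl_inj_H2 F2(1)])
    moreover have "card (spl c ` F2) \<le> card Z'"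
      by (rule card_mono) (use Z' fH finite_subset[of Z'] in auto)
    ultimately show ?thesis using Z(4) Z'(3) by simp
  qed
  obtain G where G: "G \<subseteq> H2" "Z = spl c ` G" using Z(2) by (auto simp: subset_image_iff)
  have cardG: "card F2 \<le> card G"
    using \<open>card F2 \<le> card Z\<close> card_image[OF inj_on_subset[OF spl_inj_H2 G(1)]] G(2) by simp
  have KG: "?K \<subseteq> G"
  proof
    fix e assume e: "e \<in> ?K"
    then have "spl c e \<in> spl c ` G" using Z(1) G(2) by auto
    then obtain d where d: "d \<in> G" "spl c e = spl c d" by auto
    have "e = d" by (rule inj_onD[OF spl_inj_H2 d(2)]) (use e d G in auto)
    then show "e \<in> G" using d by simp
  qed
  have fG: "finite G" using finite_subset[OF G(1)] fH by simp
  let ?F = "F1 \<union> (G - ?K)"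
  have "acy (spl c ` F1 \<union> spl c ` (G - ?K))"
  proof (rule acy_union)
    show "acy (spl c ` F1)" using F1 by (simp add: col_acy_def)
    show "acy (spl c ` (G - ?K))" by (rule acy_subset[of Z]) (use Z G in auto)
    show "finite (spl c ` F1)" using fF by simp
    show "\<exists>a b. e = {a, b}" if sF1: "e \<in> spl c ` F1" for e
    proof -
      obtain d where d: "d \<in> F1" "e = spl c d" using sF1 by (elim imageE)
      have "card d = 2" using H1 F1(1) d by auto
      then obtain x y where "d = {x, y}" by (auto simp: card_2_iff)
      then show ?thesis using d by auto
    qed
    fix s t assume s: "s \<in> \<Union> (spl c ` F1) \<inter> \<Union> (spl c ` (G - ?K))"
      and t: "t \<in> \<Union> (spl c ` F1) \<inter> \<Union> (spl c ` (G - ?K))" and co: "conn (spl c ` (G - ?K)) s t"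
    have sh: "fst s \<in> W1 \<inter> W2" if "s \<in> \<Union> (spl c ` F1) \<inter> \<Union> (spl c ` (G - ?K))" for s
    proof -
      obtain x j where s: "s = (x, j)" by (cases s)
      have "(x, j) \<in> \<Union> (spl c ` F1)" "(x, j) \<in> \<Union> (spl c ` (G - ?K))" using that s by simp_all
      then obtain y y' where "{x, y} \<in> F1" "{x, y'} \<in> G - ?K" unfolding mem_Union_spl by blast
      then have "{x, y} \<in> H1" "{x, y'} \<in> H2" using F1(1) G(1) by auto
      then have "{x, y} \<subseteq> W1" "{x, y'} \<subseteq> W2" using H1[of "{x, y}"] H2[of "{x, y'}"] by simp_all
      then show ?thesis using s by simp
    qed
    obtain x j y l where xy: "s = (x, j)" "t = (y, l)" by (cases s, cases t)
    have xW: "x \<in> W1 \<inter> W2" "y \<in> W1 \<inter> W2" using sh[OF s] sh[OF t] xy by simp_all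
    have pair: "{c x, j} = {c y, l}" using conn_spl_pair[of c "G - ?K" x j y l] co xy by simp
    show "s = t"
    proof (cases "x = y")
      case True
      then show ?thesis using pair xy by (auto simp: doubleton_eq_iff)
    next
      case False
      then have "c x \<noteq> c y" using inj xW by (auto simp: inj_on_def)
      then have jl: "j = c y" "l = c x" using pair by (auto simp: doubleton_eq_iff)
      have e: "{x, y} \<in> ?K" using K[of "{x, y}"] xW False by auto
      have "spl c ` (G - ?K) \<subseteq> Z - {spl c {x, y}}"
      proof
        fix z assume "z \<in> spl c ` (G - ?K)"
        then obtain d where d: "d \<in> G" "d \<notin> ?K" "z = spl c d" by blast
        have "z \<noteq> spl c {x, y}"
        proof
          assume "z = spl c {x, y}"
          then have "d = {x, y}" using d G(1) e by (intro inj_onD[OF spl_inj_H2]) auto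
          then show False using d e by simp
        qed
        then show "z \<in> Z - {spl c {x, y}}" using d G by simp
      qed
      with co have "conn (Z - {spl c {x, y}}) s t" by (rule conn_mono)
      moreover have "spl c {x, y} = {s, t}" using xy jl by simp
      moreover have "spl c {x, y} \<in> Z" using Z(1) e by (intro subsetD[OF Z(1)] imageI)
      ultimately show ?thesis using Z(3) unfolding acy_def by metis
    qed
  qed
  then have "col_acy c ?F" unfolding col_acy_def image_Un .
  moreover have "?F \<subseteq> H1 \<union> H2" using F1 G by auto
  moreover have "card (H1 \<union> H2) + card (c ` (W1 \<union> W2)) \<le> card ?F + card (W1 \<union> W2)"
  proof -
    have "F1 \<inter> (G - ?K) = {}" using F1(1) G(1) by auto
    then have "card ?F = card F1 + card (G - ?K)" using fF fG by (simp add: card_Un_disjoint)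
    moreover have "card (G - ?K) + card ?K = card G"
      using card_Diff_subset[of ?K G] KG fG fH card_mono[OF fG KG] by simp
    moreover have "card (H1 \<union> H2) + card ?K = card H1 + card H2" using card_Un_Int[OF fH] by simp
    moreover have "card (W1 \<union> W2) + card (W1 \<inter> W2) = card W1 + card W2" using card_Un_Int[OF fin] by simp
    moreover have "card (c ` (W1 \<union> W2)) + card (W1 \<inter> W2) \<le> card (c ` W1) + card (c ` W2)"
    proof -
      have "card (c ` W1 \<union> c ` W2) + card (c ` W1 \<inter> c ` W2) = card (c ` W1) + card (c ` W2)"
        using card_Un_Int[of "c ` W1" "c ` W2"] fin by simp
      moreover have "card (c ` (W1 \<inter> W2)) \<le> card (c ` W1 \<inter> c ` W2)"
        using fin by (intro card_mono) auto
      ultimately show ?thesis using card_image[OF inj] by (simp add: image_Un)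
    qed
    ultimately show ?thesis using F1(3) F2(3) cardG by linarith
  qed
  ultimately show ?thesis unfolding good_def by blast
qed

lemma good_merge:
  fixes c :: "'a \<Rightarrow> 'c"
  defines "h \<equiv> \<lambda>a1 a2 x. if x = a2 then a1 else x"
  assumes "finite V" "v \<in> V" and E': "\<And>e. e \<in> E' \<Longrightarrow> e \<subseteq> V - {v} \<and> card e = 2"
    and pr: "\<And>x y. {x, y} \<in> E' \<Longrightarrow> c x \<noteq> c y"
    and a: "a1 \<in> N" "a2 \<in> N" "a1 \<noteq> a2" "c a1 = c a2"
    and gd: "good (h a1 a2 ` (V - {v})) (image (h a1 a2) ` E') c"
    and N: "N \<subseteq> V - {v}" "\<And>u. u \<in> N \<Longrightarrow> c u \<noteq> c v"
    and b: "b \<in> N" "{a1, b} \<in> E'" "{a2, b} \<in> E'"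
    and W: "card {w. {a1, w} \<in> E' \<and> {a2, w} \<in> E'} \<le> 2"
    and N': "N' \<subseteq> N - {a2}" "a1 \<in> N'" "inj_on c N'"
      "card {w. {a1, w} \<in> E' \<and> {a2, w} \<in> E'} + card N \<le> card N' + 4"
  shows "good V (E' \<union> (\<lambda>u. {v, u}) ` N) c"
proof -
  let ?h = "h a1 a2"
  let ?V1 = "?h ` (V - {v})"
  let ?H = "image ?h ` E'"
  let ?W = "{w. {a1, w} \<in> E' \<and> {a2, w} \<in> E'}"
  have hsimp: "?h x = (if x = a2 then a1 else x)" for x by (simp add: h_def)
  have aV: "a1 \<in> V - {v}" "a2 \<in> V - {v}" using a N by auto
  have V1: "?V1 = V - {v, a2}" using aV a by (auto simp: hsimp image_iff)
  have cV: "card V = card ?V1 + 2"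
  proof -
    have "card (V - {v, a2}) = card V - 2" using aV assms(3) by (subst card_Diff_subset) auto
    moreover have "card {v, a2} \<le> card V" using aV assms(2,3) by (intro card_mono) auto
    ultimately show ?thesis using V1 aV by auto
  qed
  have ch: "c (?h x) = c x" for x using a by (simp add: hsimp)
  have hcol: "c ` ?V1 = c ` (V - {v})" using ch by (simp add: image_image)
  obtain F1 where F1: "F1 \<subseteq> ?H" "col_acy c F1" "card ?H + card (c ` ?V1) \<le> card F1 + card ?V1"
    using gd unfolding good_def by blast
  obtain F where F: "F \<subseteq> E'" "inj_on (image ?h) F" "F1 = image ?h ` F"
    using F1(1) by (auto simp: subset_image_inj)
  have fE: "finite E'" using assms(2) E' finite_subset[of E' "Pow V"] by blast
  have fin: "finite N" using finite_subset[OF N(1)] assms(2) by simp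
  have fin: "finite N" "finite N'" "finite F"
    using fin finite_subset[OF N'(1)] finite_subset[OF F(1) fE] by simp_all
  have h2: "card e = 2 \<and> card (?h ` e) = 2" if "e \<in> E'" for e
  proof -
    have "card e = 2" using E' that by simp
    then obtain x y where e: "e = {x, y}" "x \<noteq> y" by (auto simp: card_2_iff)
    have "c (?h x) \<noteq> c (?h y)" using pr e that ch by metis
    then have "?h x \<noteq> ?h y" by metis
    then show ?thesis using e by simp
  qed
  have ca: "col_acy c F"
    by (rule col_acy_lift[where h = ?h and c' = c]) (use F1 F ch h2 in auto)
  have nc: "\<not> conn (spl c ` F) (a1, j) (a2, j)" for j
    by (rule col_acy_lift_not_conn[where h = ?h and c' = c]) (use F1 F ch h2 a in \<open>auto simp: hsimp\<close>)
  have cardE: "card E' \<le> card ?H + card ?W"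
  proof -
    let ?D = "(\<lambda>w. {a2, w}) ` ?W"
    have inj: "inj_on (image ?h) (E' - ?D)"
    proof (rule inj_onI)
      fix d e assume de: "d \<in> E' - ?D" "e \<in> E' - ?D" "?h ` d = ?h ` e"
      have key: "a2 \<notin> e" if "d \<in> E'" "e \<in> E' - ?D" "?h ` d = ?h ` e" "a2 \<notin> d" for d e
      proof
        assume "a2 \<in> e"
        moreover have "card e = 2" using E' that(2) by simp
        ultimately obtain w where w: "e = {a2, w}" by (auto simp: card_2_iff)
        have "w \<noteq> a2" using w that E'[of e] by auto
        have "?h ` d = d" using that(4) by (auto simp: hsimp image_iff)
        moreover have "?h ` e = {a1, w}"
          unfolding w image_insert image_empty using \<open>w \<noteq> a2\<close> by (simp only: hsimp if_True if_False simp_thms)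
        ultimately have "d = {a1, w}" using that(3) by simp
        then show False using that w by auto
      qed
      show "d = e"
      proof (cases "a2 \<in> d \<or> a2 \<in> e")
        case True
        then have a2: "a2 \<in> d" "a2 \<in> e" using key[of d e] key[of e d] de by auto
        have "\<exists>w. d = {a2, w} \<and> w \<noteq> a2" "\<exists>w. e = {a2, w} \<and> w \<noteq> a2"
          using a2 E'[of d] E'[of e] de by (auto simp: card_2_iff)
        then obtain w x where w: "d = {a2, w}" "w \<noteq> a2" and x: "e = {a2, x}" "x \<noteq> a2" by blast
        have "{w, a1} = {x, a1}"
          using de(3) w x by (simp add: hsimp insert_commute)
        then show ?thesis using w x by (auto simp: doubleton_eq_iff)
      next
        case False
        then have "?h ` d = d" "?h ` e = e" by (auto simp: hsimp image_iff)
        then show ?thesis using de(3) by metis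
      qed
    qed
    have "card (E' - ?D) \<le> card ?H"
      using card_image[OF inj] card_mono[of ?H "image ?h ` (E' - ?D)"] fE by auto
    moreover have "finite ?W"
    proof (rule finite_subset)
      show "?W \<subseteq> \<Union>E'" by auto
      show "finite (\<Union>E')" using E' assms(2) finite_subset[of "\<Union>E'" V] by blast
    qed
    then have "finite ?D" "card ?D \<le> card ?W" by (auto intro: card_image_le)
    moreover have "card E' \<le> card (E' - ?D) + card ?D"
      using card_Un_le[of "E' - ?D" ?D] card_mono[of "(E' - ?D) \<union> ?D" E'] fE \<open>finite ?D\<close> by auto
    ultimately show ?thesis by linarith
  qed
  have "\<exists>e. e \<in> E' - F \<and> col_acy c (insert e F) \<and> \<not> conn (spl c ` (insert e F)) (a1, c v) (a2, c v)"
  proof -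
    have "\<exists>x\<in>{a1, a2}. \<not> conn (spl c ` F) (x, c b) (b, c x)"
      using nc[of "c b"] conn_trans[of _ "(a1, c b)" "(b, c a1)" "(a2, c b)"] conn_sym a(4) by (metis insertCI)
    then obtain x where x: "x \<in> {a1, a2}" "\<not> conn (spl c ` F) (x, c b) (b, c x)" by blast
    have "{x, b} \<notin> F"
    proof
      assume "{x, b} \<in> F"
      then have "spl c {x, b} \<in> spl c ` F" by (rule imageI)
      then show False using x(2) conn_edge[of "(x, c b)" "(b, c x)"] by simp
    qed
    moreover have "{x, b} \<in> E'" using x b by auto
    moreover have "col_acy c (insert {x, b} F)" using col_acy_insert[OF ca x(2)] .
    moreover have "\<not> conn (spl c ` (insert {x, b} F)) (a1, c v) (a2, c v)"
    proof
      assume "conn (spl c ` (insert {x, b} F)) (a1, c v) (a2, c v)"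
      then have "conn (insert {(x, c b), (b, c x)} (spl c ` F)) (a1, c v) (a2, c v)" by simp
      then have "conn (spl c ` F) (a1, c v) (x, c b) \<or> conn (spl c ` F) (a1, c v) (b, c x)"
        unfolding conn_insert using nc by blast
      then have "{c a1, c v} = {c x, c b} \<or> {c a1, c v} = {c b, c x}"
        using conn_spl_pair by metis
      moreover have "c x = c a1" "c b \<noteq> c v" "c a1 \<noteq> c v" using x a N b by auto
      ultimately show False by (auto simp: doubleton_eq_iff)
    qed
    ultimately show ?thesis by blast
  qed
  then obtain e where e: "e \<in> E' - F" and ca': "col_acy c (insert e F)"
    and nc': "\<not> conn (spl c ` (insert e F)) (a1, c v) (a2, c v)" by blast
  let ?F = "insert e F"
  have F': "?F \<subseteq> E'" "finite ?F" "card ?F = card F1 + 1"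
    using e F fin card_image[OF F(2)] by auto
  have vF: "v \<notin> \<Union>?F" using F' E' by blast
  have inj: "inj_on (\<lambda>u. {v, u}) M" for M by (auto simp: inj_on_def doubleton_eq_iff)
  have card_star: "card (X \<union> (\<lambda>u. {v, u}) ` M) = card X + card M" if "X \<subseteq> E'" "M \<subseteq> N" for X M
  proof -
    have "X \<inter> (\<lambda>u. {v, u}) ` M = {}" using that E' by blast
    moreover have "finite X" "finite M" using that fE fin finite_subset by auto
    ultimately show ?thesis using card_image[OF inj] by (simp add: card_Un_disjoint)
  qed
  have cE: "card (E' \<union> (\<lambda>u. {v, u}) ` N) = card E' + card N" using card_star by blast
  show ?thesis
  proof (cases "c v \<in> c ` (V - {v})")
    case True
    then have cc: "c ` V = c ` ?V1" using assms(3) hcol by auto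
    have 1: "col_acy c (insert {v, a1} ?F)"
      using ca' vF aV by (intro col_acy_insert_isolated) auto
    have 2: "col_acy c (insert {a2, v} (insert {v, a1} ?F))"
    proof (rule col_acy_insert[OF 1])
      have iso: "(v, c a2) \<notin> \<Union> (spl c ` ?F)" using vF unfolding mem_Union_spl by blast
      have "\<not> conn (spl c ` ?F) (v, c a1) (a2, c v)" "\<not> conn (spl c ` ?F) (a2, c v) (v, c a1)"
        using iso conn_isolated[of "spl c ` ?F" "(v, c a1)" "(a2, c v)"] conn_sym[of "spl c ` ?F"] a aV by auto
      then show "\<not> conn (spl c ` insert {v, a1} ?F) (a2, c v) (v, c a2)"
        using nc' conn_sym[of "spl c ` ?F" "(a2, c v)" "(a1, c v)"] a(4)
        unfolding image_insert[of "spl c" "{v, a1}"] spl_pair conn_insert by auto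
    qed
    let ?G = "insert {a2, v} (insert {v, a1} ?F) \<union> (\<lambda>u. {v, u}) ` (N' - {a1})"
    have "col_acy c ?G"
    proof (rule col_acy_star)
      show "finite (N' - {a1})" "inj_on c (N' - {a1})" "v \<notin> N' - {a1}"
        using fin N N' inj_on_subset[OF N'(3)] by auto
      show "col_acy c (insert {a2, v} (insert {v, a1} ?F))" by (rule 2)
      show "c y \<noteq> c u" if "u \<in> N' - {a1}" "{v, y} \<in> insert {a2, v} (insert {v, a1} ?F)" for u y
      proof -
        have "y = a1 \<or> y = a2" using that(2) vF by (auto simp: doubleton_eq_iff)
        then show ?thesis using that N'(2,3) a(4) by (auto simp: inj_on_def)
      qed
    qed
    moreover have Geq: "?G = ?F \<union> (\<lambda>u. {v, u}) ` (insert a2 N')" using N' by (auto simp: insert_commute)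
    moreover have "card ?G = card F1 + 1 + card N' + 1"
    proof -
      have "insert a2 N' \<subseteq> N" "a2 \<notin> N'" using N'(1) a by auto
      then show ?thesis unfolding Geq using card_star[of ?F "insert a2 N'"] F' fin by simp
    qed
    moreover have "?G \<subseteq> E' \<union> (\<lambda>u. {v, u}) ` N" unfolding Geq using F' N' a by auto
    ultimately show ?thesis unfolding good_def using cc cE cardE cV F1(3) N'(4)
      by (intro exI[of _ ?G]) auto
  next
    case False
    have "c ` V = insert (c v) (c ` (V - {v}))" using assms(3) by auto
    then have cc: "card (c ` V) = card (c ` ?V1) + 1" using False assms(2) hcol by simp
    let ?G = "?F \<union> (\<lambda>u. {v, u}) ` N"
    have "col_acy c ?G"
    proof (rule col_acy_star_unique[OF fin(1) ca' N(2)])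
      show "c x \<noteq> c v" if "x \<in> \<Union>?F" for x
      proof -
        have "x \<in> V - {v}" using that F'(1) E' by blast
        then show ?thesis using False by (metis imageI)
      qed
    qed
    moreover have "card ?G = card F1 + 1 + card N" using card_star[of ?F N] F' by simp
    moreover have "?G \<subseteq> E' \<union> (\<lambda>u. {v, u}) ` N" using F' by auto
    ultimately show ?thesis unfolding good_def using cc cE cardE cV F1(3) W
      by (intro exI[of _ ?G]) auto
  qed
qed

section \<open>Triangulated spheres\<close>

definition tri_edges :: "'b set set \<Rightarrow> 'b set set" where
  "tri_edges T = {e. card e = 2 \<and> (\<exists>f\<in>T. e \<subseteq> f)}"

definition linked :: "'b set set \<Rightarrow> 'b set set \<Rightarrow> bool" where
  "linked T C \<longleftrightarrow> (\<forall>A\<subseteq>T. A \<noteq> {} \<and> A \<noteq> T \<longrightarrow>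
     (\<exists>f\<in>A. \<exists>g\<in>T - A. \<exists>e. card e = 2 \<and> e \<subseteq> f \<and> e \<subseteq> g \<and> e \<notin> C))"

definition surface :: "'b set set \<Rightarrow> bool" where
  "surface T \<longleftrightarrow> finite T \<and> T \<noteq> {} \<and> (\<forall>f\<in>T. card f = 3) \<and>
     (\<forall>e\<in>tri_edges T. card {f \<in> T. e \<subseteq> f} = 2) \<and> linked T {}"

definition sphere :: "'b set set \<Rightarrow> bool" where
  "sphere T \<longleftrightarrow> surface T \<and> card T + 4 = 2 * card (\<Union>T)"

lemma third_vertex:
  assumes "card g = 3" "{a, b} \<subseteq> g" "a \<noteq> b"
  obtains z where "g = {a, b, z}" "z \<noteq> a" "z \<noteq> b"
proof -
  have "card (g - {a, b}) = 1" using assms by (subst card_Diff_subset) auto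
  then obtain z where "g - {a, b} = {z}" by (auto simp: card_1_singleton_iff)
  then have "g = {a, b, z}" "z \<noteq> a" "z \<noteq> b" using assms by auto
  then show ?thesis using that by blast
qed

lemma card_three: "a \<noteq> b \<Longrightarrow> a \<noteq> c \<Longrightarrow> b \<noteq> c \<Longrightarrow> card {a, b, c} = 3"
  by simp

lemma third_face_eq:
  assumes "finite T" "card {f \<in> T. e \<subseteq> f} \<le> 2" "f \<in> T" "g \<in> T" "h \<in> T" "e \<subseteq> f" "e \<subseteq> g" "e \<subseteq> h" "f \<noteq> g"
  shows "h = f \<or> h = g"
proof (rule ccontr)
  assume "\<not> (h = f \<or> h = g)"
  then have "card {f, g, h} = 3" using assms(9) by (metis card_three)
  moreover have "card {f, g, h} \<le> card {f \<in> T. e \<subseteq> f}"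
    using assms by (intro card_mono) auto
  ultimately show False using assms(2) by simp
qed

lemma tri_edgesI: "card e = 2 \<Longrightarrow> e \<subseteq> f \<Longrightarrow> f \<in> T \<Longrightarrow> e \<in> tri_edges T"
  unfolding tri_edges_def by blast

lemma tri_edges_mono: "A \<subseteq> B \<Longrightarrow> tri_edges A \<subseteq> tri_edges B"
  unfolding tri_edges_def by blast

lemma edges_on_tri_edges: "edges_on (\<Union>T) (tri_edges T)"
proof -
  have "\<exists>a\<in>\<Union>T. \<exists>b\<in>\<Union>T. e = {a, b}" if e: "e \<in> tri_edges T" for e
  proof -
    obtain f where f: "f \<in> T" "e \<subseteq> f" "card e = 2" using e unfolding tri_edges_def by blast
    then obtain a b where "e = {a, b}" by (auto simp: card_2_iff)
    then show ?thesis using f by blast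
  qed
  then show ?thesis unfolding edges_on_def by (rule ballI)
qed

lemma finite_Union_faces: "finite T \<Longrightarrow> (\<And>f. f \<in> T \<Longrightarrow> card f = 3) \<Longrightarrow> finite (\<Union>T)"
  by (rule finite_Union) (auto intro: card_ge_0_finite)

text \<open>The edges crossed by a spanning tree of the dual graph can be removed without disconnecting
  the vertices: walk around the face that was attached through the removed edge.\<close>
lemma dual_tree:
  assumes fin: "finite T" and ne: "T \<noteq> {}" and c3: "\<And>f. f \<in> T \<Longrightarrow> card f = 3"
    and le2: "\<And>e. card e = 2 \<Longrightarrow> card {f \<in> T. e \<subseteq> f} \<le> 2" and li: "linked T C"
  shows "\<exists>S\<subseteq>tri_edges T. S \<inter> C = {} \<and> card S + 1 = card T \<and> (\<forall>e\<in>S. card {f \<in> T. e \<subseteq> f} = 2) \<and>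
           (\<forall>x\<in>\<Union>T. \<forall>y\<in>\<Union>T. conn (tri_edges T - S) x y)"
proof -
  define Q where "Q = (\<lambda>n A S. A \<subseteq> T \<and> card A = n \<and> S \<subseteq> tri_edges A \<and> S \<inter> C = {} \<and> finite S \<and> card S + 1 = n \<and>
      (\<forall>e\<in>S. \<exists>f\<in>A. \<exists>g\<in>A. f \<noteq> g \<and> e \<subseteq> f \<and> e \<subseteq> g) \<and> (\<forall>x\<in>\<Union>A. \<forall>y\<in>\<Union>A. conn (tri_edges A - S) x y))"
  have step: "\<exists>A S. Q n A S" if "1 \<le> n" "n \<le> card T" for n
    using that
  proof (induction n rule: nat_induct_at_least)
    case base
    obtain f where f: "f \<in> T" using ne by blast
    have "conn (tri_edges {f}) x y" if "x \<in> f" "y \<in> f" for x y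
      using that by (cases "x = y") (auto intro!: conn_edge simp: tri_edges_def)
    then have "Q 1 {f} {}" unfolding Q_def using f by auto
    then show ?case by blast
  next
    case (Suc n)
    obtain A S where "Q n A S" using Suc by auto
    then have A: "A \<subseteq> T" "card A = n" and S: "S \<subseteq> tri_edges A" "S \<inter> C = {}" "finite S" "card S + 1 = n"
      and S2: "\<And>e. e \<in> S \<Longrightarrow> \<exists>f\<in>A. \<exists>g\<in>A. f \<noteq> g \<and> e \<subseteq> f \<and> e \<subseteq> g"
      and co: "\<And>x y. x \<in> \<Union>A \<Longrightarrow> y \<in> \<Union>A \<Longrightarrow> conn (tri_edges A - S) x y"
      unfolding Q_def by auto
    have "A \<noteq> {}" "A \<noteq> T" using A Suc.hyps Suc.prems by auto
    then have "\<exists>f\<in>A. \<exists>g\<in>T - A. \<exists>e. card e = 2 \<and> e \<subseteq> f \<and> e \<subseteq> g \<and> e \<notin> C"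
      using li[unfolded linked_def, rule_format, OF A(1)] by simp
    then obtain f g e where fg: "f \<in> A" "g \<in> T" "g \<notin> A" "card e = 2" "e \<subseteq> f" "e \<subseteq> g" "e \<notin> C"
      by auto
    obtain a b where e: "e = {a, b}" "a \<noteq> b" using fg(4) by (auto simp: card_2_iff)
    obtain z where g: "g = {a, b, z}" "z \<noteq> a" "z \<noteq> b"
      using third_vertex[of g a b] c3[OF fg(2)] fg(6) e by blast
    have notS: "d \<notin> S" if "d \<subseteq> g" for d
    proof
      assume d: "d \<in> S"
      from S2[OF this] obtain f1 f2 where ff: "f1 \<in> A" "f2 \<in> A" "f1 \<noteq> f2" "d \<subseteq> f1" "d \<subseteq> f2"
        by (elim bexE conjE)
      have "card d = 2" using d S(1) unfolding tri_edges_def by blast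
      then have "g = f1 \<or> g = f2"
        using third_face_eq[OF fin le2, of d f1 f2 g] ff A(1) fg(2) that by blast
      then show False using ff fg(3) by blast
    qed
    let ?A = "insert g A" and ?S = "insert e S"
    have AB: "tri_edges A \<subseteq> tri_edges ?A" by (rule tri_edges_mono) auto
    have gz: "{a, z} \<in> tri_edges ?A - ?S" "{b, z} \<in> tri_edges ?A - ?S"
      using notS[of "{a, z}"] notS[of "{b, z}"] g e by (auto simp: tri_edges_def doubleton_eq_iff)
    let ?Y = "tri_edges ?A - ?S"
    have az: "conn ?Y a z" "conn ?Y b z" using gz by (simp_all only: conn_edge)
    have cA: "conn ?Y x y" if "x \<in> \<Union>A" "y \<in> \<Union>A" for x y
    proof (rule conn_hom[OF co[OF that], where h = "\<lambda>x. x"])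
      fix p q assume pq: "{p, q} \<in> tri_edges A - S"
      show "conn ?Y p q"
      proof (cases "{p, q} = e")
        case True
        then have "p = a \<and> q = b \<or> p = b \<and> q = a" using e by (auto simp: doubleton_eq_iff)
        then show ?thesis
          using conn_trans[OF az(1) conn_sym[OF az(2)]] conn_trans[OF az(2) conn_sym[OF az(1)]] by auto
      next
        case False
        then show ?thesis using pq AB by (intro conn_edge) auto
      qed
    qed
    have aA: "a \<in> \<Union>A" using fg e by auto
    have toa: "conn ?Y x a" if "x \<in> \<Union>?A" for x
    proof (cases "x \<in> \<Union>A")
      case True
      then show ?thesis using cA aA by blast
    next
      case False
      then have "x = z" using that g fg(1,5) e by auto
      then show ?thesis using az conn_sym by metis
    qed
    have fA: "finite A" using A(1) fin finite_subset by blast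
    have "Q (Suc n) ?A ?S"
      unfolding Q_def
    proof (intro conjI ballI)
      show "?A \<subseteq> T" "card ?A = Suc n" using A fg fA by auto
      show "?S \<subseteq> tri_edges ?A" using S(1) AB fg unfolding tri_edges_def by auto
      show "?S \<inter> C = {}" "finite ?S" using S fg by auto
      show "card ?S + 1 = Suc n" using S notS[OF fg(6)] by simp
      show "\<exists>f\<in>?A. \<exists>h\<in>?A. f \<noteq> h \<and> d \<subseteq> f \<and> d \<subseteq> h" if "d \<in> ?S" for d
      proof (cases "d = e")
        case True
        then show ?thesis using fg by (intro bexI[of _ f] bexI[of _ g]) auto
      next
        case False
        then show ?thesis using S2[of d] that by blast
      qed
      show "conn ?Y x y" if "x \<in> \<Union>?A" "y \<in> \<Union>?A" for x y
        using conn_trans[OF toa[OF that(1)] conn_sym[OF toa[OF that(2)]]] .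
    qed
    then show ?case by blast
  qed
  have "1 \<le> card T" using fin ne by (simp add: Suc_leI card_gt_0_iff)
  then obtain A S where Q: "Q (card T) A S" using step by blast
  then have "A \<subseteq> T" "card A = card T" unfolding Q_def by simp_all
  then have AT: "A = T" using card_subset_eq[OF fin] by simp
  have "card {f \<in> T. e \<subseteq> f} = 2" if eS: "e \<in> S" for e
  proof -
    obtain f g where fg: "f \<in> T" "g \<in> T" "f \<noteq> g" "e \<subseteq> f" "e \<subseteq> g" using Q eS AT unfolding Q_def by meson
    have "S \<subseteq> tri_edges T" using Q AT unfolding Q_def by simp
    then have "card e = 2" using eS unfolding tri_edges_def by auto
    then have "card {f \<in> T. e \<subseteq> f} \<le> 2" by (rule le2)
    moreover have "card {f, g} \<le> card {f \<in> T. e \<subseteq> f}" using fin fg by (intro card_mono) auto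
    ultimately show ?thesis using fg by simp
  qed
  then show ?thesis using Q AT unfolding Q_def by (intro exI[of _ S]) auto
qed

lemma dual_treeE:
  assumes "finite T" "T \<noteq> {}" "\<And>f. f \<in> T \<Longrightarrow> card f = 3"
    and "\<And>e. card e = 2 \<Longrightarrow> card {f \<in> T. e \<subseteq> f} \<le> 2" "linked T C"
  obtains D where "D \<subseteq> tri_edges T" "D \<inter> C = {}" "card D + 1 = card T"
    "\<And>x y. x \<in> \<Union>T \<Longrightarrow> y \<in> \<Union>T \<Longrightarrow> conn (tri_edges T - D) x y"
proof -
  have "\<exists>S\<subseteq>tri_edges T. S \<inter> C = {} \<and> card S + 1 = card T \<and> (\<forall>e\<in>S. card {f \<in> T. e \<subseteq> f} = 2) \<and>
           (\<forall>x\<in>\<Union>T. \<forall>y\<in>\<Union>T. conn (tri_edges T - S) x y)"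
    by (rule dual_tree) (use assms in simp_all)
  then obtain D where D: "D \<subseteq> tri_edges T" "D \<inter> C = {}" "card D + 1 = card T"
    and co: "\<forall>x\<in>\<Union>T. \<forall>y\<in>\<Union>T. conn (tri_edges T - D) x y" by (elim exE conjE)
  show ?thesis by (rule that[OF D]) (use co in blast)
qed

lemma surfaceD:
  assumes "surface T"
  shows "finite T" "T \<noteq> {}" "f \<in> T \<Longrightarrow> card f = 3" "e \<in> tri_edges T \<Longrightarrow> card {f \<in> T. e \<subseteq> f} = 2"
    "linked T {}" "finite (\<Union>T)" "finite (tri_edges T)"
proof -
  show 1: "finite T" "T \<noteq> {}" "f \<in> T \<Longrightarrow> card f = 3" "e \<in> tri_edges T \<Longrightarrow> card {f \<in> T. e \<subseteq> f} = 2"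
    "linked T {}" for f e using assms unfolding surface_def by auto
  show "finite (\<Union>T)" using finite_Union_faces 1 by blast
  then show "finite (tri_edges T)" using edges_on_finite edges_on_tri_edges by blast
qed

lemma surface_le2:
  assumes "surface T" "card e = 2"
  shows "card {f \<in> T. e \<subseteq> f} \<le> 2"
proof (cases "e \<in> tri_edges T")
  case True
  then show ?thesis using surfaceD(4)[OF assms(1)] by simp
next
  case False
  then have "{f \<in> T. e \<subseteq> f} = {}" using assms(2) unfolding tri_edges_def by auto
  then show ?thesis by (simp only: card.empty)
qed

lemma other_face:
  assumes "surface T" "f \<in> T" "e \<subseteq> f" "card e = 2"
  obtains g where "g \<in> T" "g \<noteq> f" "e \<subseteq> g" "\<And>h. h \<in> T \<Longrightarrow> e \<subseteq> h \<Longrightarrow> h = f \<or> h = g"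
proof -
  have "card {f \<in> T. e \<subseteq> f} = 2" using surfaceD(4)[OF assms(1)] tri_edgesI assms by metis
  then obtain x y where xy: "{f \<in> T. e \<subseteq> f} = {x, y}" "x \<noteq> y" by (auto simp: card_2_iff)
  have "f \<in> {f \<in> T. e \<subseteq> f}" using assms by simp
  then have "f = x \<or> f = y" using xy(1) by simp
  then have "\<exists>g. {f \<in> T. e \<subseteq> f} = {f, g} \<and> g \<noteq> f"
  proof
    assume "f = x"
    then show ?thesis using xy by (intro exI[of _ y]) simp
  next
    assume "f = y"
    then show ?thesis using xy by (intro exI[of _ x]) (simp add: insert_commute)
  qed
  then obtain g where g: "{f \<in> T. e \<subseteq> f} = {f, g}" "g \<noteq> f" by (elim exE conjE)
  then have "g \<in> {f \<in> T. e \<subseteq> f}" by simp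
  then have "g \<in> T" "e \<subseteq> g" by simp_all
  moreover have "h = f \<or> h = g" if "h \<in> T" "e \<subseteq> h" for h
  proof -
    have "h \<in> {f \<in> T. e \<subseteq> f}" using that by simp
    then show ?thesis using g by simp
  qed
  ultimately show ?thesis using that g by blast
qed

lemma card_tri_edges:
  assumes "surface T"
  shows "2 * card (tri_edges T) = 3 * card T"
proof -
  note S = surfaceD[OF assms]
  have k: "\<forall>f\<in>T. card {e \<in> tri_edges T. e \<subseteq> f} = 3"
  proof
    fix f assume f: "f \<in> T"
    have "{e \<in> tri_edges T. e \<subseteq> f} = {e. e \<subseteq> f \<and> card e = 2}" using f unfolding tri_edges_def by blast
    moreover have "finite f" using S(3)[OF f] by (auto intro: card_ge_0_finite)
    ultimately show "card {e \<in> tri_edges T. e \<subseteq> f} = 3" using n_subsets[of f 2] S(3)[OF f] by (simp add: choose_two)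
  qed
  have "(\<Sum>e\<in>tri_edges T. card {f \<in> T. e \<subseteq> f}) = (\<Sum>f\<in>T. 3)"
    by (rule sum_multicount_gen) (use S k in auto)
  moreover have "(\<Sum>e\<in>tri_edges T. card {f \<in> T. e \<subseteq> f}) = (\<Sum>e\<in>tri_edges T. 2)"
    by (rule sum.cong) (use S in auto)
  ultimately show ?thesis by simp
qed

lemma euler_le:
  assumes "surface T"
  shows "2 * card (\<Union>T) \<le> card T + 4"
proof -
  note S = surfaceD[OF assms]
  obtain D where D: "D \<subseteq> tri_edges T" "card D + 1 = card T"
     "\<And>x y. x \<in> \<Union>T \<Longrightarrow> y \<in> \<Union>T \<Longrightarrow> conn (tri_edges T - D) x y"
    using dual_treeE[OF S(1,2,3) surface_le2[OF assms] S(5)] by metis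
  have "edges_on (\<Union>T) (tri_edges T - D)" using edges_on_subset[OF edges_on_tri_edges] by blast
  moreover have "\<Union>T \<noteq> {}" using S(2,3) by fastforce
  ultimately have "card (\<Union>T) \<le> card (tri_edges T - D) + 1" using connected_card_le(1) S(6) D(3) by blast
  moreover have "card (tri_edges T - D) + card D = card (tri_edges T)"
    using D(1) S(7) by (metis card_Diff_subset card_mono finite_subset le_add_diff_inverse2)
  ultimately show ?thesis using D(2) card_tri_edges[OF assms] by linarith
qed

definition bd :: "'b set set \<Rightarrow> 'b set set \<Rightarrow> 'b set set" where
  "bd T A = {e. card e = 2 \<and> (\<exists>f\<in>A. e \<subseteq> f) \<and> (\<exists>g\<in>T - A. e \<subseteq> g)}"

lemma bd_sub: "A \<subseteq> T \<Longrightarrow> bd T A \<subseteq> tri_edges T"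
  unfolding bd_def tri_edges_def by blast

lemma surface_eqI:
  assumes "surface T" "A \<subseteq> T" "A \<noteq> {}" "bd T A = {}"
  shows "A = T"
proof (rule ccontr)
  assume "A \<noteq> T"
  then have "\<exists>f\<in>A. \<exists>g\<in>T - A. \<exists>e. card e = 2 \<and> e \<subseteq> f \<and> e \<subseteq> g \<and> e \<notin> {}"
    using surfaceD(5)[OF assms(1), unfolded linked_def, rule_format, OF assms(2)] assms(3) by simp
  then have "\<exists>e. e \<in> bd T A" unfolding bd_def by blast
  then show False using assms(4) by simp
qed

lemma bd_even:
  assumes "surface T" "A \<subseteq> T"
  shows "even (card {e \<in> bd T A. x \<in> e})"
proof -
  note S = surfaceD[OF assms(1)]
  let ?s = "{e \<in> tri_edges T. x \<in> e}" and ?t = "{f \<in> A. x \<in> f}"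
  have fA: "finite A" using assms(2) S(1) finite_subset by blast
  have k: "\<forall>f\<in>?t. card {e \<in> ?s. e \<subseteq> f} = 2"
  proof
    fix f assume f: "f \<in> ?t"
    then have "card (f - {x}) = 2" using S(3) assms(2) by (subst card_Diff_singleton) auto
    then obtain y z where yz: "f - {x} = {y, z}" "y \<noteq> z" by (auto simp: card_2_iff)
    then have fe: "f = {x, y, z}" "y \<noteq> x" "z \<noteq> x" using f by auto
    have fT: "f \<in> T" using f assms(2) by auto
    have "{e \<in> ?s. e \<subseteq> f} = {{x, y}, {x, z}}"
    proof (intro equalityI subsetI)
      fix e assume e: "e \<in> {e \<in> ?s. e \<subseteq> f}"
      then have "card e = 2" unfolding tri_edges_def by blast
      then obtain w where "e = {x, w}" "w \<noteq> x" using e by (auto simp: card_2_iff)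
      then show "e \<in> {{x, y}, {x, z}}" using e fe by auto
    next
      fix e assume "e \<in> {{x, y}, {x, z}}"
      then have "card e = 2 \<and> e \<subseteq> f \<and> x \<in> e" using fe by auto
      then show "e \<in> {e \<in> ?s. e \<subseteq> f}" using fT unfolding tri_edges_def by blast
    qed
    then show "card {e \<in> ?s. e \<subseteq> f} = 2" using yz by (simp add: doubleton_eq_iff)
  qed
  have "(\<Sum>e\<in>?s. card {f \<in> ?t. e \<subseteq> f}) = (\<Sum>f\<in>?t. 2)"
    by (rule sum_multicount_gen) (use S fA k in auto)
  then have "even (\<Sum>e\<in>?s. card {f \<in> ?t. e \<subseteq> f})" by simp
  then have "even (card {e \<in> ?s. odd (card {f \<in> ?t. e \<subseteq> f})})"
    using S(7) by (subst (asm) even_sum_iff) auto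
  moreover have "{e \<in> ?s. odd (card {f \<in> ?t. e \<subseteq> f})} = {e \<in> bd T A. x \<in> e}"
  proof -
    have "odd (card {f \<in> ?t. e \<subseteq> f}) \<longleftrightarrow> e \<in> bd T A" if "e \<in> ?s" for e
    proof -
      let ?a = "{f \<in> A. e \<subseteq> f}" and ?b = "{f \<in> T - A. e \<subseteq> f}"
      have "{f \<in> ?t. e \<subseteq> f} = ?a" using that by auto
      moreover have "?a \<union> ?b = {f \<in> T. e \<subseteq> f}" "?a \<inter> ?b = {}" using assms(2) by auto
      then have "card ?a + card ?b = 2"
        using S(4)[of e] that S(1) fA card_Un_disjoint[of ?a ?b] by auto
      moreover have "e \<in> bd T A \<longleftrightarrow> ?a \<noteq> {} \<and> ?b \<noteq> {}"
        using that unfolding bd_def tri_edges_def by blast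
      moreover have "?a \<noteq> {} \<longleftrightarrow> card ?a > 0" "?b \<noteq> {} \<longleftrightarrow> card ?b > 0"
        using fA S(1) by (simp_all only: card_gt_0_iff) auto
      ultimately show ?thesis by presburger
    qed
    then show ?thesis using bd_sub[OF assms(2)] by blast
  qed
  ultimately show ?thesis by simp
qed

lemma bd_compl: "A \<subseteq> T \<Longrightarrow> bd T (T - A) = bd T A"
  unfolding bd_def by (auto simp: double_diff)

text \<open>A combinatorial Jordan curve theorem. The edge set \<^term>\<open>C\<close> is that of a cycle: it has no proper
  nonempty even subset and as many edges as vertices.\<close>
lemma sphere_separation:
  assumes sp: "sphere T" and C: "C \<subseteq> tri_edges T" "\<not> acy C"
    and ev: "\<And>D. D \<subseteq> C \<Longrightarrow> (\<And>x. even (card {e \<in> D. x \<in> e})) \<Longrightarrow> D = {} \<or> D = C"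
    and cC: "card C = card (\<Union>C)"
  shows "\<exists>A\<subseteq>T. A \<noteq> {} \<and> A \<noteq> T \<and> bd T A = C \<and> \<Union>A \<inter> \<Union>(T - A) = \<Union>C"
proof -
  have su: "surface T" and eul: "card T + 4 = 2 * card (\<Union>T)" using sp unfolding sphere_def by auto
  note S = surfaceD[OF su]
  let ?E = "tri_edges T" and ?V = "\<Union>T"
  have Vne: "?V \<noteq> {}" using S(2,3) by fastforce
  have E: "card ?E + 2 = card ?V + card T" using card_tri_edges[OF su] eul by linarith
  have Cne: "C \<noteq> {}" using C(2) by auto
  have "\<not> linked T C"
  proof
    assume "linked T C"
    then obtain D where D: "D \<subseteq> ?E" "D \<inter> C = {}" "card D + 1 = card T"
       "\<And>x y. x \<in> ?V \<Longrightarrow> y \<in> ?V \<Longrightarrow> conn (?E - D) x y"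
      using dual_treeE[OF S(1,2,3) surface_le2[OF su], of C] by metis
    have "edges_on ?V (?E - D)" using edges_on_subset[OF edges_on_tri_edges] by blast
    note co = connected_card_le[OF this S(6) Vne D(4)]
    have "card (?E - D) + card D = card ?E"
      using D(1) S(7) by (metis card_Diff_subset card_mono finite_subset le_add_diff_inverse2)
    then have "card ?V = card (?E - D) + 1" using E D(3) by linarith
    then have "acy (?E - D)" using co by blast
    then show False using C D(2) acy_subset by blast
  qed
  then obtain A where A: "A \<subseteq> T" "A \<noteq> {}" "A \<noteq> T"
    and nA': "\<not> (\<exists>f\<in>A. \<exists>g\<in>T - A. \<exists>e. card e = 2 \<and> e \<subseteq> f \<and> e \<subseteq> g \<and> e \<notin> C)"
    unfolding linked_def not_all not_imp by (elim exE conjE)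
  then have nA: "\<And>f g e. f \<in> A \<Longrightarrow> g \<in> T - A \<Longrightarrow> card e = 2 \<Longrightarrow> e \<subseteq> f \<Longrightarrow> e \<subseteq> g \<Longrightarrow> e \<in> C"
    by blast
  have full: "bd T X = C" if "X \<subseteq> T" "X \<noteq> {}" "X \<noteq> T" "bd T X \<subseteq> C" for X
    using ev[OF that(4)] bd_even[OF su that(1)] surface_eqI[OF su that(1,2)] that(3) by blast
  have bA: "bd T A = C" using A nA by (intro full) (auto simp: bd_def)
  have side: "card (\<Union>A) + card A \<le> card (tri_edges A) + 1" if A: "A \<subseteq> T" "A \<noteq> {}" "A \<noteq> T" "bd T A = C" for A
  proof -
    have fA: "finite A" using A(1) S(1) finite_subset by blast
    have one: "f = g" if "e \<in> C" "f \<in> A" "g \<in> A" "e \<subseteq> f" "e \<subseteq> g" for e f g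
    proof (rule ccontr)
      assume "f \<noteq> g"
      have "e \<in> bd T A" using that A by simp
      then obtain h where h: "h \<in> T - A" "e \<subseteq> h" "card e = 2" unfolding bd_def by blast
      have "h = f \<or> h = g"
        by (rule third_face_eq[OF S(1) surface_le2[OF su h(3)]]) (use that h A \<open>f \<noteq> g\<close> in auto)
      then show False using h that by auto
    qed
    have li: "linked A C"
      unfolding linked_def
    proof (intro allI impI)
      fix X assume X: "X \<subseteq> A" "X \<noteq> {} \<and> X \<noteq> A"
      show "\<exists>f\<in>X. \<exists>g\<in>A - X. \<exists>e. card e = 2 \<and> e \<subseteq> f \<and> e \<subseteq> g \<and> e \<notin> C"
      proof (rule ccontr)
        assume no: "\<not> ?thesis"
        have sub: "bd T Y \<subseteq> C" if Y: "Y = X \<or> Y = A - X" for Y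
        proof
          fix e assume "e \<in> bd T Y"
          then obtain f g where fg: "card e = 2" "f \<in> Y" "g \<in> T - Y" "e \<subseteq> f" "e \<subseteq> g" unfolding bd_def by blast
          show "e \<in> C"
          proof (cases "g \<in> A")
            case True
            then show ?thesis using no Y fg X by blast
          next
            case False
            then have "e \<in> bd T A" using fg Y X unfolding bd_def by blast
            then show ?thesis using A by simp
          qed
        qed
        have "X \<subseteq> T" "X \<noteq> T" "A - X \<subseteq> T" "A - X \<noteq> {}" "A - X \<noteq> T" using X A(1-3) by auto
        then have b: "bd T X = C" "bd T (A - X) = C"
          using full[of X] full[of "A - X"] X sub by simp_all
        obtain e where e: "e \<in> C" using Cne by blast
        then have "e \<in> bd T X" "e \<in> bd T (A - X)" using b by simp_all
        then obtain f g where fg: "f \<in> X" "e \<subseteq> f" "g \<in> A - X" "e \<subseteq> g" unfolding bd_def by auto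
        then have "f = g" using one[OF e, of f g] X by auto
        then show False using fg by simp
      qed
    qed
    have le2: "card {f \<in> A. e \<subseteq> f} \<le> 2" if "card e = 2" for e
    proof -
      have "card {f \<in> A. e \<subseteq> f} \<le> card {f \<in> T. e \<subseteq> f}" using A S(1) by (intro card_mono) auto
      then show ?thesis using surface_le2[OF su that] by linarith
    qed
    have c3: "card f = 3" if "f \<in> A" for f using that A S(3) by blast
    obtain D where D: "D \<subseteq> tri_edges A" "card D + 1 = card A" "D \<inter> C = {}"
       "\<And>x y. x \<in> \<Union>A \<Longrightarrow> y \<in> \<Union>A \<Longrightarrow> conn (tri_edges A - D) x y"
      using dual_treeE[OF fA A(2) c3 le2 li] by metis
    have CA: "C \<subseteq> tri_edges A - D"
      using D(3) A(4) unfolding bd_def tri_edges_def by blast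
    have fVA: "finite (\<Union>A)" using finite_Union_faces[OF fA c3] .
    have fEA: "finite (tri_edges A)" using edges_on_finite[OF edges_on_tri_edges fVA] .
    have "edges_on (\<Union>A) (tri_edges A - D)" using edges_on_subset[OF edges_on_tri_edges] by blast
    moreover have "\<Union>A \<noteq> {}" using A(2) c3 by fastforce
    ultimately have "card (\<Union>A) \<le> card (tri_edges A - D) + 1" "card (\<Union>A) \<noteq> card (tri_edges A - D) + 1"
      using connected_card_le[of "\<Union>A" "tri_edges A - D"] fVA D(4) C(2) CA acy_subset by blast+
    moreover have "card (tri_edges A - D) + card D = card (tri_edges A)"
      using D(1) fEA by (metis card_Diff_subset card_mono finite_subset le_add_diff_inverse2)
    ultimately show ?thesis using D(2) by linarith
  qed
  let ?B = "T - A"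
  have sA: "card (\<Union>A) + card A \<le> card (tri_edges A) + 1" using side A bA by blast
  have sB: "card (\<Union>?B) + card ?B \<le> card (tri_edges ?B) + 1"
    using A bA bd_compl[OF A(1)] by (intro side) auto
  have "tri_edges A \<union> tri_edges ?B = ?E" "tri_edges A \<inter> tri_edges ?B = C"
    using A(1) bA unfolding tri_edges_def bd_def by blast+
  then have eE: "card (tri_edges A) + card (tri_edges ?B) = card ?E + card C"
    using card_Un_Int[of "tri_edges A" "tri_edges ?B"] S(7) by (metis finite_Un)
  have eT: "card A + card ?B = card T"
    using A(1) S(1) by (metis card_Diff_subset card_mono finite_subset le_add_diff_inverse)
  have UV: "\<Union>A \<union> \<Union>?B = ?V" using A(1) by blast
  then have eV: "card (\<Union>A) + card (\<Union>?B) = card ?V + card (\<Union>A \<inter> \<Union>?B)"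
    using card_Un_Int[of "\<Union>A" "\<Union>?B"] S(6) by (metis finite_Un)
  have "\<Union>C \<subseteq> \<Union>A \<inter> \<Union>?B" using bA unfolding bd_def by blast
  moreover have "card (\<Union>A \<inter> \<Union>?B) \<le> card (\<Union>C)"
    using sA sB eE eT eV E cC by linarith
  moreover have "finite (\<Union>A \<inter> \<Union>?B)" using UV S(6) by (metis finite_Int finite_Un)
  ultimately have "\<Union>A \<inter> \<Union>?B = \<Union>C" by (metis card_seteq)
  then show ?thesis using A bA by blast
qed

lemma even_pair:
  assumes "{e \<in> C. x \<in> e} = {p, q}" "p \<noteq> q" "D \<subseteq> C" "even (card {e \<in> D. x \<in> e})"
  shows "p \<in> D \<longleftrightarrow> q \<in> D"
proof -
  have "{e \<in> D. x \<in> e} = {p, q} \<inter> D" using assms(1,3) by blast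
  then show ?thesis using assms(2,4) by (cases "p \<in> D"; cases "q \<in> D") auto
qed

lemma triangle_separation:
  assumes "sphere T" "{a, b} \<in> tri_edges T" "{b, c} \<in> tri_edges T" "{c, a} \<in> tri_edges T"
    and d: "a \<noteq> b" "b \<noteq> c" "c \<noteq> a"
  shows "\<exists>A\<subseteq>T. A \<noteq> {} \<and> A \<noteq> T \<and> bd T A = {{a, b}, {b, c}, {c, a}} \<and> \<Union>A \<inter> \<Union>(T - A) = {a, b, c}"
proof -
  let ?C = "{{a, b}, {b, c}, {c, a}}"
  have "\<not> acy ?C"
  proof
    assume "acy ?C"
    then have "\<not> conn (?C - {{a, b}}) a b" unfolding acy_def by blast
    moreover have "{a, c} \<in> ?C - {{a, b}}" "{c, b} \<in> ?C - {{a, b}}" using d by (auto simp: doubleton_eq_iff)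
    then have "conn (?C - {{a, b}}) a b" by (rule conn_trans[OF conn_edge conn_edge])
    ultimately show False by contradiction
  qed
  moreover have "D = {} \<or> D = ?C" if D: "D \<subseteq> ?C" and ev: "\<And>x. even (card {e \<in> D. x \<in> e})" for D
  proof -
    have 1: "{e \<in> ?C. a \<in> e} = {{a, b}, {c, a}}" "{e \<in> ?C. b \<in> e} = {{a, b}, {b, c}}" using d by auto
    have 2: "{a, b} \<noteq> {c, a}" "{a, b} \<noteq> {b, c}" using d by (auto simp: doubleton_eq_iff)
    have "{a, b} \<in> D \<longleftrightarrow> {c, a} \<in> D" "{a, b} \<in> D \<longleftrightarrow> {b, c} \<in> D"
      using even_pair[OF 1(1) 2(1) D ev] even_pair[OF 1(2) 2(2) D ev] by auto
    then show ?thesis using D by blast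
  qed
  moreover have "card ?C = card (\<Union>?C)"
  proof -
    have "\<Union>?C = {a, b, c}" by auto
    then show ?thesis using d by (auto simp: doubleton_eq_iff)
  qed
  moreover have "\<Union>?C = {a, b, c}" by auto
  ultimately show ?thesis using sphere_separation[OF assms(1), of ?C] assms(2-4) by auto
qed

lemma square_separation:
  assumes "sphere T" "{a, b} \<in> tri_edges T" "{b, c} \<in> tri_edges T" "{c, d} \<in> tri_edges T" "{d, a} \<in> tri_edges T"
    and d: "distinct [a, b, c, d]"
  shows "\<exists>A\<subseteq>T. A \<noteq> {} \<and> A \<noteq> T \<and> bd T A = {{a, b}, {b, c}, {c, d}, {d, a}} \<and> \<Union>A \<inter> \<Union>(T - A) = {a, b, c, d}"
proof -
  let ?C = "{{a, b}, {b, c}, {c, d}, {d, a}}"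
  have "\<not> acy ?C"
  proof
    assume "acy ?C"
    then have "\<not> conn (?C - {{a, b}}) a b" unfolding acy_def by blast
    moreover have "{a, d} \<in> ?C - {{a, b}}" "{d, c} \<in> ?C - {{a, b}}" "{c, b} \<in> ?C - {{a, b}}"
      using d by (auto simp: doubleton_eq_iff)
    then have "conn (?C - {{a, b}}) a b" by (rule conn_trans[OF conn_edge conn_trans[OF conn_edge conn_edge]])
    ultimately show False by contradiction
  qed
  moreover have "D = {} \<or> D = ?C" if D: "D \<subseteq> ?C" and ev: "\<And>x. even (card {e \<in> D. x \<in> e})" for D
  proof -
    have 1: "{e \<in> ?C. a \<in> e} = {{a, b}, {d, a}}" "{e \<in> ?C. b \<in> e} = {{a, b}, {b, c}}"
       "{e \<in> ?C. c \<in> e} = {{b, c}, {c, d}}" using d by auto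
    have 2: "{a, b} \<noteq> {d, a}" "{a, b} \<noteq> {b, c}" "{b, c} \<noteq> {c, d}" using d by (auto simp: doubleton_eq_iff)
    have "{a, b} \<in> D \<longleftrightarrow> {d, a} \<in> D" "{a, b} \<in> D \<longleftrightarrow> {b, c} \<in> D" "{b, c} \<in> D \<longleftrightarrow> {c, d} \<in> D"
      using even_pair[OF 1(1) 2(1) D ev] even_pair[OF 1(2) 2(2) D ev] even_pair[OF 1(3) 2(3) D ev] by auto
    then show ?thesis using D by blast
  qed
  moreover have "\<Union>?C = {a, b, c, d}" by auto
  moreover have "card ?C = card (\<Union>?C)"
  proof -
    have "card ?C = 4" "card {a, b, c, d} = 4" using d by (auto simp: doubleton_eq_iff)
    moreover have "\<Union>?C = {a, b, c, d}" by auto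
    ultimately show ?thesis by (simp only:)
  qed
  ultimately show ?thesis using sphere_separation[OF assms(1), of ?C] assms(2-5) by auto
qed

section \<open>Splitting and contracting spheres\<close>

lemma tri_edges_insert: "tri_edges (insert f A) = {e. card e = 2 \<and> e \<subseteq> f} \<union> tri_edges A"
  unfolding tri_edges_def by blast

lemma bdE:
  assumes "e \<in> bd T A"
  obtains f g where "card e = 2" "f \<in> A" "e \<subseteq> f" "g \<in> T" "g \<notin> A" "e \<subseteq> g"
  using assms unfolding bd_def by blast

lemma bdI: "card e = 2 \<Longrightarrow> f \<in> A \<Longrightarrow> e \<subseteq> f \<Longrightarrow> g \<in> T \<Longrightarrow> g \<notin> A \<Longrightarrow> e \<subseteq> g \<Longrightarrow> e \<in> bd T A"
  unfolding bd_def by blast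

lemma tri_edgesE:
  assumes "e \<in> tri_edges T"
  obtains f where "card e = 2" "f \<in> T" "e \<subseteq> f"
  using assms unfolding tri_edges_def by blast

lemma tri_sub2:
  assumes "e \<subseteq> {p, q, r}" "card e = 2"
  shows "e = {p, q} \<or> e = {q, r} \<or> e = {p, r}"
proof -
  have "\<exists>x y. e = {x, y} \<and> x \<noteq> y" using assms(2) by (auto simp: card_2_iff)
  then obtain x y where xy: "e = {x, y}" "x \<noteq> y" by (elim exE conjE)
  then have "x = p \<or> x = q \<or> x = r" "y = p \<or> y = q \<or> y = r" using assms(1) by auto
  then show ?thesis using xy by (elim disjE) (simp_all add: insert_commute)
qed

lemma surface_closed_eqI:
  assumes su: "surface T" and A: "A \<subseteq> T" "A \<noteq> {}"
    and cl: "\<And>f e. f \<in> A \<Longrightarrow> e \<subseteq> f \<Longrightarrow> card e = 2 \<Longrightarrow> \<exists>f1\<in>A. \<exists>f2\<in>A. f1 \<noteq> f2 \<and> e \<subseteq> f1 \<and> e \<subseteq> f2"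
  shows "A = T"
proof (rule surface_eqI[OF su A])
  have "e \<notin> bd T A" for e
  proof
    assume "e \<in> bd T A"
    then obtain f g where e: "card e = 2" "f \<in> A" "e \<subseteq> f" "g \<in> T" "g \<notin> A" "e \<subseteq> g" by (rule bdE)
    from cl[OF e(2,3,1)] obtain f1 f2 where ff: "f1 \<in> A" "f2 \<in> A" "f1 \<noteq> f2" "e \<subseteq> f1" "e \<subseteq> f2"
      by (elim bexE conjE)
    have "g = f1 \<or> g = f2"
      using third_face_eq[OF surfaceD(1)[OF su] surface_le2[OF su e(1)], of f1 f2 g] ff e A(1) by blast
    then show False using ff(1,2) e(5) by auto
  qed
  then show "bd T A = {}" by blast
qed

lemma sphere_card_ge4:
  assumes "surface T"
  shows "4 \<le> card (\<Union>T)"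
proof -
  note S = surfaceD[OF assms]
  obtain f where f: "f \<in> T" using S(2) by blast
  have "card f = 3" using S(3) f .
  then obtain a b c where abc: "f = {a, b, c}" "a \<noteq> b" "a \<noteq> c" "b \<noteq> c" by (auto simp: card_3_iff)
  obtain g where g: "g \<in> T" "g \<noteq> f" "{a, b} \<subseteq> g"
    by (rule other_face[OF assms f, of "{a, b}"]) (use abc in auto)
  obtain z where z: "g = {a, b, z}" "z \<noteq> a" "z \<noteq> b" using third_vertex[OF S(3)[OF g(1)] g(3) abc(2)] .
  have "z \<noteq> c" using z g abc by auto
  then have "card {a, b, c, z} = 4" using abc z by simp
  moreover have "f \<subseteq> \<Union>T" "g \<subseteq> \<Union>T" using f g(1) by (simp_all only: Union_upper)
  then have "{a, b, c, z} \<subseteq> \<Union>T" unfolding abc(1) z(1) by simp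
  ultimately show ?thesis using card_mono[OF S(6)] by metis
qed

lemma surface_cap:
  assumes su: "surface T" and A: "A \<subseteq> T" "bd T A = {{a, b}, {b, c}, {c, a}}"
    and d: "a \<noteq> b" "b \<noteq> c" "c \<noteq> a" and nf: "{a, b, c} \<notin> T"
  shows "surface (insert {a, b, c} A)"
proof -
  note S = surfaceD[OF su]
  let ?t = "{a, b, c}" and ?C = "{{a, b}, {b, c}, {c, a}}"
  let ?A = "insert ?t A"
  have fA: "finite A" using A(1) S(1) finite_subset by blast
  have tsub: "e \<subseteq> ?t \<and> card e = 2 \<longleftrightarrow> e \<in> ?C" for e
  proof
    assume e: "e \<subseteq> ?t \<and> card e = 2"
    then have "card e = 2" by simp
    then obtain x y where "e = {x, y}" "x \<noteq> y" by (auto simp: card_2_iff)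
    then show "e \<in> ?C" using e by auto
  qed (use d in auto)
  have two: "card {f \<in> ?A. e \<subseteq> f} = 2" if e: "e \<in> tri_edges ?A" for e
  proof (cases "e \<in> ?C")
    case True
    then have "e \<in> bd T A" using A by simp
    then obtain f g where fg: "card e = 2" "f \<in> A" "e \<subseteq> f" "g \<in> T" "g \<notin> A" "e \<subseteq> g" unfolding bd_def by blast
    have "h = f" if h: "h \<in> A" "e \<subseteq> h" for h
    proof -
      have "f \<noteq> g" "h \<noteq> g" using fg h by auto
      then show ?thesis using third_face_eq[OF S(1) surface_le2[OF su fg(1)], of f g h] fg h A(1) by auto
    qed
    then have "{f \<in> ?A. e \<subseteq> f} = {?t, f}" using fg True tsub by blast
    moreover have "?t \<noteq> f" using nf fg A by auto
    ultimately show ?thesis by simp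
  next
    case False
    obtain f where f0: "card e = 2" "f \<in> ?A" "e \<subseteq> f" using e by (rule tri_edgesE)
    have e2: "card e = 2" and et: "\<not> e \<subseteq> ?t" using f0(1) tsub[of e] False by simp_all
    have f: "f \<in> A" "e \<subseteq> f" using f0(2,3) et by auto
    have "e \<notin> bd T A" using False A by simp
    then have "g \<in> A" if "g \<in> T" "e \<subseteq> g" for g
      using bdI[OF e2 f that(1) _ that(2)] by blast
    then have "{f \<in> ?A. e \<subseteq> f} = {f \<in> T. e \<subseteq> f}"
      using A(1) et by (intro equalityI subsetI) auto
    moreover have "e \<in> tri_edges T" using f e2 A(1) unfolding tri_edges_def by blast
    ultimately show ?thesis using S(4) by simp
  qed
  have cross: "\<exists>f\<in>X. \<exists>g\<in>?A - X. \<exists>e. card e = 2 \<and> e \<subseteq> f \<and> e \<subseteq> g" if X: "X \<subseteq> A" "X \<noteq> {}" for X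
  proof (rule ccontr)
    assume no: "\<not> ?thesis"
    have "bd T X = {}"
    proof (rule ccontr)
      assume "bd T X \<noteq> {}"
      then obtain e f g where e: "card e = 2" "f \<in> X" "g \<in> T - X" "e \<subseteq> f" "e \<subseteq> g" unfolding bd_def by blast
      show False
      proof (cases "g \<in> A")
        case True
        then show ?thesis using no e by blast
      next
        case False
        then have "e \<in> bd T A" using e X unfolding bd_def by blast
        then have "e \<subseteq> ?t" using A tsub by auto
        moreover have "?t \<notin> X" using nf X A by auto
        ultimately show False using no e by blast
      qed
    qed
    then have "X = T" using surface_eqI[OF su] X A by blast
    then show False using X A unfolding bd_def by auto
  qed
  have "linked ?A {}"
    unfolding linked_def
  proof (intro allI impI)
    fix X assume X: "X \<subseteq> ?A" "X \<noteq> {} \<and> X \<noteq> ?A"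
    show "\<exists>f\<in>X. \<exists>g\<in>?A - X. \<exists>e. card e = 2 \<and> e \<subseteq> f \<and> e \<subseteq> g \<and> e \<notin> {}"
    proof (cases "?t \<in> X")
      case False
      then show ?thesis using cross[of X] X by auto
    next
      case True
      define Y where "Y = ?A - X"
      have "Y \<subseteq> A" "Y \<noteq> {}" "?A - Y = X" using X True unfolding Y_def by auto
      then obtain f g e where "f \<in> Y" "g \<in> X" "card e = 2" "e \<subseteq> f" "e \<subseteq> g"
        using cross[of Y] by (metis)
      then show ?thesis unfolding Y_def by blast
    qed
  qed
  moreover have "card f = 3" if "f \<in> ?A" for f using that S(3) A(1) d by auto
  ultimately show ?thesis using two fA unfolding surface_def by blast
qed

lemma split_sphere:
  assumes sp: "sphere T" and e: "{a, b} \<in> tri_edges T" "{b, c} \<in> tri_edges T" "{c, a} \<in> tri_edges T"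
    and d: "a \<noteq> b" "b \<noteq> c" "c \<noteq> a" and nf: "{a, b, c} \<notin> T"
  shows "\<exists>T1 T2. sphere T1 \<and> sphere T2 \<and> T1 \<union> T2 = insert {a, b, c} T \<and> {a, b, c} \<in> T1 \<inter> T2 \<and>
    \<Union>T1 \<inter> \<Union>T2 = {a, b, c} \<and> card (\<Union>T1) < card (\<Union>T) \<and> card (\<Union>T2) < card (\<Union>T)"
proof -
  have su: "surface T" and eul: "card T + 4 = 2 * card (\<Union>T)" using sp unfolding sphere_def by auto
  note S = surfaceD[OF su]
  obtain A where A: "A \<subseteq> T" "A \<noteq> {}" "A \<noteq> T" "bd T A = {{a, b}, {b, c}, {c, a}}"
    and V: "\<Union>A \<inter> \<Union>(T - A) = {a, b, c}"
    using triangle_separation[OF sp e d] by blast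
  let ?B = "T - A" and ?t = "{a, b, c}"
  let ?T1 = "insert ?t A" and ?T2 = "insert ?t (T - A)"
  have sA: "surface ?T1" by (rule surface_cap[OF su A(1,4) d nf])
  have sB: "surface ?T2" by (rule surface_cap[OF su _ _ d nf]) (use A bd_compl[OF A(1)] in auto)
  have tin: "?t \<subseteq> \<Union>A" by (subst V[symmetric]) (rule Int_lower1)
  have tin: "?t \<subseteq> \<Union>A" "?t \<subseteq> \<Union>?B" using tin by (simp_all add: V[symmetric])
  have U: "\<Union>?T1 = \<Union>A" "\<Union>?T2 = \<Union>?B" using tin by auto
  have fin: "finite A" "finite ?B" "finite (\<Union>A)" "finite (\<Union>?B)"
    using S(1,6) A(1) finite_subset by (auto intro: finite_subset[OF _ S(6)])
  have cT: "card ?T1 + card ?T2 = card T + 2"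
  proof -
    have "?t \<notin> A" "?t \<notin> ?B" using nf A by auto
    moreover have "card A + card ?B = card T" using A(1) S(1) fin card_mono[OF S(1) A(1)] by (simp add: card_Diff_subset)
    ultimately show ?thesis using fin by simp
  qed
  have "\<Union>A \<union> \<Union>?B = \<Union>T" using A(1) by blast
  then have cV: "card (\<Union>A) + card (\<Union>?B) = card (\<Union>T) + 3"
    using card_Un_Int[OF fin(3,4)] V d by simp
  have le: "2 * card (\<Union>A) \<le> card ?T1 + 4" "2 * card (\<Union>?B) \<le> card ?T2 + 4"
    using euler_le[OF sA] euler_le[OF sB] U by simp_all
  have ge: "4 \<le> card (\<Union>A)" "4 \<le> card (\<Union>?B)"
    using sphere_card_ge4[OF sA] sphere_card_ge4[OF sB] U by simp_all
  have "sphere ?T1" "sphere ?T2" using sA sB le cT cV eul U unfolding sphere_def by simp_all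
  moreover have "card (\<Union>?T1) < card (\<Union>T)" "card (\<Union>?T2) < card (\<Union>T)" using ge cV U by simp_all
  moreover have "?T1 \<union> ?T2 = insert ?t T" "?t \<in> ?T1 \<inter> ?T2" using A(1) by auto
  moreover have "\<Union>?T1 \<inter> \<Union>?T2 = ?t" unfolding U by (rule V)
  ultimately show ?thesis by (intro exI[of _ ?T1] exI[of _ ?T2] conjI)
qed

definition flag :: "'b set set \<Rightarrow> bool" where
  "flag T \<longleftrightarrow> (\<forall>a b c. a \<noteq> b \<longrightarrow> b \<noteq> c \<longrightarrow> c \<noteq> a \<longrightarrow> {a, b} \<in> tri_edges T \<longrightarrow> {b, c} \<in> tri_edges T \<longrightarrow>
     {c, a} \<in> tri_edges T \<longrightarrow> {a, b, c} \<in> T)"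

lemma flagD: "flag T \<Longrightarrow> {a, b} \<in> tri_edges T \<Longrightarrow> {b, c} \<in> tri_edges T \<Longrightarrow> {c, a} \<in> tri_edges T \<Longrightarrow>
   a \<noteq> b \<Longrightarrow> b \<noteq> c \<Longrightarrow> c \<noteq> a \<Longrightarrow> {a, b, c} \<in> T"
  unfolding flag_def by blast

lemma face_edge: "surface T \<Longrightarrow> f \<in> T \<Longrightarrow> {x, y} \<subseteq> f \<Longrightarrow> x \<noteq> y \<Longrightarrow> {x, y} \<in> tri_edges T"
  by (intro tri_edgesI) auto

lemma tri_edge_neq: "{x, y} \<in> tri_edges T \<Longrightarrow> x \<noteq> y"
  unfolding tri_edges_def by auto

lemma card_sub_two:
  assumes "card {f \<in> T. e \<subseteq> f} = 2"
  obtains f g where "{f \<in> T. e \<subseteq> f} = {f, g}" "f \<noteq> g"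
  using assms by (auto simp: card_2_iff)

lemma tetrahedron:
  assumes su: "surface T" and f: "{a, b, c} \<in> T" "{a, b, d} \<in> T" "{a, c, d} \<in> T" "{b, c, d} \<in> T"
    and d: "distinct [a, b, c, d]"
  shows "T = {{a, b, c}, {a, b, d}, {a, c, d}, {b, c, d}}"
proof -
  define A where "A = {{a, b, c}, {a, b, d}, {a, c, d}, {b, c, d}}"
  define dbl where "dbl = (\<lambda>e. \<exists>f1\<in>A. \<exists>f2\<in>A. f1 \<noteq> f2 \<and> e \<subseteq> f1 \<and> e \<subseteq> f2)"
  have dblI: "dbl e" if "f1 \<in> A" "f2 \<in> A" "f1 \<noteq> f2" "e \<subseteq> f1" "e \<subseteq> f2" for e f1 f2
    using that unfolding dbl_def by blast
  have memA: "{a, b, c} \<in> A" "{a, b, d} \<in> A" "{a, c, d} \<in> A" "{b, c, d} \<in> A" unfolding A_def by simp_all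
  have ne: "{a, b, c} \<noteq> {a, b, d}" "{a, b, c} \<noteq> {a, c, d}" "{a, b, c} \<noteq> {b, c, d}"
    "{a, b, d} \<noteq> {a, c, d}" "{a, b, d} \<noteq> {b, c, d}" "{a, c, d} \<noteq> {b, c, d}" using d by auto
  have db: "dbl {a, b}" "dbl {a, c}" "dbl {b, c}" "dbl {a, d}" "dbl {b, d}" "dbl {c, d}"
    using dblI[OF memA(1,2) ne(1)] dblI[OF memA(1,3) ne(2)] dblI[OF memA(1,4) ne(3)]
      dblI[OF memA(2,3) ne(4)] dblI[OF memA(2,4) ne(5)] dblI[OF memA(3,4) ne(6)] by simp_all
  have "A = T"
  proof (rule surface_closed_eqI[OF su])
    show "A \<subseteq> T" "A \<noteq> {}" using f unfolding A_def by simp_all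
    fix g e assume g: "g \<in> A" "e \<subseteq> g" "card e = 2"
    then consider "g = {a, b, c}" | "g = {a, b, d}" | "g = {a, c, d}" | "g = {b, c, d}" unfolding A_def by auto
    then have "dbl e"
      using tri_sub2[OF _ g(3)] g(2) db by cases metis+
    then show "\<exists>f1\<in>A. \<exists>f2\<in>A. f1 \<noteq> f2 \<and> e \<subseteq> f1 \<and> e \<subseteq> f2" unfolding dbl_def .
  qed
  then show ?thesis unfolding A_def by simp
qed

lemma contract_sphere:
  fixes x s :: 'b
  defines "h \<equiv> \<lambda>u. if u = s then x else u"
  assumes sp: "sphere T" and fl: "flag T" and n5: "5 \<le> card (\<Union>T)" and xs: "{x, s} \<in> tri_edges T"
  shows "sphere {h ` f | f. f \<in> T \<and> card (h ` f) = 3}"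
    and "\<Union>{h ` f | f. f \<in> T \<and> card (h ` f) = 3} = \<Union>T - {s}"
    and "tri_edges {h ` f | f. f \<in> T \<and> card (h ` f) = 3} = {h ` e | e. e \<in> tri_edges T \<and> card (h ` e) = 2}"
proof -
  have su: "surface T" and eul: "card T + 4 = 2 * card (\<Union>T)" using sp unfolding sphere_def by auto
  note S = surfaceD[OF su]
  have nxs: "x \<noteq> s" using tri_edge_neq[OF xs] .
  let ?D = "{f \<in> T. \<not> {x, s} \<subseteq> f}"
  have hs: "h u = (if u = s then x else u)" for u by (simp add: h_def)
  have h_id: "h ` e = e" if "s \<notin> e" for e using that by (auto simp: hs image_iff)
  have h_s: "h ` e = insert x (e - {s})" if "s \<in> e" for e using that by (auto simp: hs image_iff)
  have fin3: "finite f" if "f \<in> T" for f using S(3)[OF that] by (auto intro: card_ge_0_finite)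
  have card3: "card (h ` f) = 3 \<longleftrightarrow> \<not> {x, s} \<subseteq> f" if f: "f \<in> T" for f
  proof (cases "s \<in> f")
    case True
    have "card (f - {s}) = 2" "finite f" using True S(3)[OF f] fin3[OF f] by auto
    then show ?thesis unfolding h_s[OF True] using True nxs by (cases "x \<in> f") (simp_all add: insert_absorb)
  next
    case False
    then show ?thesis using h_id S(3)[OF f] by simp
  qed
  let ?T' = "{h ` f | f. f \<in> T \<and> card (h ` f) = 3}"
  have T': "?T' = image h ` ?D" using card3 by blast
  have apex: "{x, s, u} \<in> T" if "{x, u} \<in> tri_edges T" "{s, u} \<in> tri_edges T" for u
  proof -
    have "u \<noteq> x" "u \<noteq> s" using tri_edge_neq[OF that(1)] tri_edge_neq[OF that(2)] by simp_all
    then show ?thesis using flagD[OF fl, of x s u] xs that nxs by (simp add: insert_commute)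
  qed
  have hinj: "inj_on (image h) ?D"
  proof -
    have key: "f = g" if f: "f \<in> ?D" and g: "g \<in> ?D" and eq: "h ` f = h ` g" and sf: "s \<in> f" for f g
    proof (rule ccontr)
      assume ne: "f \<noteq> g"
      have fT: "f \<in> T" "g \<in> T" and xf: "x \<notin> f" using f g sf by auto
      have sg: "s \<notin> g"
      proof
        assume "s \<in> g"
        then have "x \<notin> g" using g by auto
        then have "f - {s} = g - {s}" using eq h_s[OF sf] h_s[OF \<open>s \<in> g\<close>] xf by (metis Diff_insert_absorb insert_Diff_single Diff_iff insertI1 insert_ident)
        then show False using ne sf \<open>s \<in> g\<close> by blast
      qed
      have g_eq: "g = insert x (f - {s})" using eq h_s[OF sf] h_id[OF sg] by simp
      have "card (f - {s}) = 2" using S(3)[OF fT(1)] sf by simp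
      then have "\<exists>u w. f - {s} = {u, w} \<and> u \<noteq> w" by (auto simp: card_2_iff)
      then obtain u w where uw: "f - {s} = {u, w}" "u \<noteq> w" by blast
      have fe: "f = {s, u, w}" using uw sf by auto
      have ge: "g = {x, u, w}" using g_eq uw by simp
      have ne': "u \<noteq> x" "w \<noteq> x" "u \<noteq> s" "w \<noteq> s" using uw xf by auto
      have 1: "{x, s, u} \<in> T" by (rule apex) (use face_edge[OF su fT(2)] face_edge[OF su fT(1)] fe ge ne' in auto)
      have 2: "{x, s, w} \<in> T" by (rule apex) (use face_edge[OF su fT(2)] face_edge[OF su fT(1)] fe ge ne' in auto)
      have "T = {{x, s, u}, {x, s, w}, {x, u, w}, {s, u, w}}"
        by (rule tetrahedron[OF su 1 2]) (use fT fe ge ne' uw nxs in auto)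
      then have "\<Union>T = {x, s, u, w}" by auto
      then have "card (\<Union>T) \<le> 4" using card_length[of "[x, s, u, w]"] by simp
      then show False using n5 by simp
    qed
    show ?thesis
    proof (rule inj_onI)
      fix f g assume fg: "f \<in> ?D" "g \<in> ?D" "h ` f = h ` g"
      show "f = g"
      proof (cases "s \<in> f \<or> s \<in> g")
        case True
        then show ?thesis using key[OF fg] key[OF fg(2,1) fg(3)[symmetric]] by auto
      next
        case False
        then show ?thesis using fg(3) h_id by auto
      qed
    qed
  qed
  have card_D: "card ?T' + 2 = card T"
  proof -
    have "T = ?D \<union> {f \<in> T. {x, s} \<subseteq> f}" "?D \<inter> {f \<in> T. {x, s} \<subseteq> f} = {}" by auto
    then have "card T = card ?D + card {f \<in> T. {x, s} \<subseteq> f}" using S(1) by (metis card_Un_disjoint finite_Un)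
    then show ?thesis unfolding T' using card_image[OF hinj] S(4)[OF xs] by simp
  qed
  have D_edge: "\<exists>f\<in>?D. e \<subseteq> f" if e: "e \<in> tri_edges T" and ne: "e \<noteq> {x, s}" for e
  proof (rule ccontr)
    assume no: "\<not> ?thesis"
    have e2: "card e = 2" using e unfolding tri_edges_def by blast
    have "finite e" using e2 by (auto intro: card_ge_0_finite)
    obtain f g where fg: "{f \<in> T. e \<subseteq> f} = {f, g}" "f \<noteq> g" using card_sub_two[OF S(4)[OF e]] .
    then have "f \<in> {f \<in> T. e \<subseteq> f}" "g \<in> {f \<in> T. e \<subseteq> f}" by auto
    then have f: "f \<in> T" "e \<subseteq> f" "g \<in> T" "e \<subseteq> g" by auto
    then have xf: "{x, s} \<subseteq> f" "{x, s} \<subseteq> g" using no by auto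
    have ff: "card (e \<union> {x, s}) \<ge> 3"
    proof (rule ccontr)
      assume "\<not> ?thesis"
      then have "card (e \<union> {x, s}) \<le> 2" by simp
      then have le: "card (e \<union> {x, s}) \<le> card e" "card (e \<union> {x, s}) \<le> card {x, s}" using e2 nxs by simp_all
      have "finite (e \<union> {x, s})" using \<open>finite e\<close> by simp
      then have "e = e \<union> {x, s}" "{x, s} = e \<union> {x, s}"
        using card_seteq[OF _ Un_upper1 le(1)] card_seteq[OF _ Un_upper2 le(2)] by blast+
      then show False using ne by metis
    qed
    have "f = e \<union> {x, s}" "g = e \<union> {x, s}"
      using card_seteq[of f "e \<union> {x, s}"] card_seteq[of g "e \<union> {x, s}"] f xf ff S(3) fin3 by simp_all
    then show False using fg by simp
  qed
  show E': "tri_edges ?T' = {h ` e | e. e \<in> tri_edges T \<and> card (h ` e) = 2}"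
  proof (intro equalityI subsetI)
    fix e' assume "e' \<in> tri_edges ?T'"
    then obtain f where f: "f \<in> ?D" "e' \<subseteq> h ` f" "card e' = 2" unfolding T' tri_edges_def by blast
    obtain e where e: "e \<subseteq> f" "inj_on h e" "e' = h ` e" using f(2) unfolding subset_image_inj by blast
    have "card e = 2" using f(3) e card_image by metis
    then have "e \<in> tri_edges T" using f e unfolding tri_edges_def by blast
    then show "e' \<in> {h ` e | e. e \<in> tri_edges T \<and> card (h ` e) = 2}" using e f(3) by blast
  next
    fix e' assume "e' \<in> {h ` e | e. e \<in> tri_edges T \<and> card (h ` e) = 2}"
    then obtain e where e: "e \<in> tri_edges T" "card (h ` e) = 2" "e' = h ` e" by blast
    have "h ` {x, s} = {x}" by (auto simp: hs)
    then have "e \<noteq> {x, s}" using e(2) by auto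
    then obtain f where "f \<in> ?D" "e \<subseteq> f" using D_edge e by blast
    then show "e' \<in> tri_edges ?T'" unfolding T' using e by (intro tri_edgesI[of _ "h ` f"]) auto
  qed
  show V': "\<Union>?T' = \<Union>T - {s}"
  proof (intro equalityI subsetI)
    fix u assume "u \<in> \<Union>?T'"
    then obtain f w where "f \<in> T" "w \<in> f" "u = h w" by blast
    moreover have "x \<in> \<Union>T" using xs unfolding tri_edges_def by blast
    ultimately show "u \<in> \<Union>T - {s}" using nxs by (auto simp: hs)
  next
    fix u assume u: "u \<in> \<Union>T - {s}"
    then obtain f where f: "f \<in> T" "u \<in> f" by blast
    have "card (f - {u}) = 2" using S(3)[OF f(1)] f(2) by simp
    then have "\<not> f - {u} \<subseteq> {x}" using card_mono[of "{x}" "f - {u}"] by auto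
    then obtain w where w: "w \<in> f" "w \<noteq> u" "w \<noteq> x" by blast
    show "u \<in> \<Union>?T'"
    proof (cases "{u, w} = {x, s}")
      case False
      have "{u, w} \<in> tri_edges T" using face_edge[OF su f(1)] f w by auto
      then obtain g where "g \<in> ?D" "{u, w} \<subseteq> g" using D_edge False by blast
      moreover have "h u = u" using u by (simp add: hs)
      ultimately show ?thesis unfolding T' by (intro UnionI[of "h ` g"] imageI) (auto intro: rev_image_eqI)
    next
      case True
      then have "u = x" using u by (auto simp: doubleton_eq_iff)
      have "x \<in> f" "s \<in> f" using True f w by auto
      then obtain z where z: "f = {x, s, z}" "z \<noteq> x" "z \<noteq> s" using third_vertex[OF S(3)[OF f(1)], of x s] nxs by auto
      have "{x, z} \<in> tri_edges T" using face_edge[OF su f(1)] z by auto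
      then obtain g where "g \<in> ?D" "{x, z} \<subseteq> g" using D_edge[of "{x, z}"] z by (auto simp: doubleton_eq_iff)
      moreover have "h x = x" using nxs by (simp add: hs)
      ultimately show ?thesis unfolding T' \<open>u = x\<close> by (intro UnionI[of "h ` g"] imageI) (auto intro: rev_image_eqI)
    qed
  qed
  have two: "card {f' \<in> ?T'. e' \<subseteq> f'} = 2" if e': "e' \<in> tri_edges ?T'" for e'
  proof -
    have im: "{f' \<in> ?T'. e' \<subseteq> f'} = image h ` {f \<in> ?D. e' \<subseteq> h ` f}" unfolding T' by blast
    have "inj_on (image h) {f \<in> ?D. e' \<subseteq> h ` f}" by (rule inj_on_subset[OF hinj]) auto
    then have eq: "card {f' \<in> ?T'. e' \<subseteq> f'} = card {f \<in> ?D. e' \<subseteq> h ` f}" unfolding im by (rule card_image)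
    obtain e where e: "e \<in> tri_edges T" "e' = h ` e" "card e' = 2" using e' unfolding E' by blast
    have snot: "s \<notin> e'" using e nxs by (auto simp: hs)
    show ?thesis
    proof (cases "x \<in> e'")
      case False
      then have "s \<notin> e" using e(2) by (auto simp: hs)
      then have ee: "e' = e" using e h_id by simp
      have "{f \<in> ?D. e' \<subseteq> h ` f} = {f \<in> T. e \<subseteq> f}"
      proof (intro equalityI subsetI)
        fix f assume f: "f \<in> {f \<in> ?D. e' \<subseteq> h ` f}"
        have "u \<in> f" if "u \<in> e" for u
        proof -
          have "u \<in> h ` f" "u \<noteq> x" using f that ee False by auto
          then show ?thesis by (auto simp: hs split: if_splits)
        qed
        then show "f \<in> {f \<in> T. e \<subseteq> f}" using f by auto
      next
        fix f assume f: "f \<in> {f \<in> T. e \<subseteq> f}"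
        have "\<not> {x, s} \<subseteq> f"
        proof
          assume "{x, s} \<subseteq> f"
          then have "e \<union> {x, s} \<subseteq> f" using f by auto
          moreover have "finite e" using e ee by (auto intro: card_ge_0_finite)
          then have "card (e \<union> {x, s}) = 4" using e ee False snot nxs by (simp add: card_insert_if)
          ultimately show False using card_mono[OF fin3, of f "e \<union> {x, s}"] f S(3)[of f] by auto
        qed
        moreover have "e \<subseteq> h ` f"
        proof
          fix u assume u: "u \<in> e"
          then have "h u = u" using snot ee by (auto simp: hs)
          then show "u \<in> h ` f" using u f by (metis imageI mem_Collect_eq subsetD)
        qed
        ultimately show "f \<in> {f \<in> ?D. e' \<subseteq> h ` f}" using f ee by auto
      qed
      then show ?thesis using eq S(4)[OF e(1)] by simp
    next
      case True
      have "\<exists>u. e' = {x, u} \<and> u \<noteq> x" using True e(3) by (auto simp: card_2_iff)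
      then obtain u where u: "e' = {x, u}" "u \<noteq> x" by blast
      have us: "u \<noteq> s" using snot u by auto
      let ?X = "{f \<in> T. {x, u} \<subseteq> f \<and> s \<notin> f}" and ?Y = "{f \<in> T. {s, u} \<subseteq> f \<and> x \<notin> f}"
      have mem: "x \<in> h ` f \<longleftrightarrow> x \<in> f \<or> s \<in> f" "u \<in> h ` f \<longleftrightarrow> u \<in> f" for f
        using nxs us u(2) by (auto simp: hs image_iff)
      have "{f \<in> ?D. e' \<subseteq> h ` f} = ?X \<union> ?Y" using u mem by auto
      moreover have "?X \<inter> ?Y = {}" by auto
      ultimately have c: "card {f \<in> ?D. e' \<subseteq> h ` f} = card ?X + card ?Y" using S(1) by (simp add: card_Un_disjoint)
      have part: "card {f \<in> T. {p, u} \<subseteq> f \<and> q \<notin> f} =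
          (if {p, u} \<in> tri_edges T then if {q, u} \<in> tri_edges T then 1 else 2 else 0)"
        if pq: "p = x \<and> q = s \<or> p = s \<and> q = x" for p q
      proof (cases "{p, u} \<in> tri_edges T")
        case False
        have "{f \<in> T. {p, u} \<subseteq> f \<and> q \<notin> f} = {}"
          using False face_edge[OF su, of _ p u] pq u us by blast
        then show ?thesis using False by (simp only: card.empty if_False)
      next
        case T1: True
        obtain f g where fg: "{f \<in> T. {p, u} \<subseteq> f} = {f, g}" "f \<noteq> g" using card_sub_two[OF S(4)[OF T1]] .
        have neq: "p \<noteq> u" "q \<noteq> u" "p \<noteq> q" using pq u us nxs by auto
        show ?thesis
        proof (cases "{q, u} \<in> tri_edges T")
          case True
          have t: "{p, q, u} \<in> T" using pq apex[of u] T1 True by (auto simp: insert_commute)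
          then have "{p, q, u} \<in> {f \<in> T. {p, u} \<subseteq> f}" by auto
          then have "{p, q, u} = f \<or> {p, q, u} = g" unfolding fg(1) by (simp only: insert_iff empty_iff simp_thms)
          have only: "k = {p, q, u}" if "k \<in> T" "{p, u} \<subseteq> k" "q \<in> k" for k
            using card_seteq[of k "{p, q, u}"] that S(3) fin3 neq by simp
          have "\<exists>k. {f \<in> T. {p, u} \<subseteq> f} = {{p, q, u}, k} \<and> k \<noteq> {p, q, u}"
            using fg \<open>{p, q, u} = f \<or> {p, q, u} = g\<close> by (metis insert_commute)
          then obtain k where k: "{f \<in> T. {p, u} \<subseteq> f} = {{p, q, u}, k}" "k \<noteq> {p, q, u}" by blast
          then have "k \<in> {f \<in> T. {p, u} \<subseteq> f}" by simp
          then have "q \<notin> k" using only k(2) by blast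
          have "{f \<in> T. {p, u} \<subseteq> f \<and> q \<notin> f} = {f \<in> T. {p, u} \<subseteq> f} - {{p, q, u}}"
            using only by blast
          also have "\<dots> = {k}" using k by auto
          finally show ?thesis using T1 True by simp
        next
          case False
          have "{f \<in> T. {p, u} \<subseteq> f \<and> q \<notin> f} = {f \<in> T. {p, u} \<subseteq> f}"
            using False face_edge[OF su, of _ q u] neq by blast
          then show ?thesis using S(4)[OF T1] T1 False by simp
        qed
      qed
      have "{x, u} \<in> tri_edges T \<or> {s, u} \<in> tri_edges T"
      proof -
        have "\<exists>p q. e = {p, q} \<and> p \<noteq> q"
        proof -
          have "card e = 2" using e(1) unfolding tri_edges_def by blast
          then show ?thesis by (auto simp: card_2_iff)
        qed
        then obtain p q where pq: "e = {p, q}" by blast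
        then have "{h p, h q} = {x, u}" using e u by simp
        then have "(p = x \<or> p = s) \<and> q = u \<or> p = u \<and> (q = x \<or> q = s)"
          using u(2) us by (auto simp: doubleton_eq_iff hs split: if_splits)
        then show ?thesis using pq e(1) by (auto simp: insert_commute)
      qed
      then show ?thesis using eq c part[of x s] part[of s x] by (auto split: if_splits)
    qed
  qed
  have card3': "card f = 3" if "f \<in> ?T'" for f using that by auto
  have li: "linked ?T' {}"
    unfolding linked_def
  proof (intro allI impI)
    fix X' assume X': "X' \<subseteq> ?T'" "X' \<noteq> {} \<and> X' \<noteq> ?T'"
    show "\<exists>f\<in>X'. \<exists>g\<in>?T' - X'. \<exists>e. card e = 2 \<and> e \<subseteq> f \<and> e \<subseteq> g \<and> e \<notin> {}"
    proof (rule ccontr)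
      assume no: "\<not> ?thesis"
      then have nox: "h ` f \<in> X' \<longleftrightarrow> h ` g \<in> X'" if "f \<in> ?D" "g \<in> ?D" "card e = 2" "e \<subseteq> h ` f" "e \<subseteq> h ` g" for f g e
        using that X'(1) unfolding T' by blast
      let ?adj = "\<lambda>g f. f \<in> ?D \<and> (\<exists>e. card e = 2 \<and> e \<subseteq> f \<and> e \<subseteq> g)"
      define X where "X = {f \<in> ?D. h ` f \<in> X'} \<union> {g \<in> T - ?D. \<exists>f. ?adj g f \<and> h ` f \<in> X'}"
      have X1: "f \<in> X \<longleftrightarrow> h ` f \<in> X'" if "f \<in> ?D" for f using that unfolding X_def by auto
      have h2: "card (h ` e) = 2" if "e \<subseteq> f" "f \<in> ?D" "card e = 2" for e f
      proof -
        have "card (h ` f) = card f" using card3 that(2) S(3) by auto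
        then have "inj_on h f" using fin3 that(2) eq_card_imp_inj_on by blast
        then show ?thesis using that card_image inj_on_subset by metis
      qed
      have same: "h ` f \<in> X' \<longleftrightarrow> h ` f' \<in> X'" if g: "g \<in> T - ?D" and f: "?adj g f" and f': "?adj g f'" for g f f'
      proof -
        have "{x, s} \<subseteq> g" "g \<in> T" using g by auto
        then obtain u where gu: "g = {x, s, u}" "u \<noteq> x" "u \<noteq> s" using third_vertex[OF S(3), of g x s] nxs by blast
        have "{x, u} \<subseteq> h ` f" if f: "?adj g f" for f
        proof -
          obtain e where e: "card e = 2" "e \<subseteq> f" "e \<subseteq> g" using f by blast
          have "\<exists>p q. e = {p, q} \<and> p \<noteq> q" using e(1) by (auto simp: card_2_iff)
          then obtain p q where pq: "e = {p, q}" "p \<noteq> q" by blast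
          have "e \<noteq> {x, s}" using f e by auto
          then have "u \<in> e" "x \<in> e \<or> s \<in> e" using e(3) gu pq by auto
          then have "u \<in> f" "x \<in> f \<or> s \<in> f" using e by auto
          then show ?thesis using gu by (auto simp: hs image_iff)
        qed
        moreover have "card {x, u} = 2" using gu by simp
        ultimately show ?thesis using nox[of f f' "{x, u}"] f f' by blast
      qed
      have "bd T X \<subseteq> {{x, s}}"
      proof
        fix e assume "e \<in> bd T X"
        then obtain f g where fg: "card e = 2" "f \<in> X" "e \<subseteq> f" "g \<in> T" "g \<notin> X" "e \<subseteq> g" unfolding bd_def by blast
        have fT: "f \<in> T" using fg(2) unfolding X_def by auto
        show "e \<in> {{x, s}}"
        proof (cases "f \<in> ?D")
          case fD: True
          show ?thesis
          proof (cases "g \<in> ?D")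
            case True
            then have "h ` f \<in> X' \<longleftrightarrow> h ` g \<in> X'" using nox[of f g "h ` e"] fD h2[OF fg(3) fD fg(1)] fg by blast
            then show ?thesis using X1[OF fD] X1[OF True] fg by blast
          next
            case False
            then have "?adj g f" "h ` f \<in> X'" using fg fD X1 by blast+
            then show ?thesis using False fg unfolding X_def by blast
          qed
        next
          case fD: False
          then obtain f' where f': "?adj f f'" "h ` f' \<in> X'" using fg(2) unfolding X_def by blast
          show ?thesis
          proof (cases "g \<in> ?D")
            case True
            then have "?adj f g" using fg by blast
            then have "h ` g \<in> X'" using same[of f g f'] f' fD fT by blast
            then show ?thesis using X1[OF True] fg by blast
          next
            case False
            then have "{x, s} \<subseteq> f" "{x, s} \<subseteq> g" "f \<noteq> g" using fD fT fg by auto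
            show ?thesis
            proof (rule ccontr)
              assume "e \<notin> {{x, s}}"
              then have "e \<noteq> {x, s}" by simp
              moreover have "e \<in> tri_edges T" using fg unfolding tri_edges_def by blast
              ultimately obtain k where "k \<in> ?D" "e \<subseteq> k" using D_edge by blast
              then have "k = f \<or> k = g" using third_face_eq[OF S(1) surface_le2[OF su fg(1)], of f g k] fg fT \<open>f \<noteq> g\<close> by blast
              then show False using \<open>k \<in> ?D\<close> fD False by blast
            qed
          qed
        qed
      qed
      moreover have "bd T X \<noteq> {{x, s}}"
      proof
        assume b: "bd T X = {{x, s}}"
        have "X \<subseteq> T" unfolding X_def by auto
        from bd_even[OF su this, of x] have "even (card {e \<in> {{x, s}}. x \<in> e})" unfolding b .
        moreover have "{e \<in> {{x, s}}. x \<in> e} = {{x, s}}" by auto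
        ultimately show False by simp
      qed
      ultimately have bX: "bd T X = {}" by blast
      obtain f' where f': "f' \<in> X'" using X' by blast
      then obtain f where f: "f \<in> ?D" "h ` f \<in> X'" using X'(1) unfolding T' by blast
      have "X \<subseteq> T" unfolding X_def by auto
      moreover have "f \<in> X" using X1[OF f(1)] f(2) by simp
      then have "X \<noteq> {}" by blast
      ultimately have "X = T" by (rule surface_eqI[OF su _ _ bX])
      then have "?T' \<subseteq> X'" unfolding T' using X1 by blast
      then show False using X' by blast
    qed
  qed
  have "?T' \<noteq> {}"
  proof
    assume e: "?T' = {}"
    have "card ?T' = 0" unfolding e by (rule card.empty)
    then show False using card_D eul n5 by linarith
  qed
  moreover have "finite ?T'" unfolding T' using S(1) by simp
  ultimately have "surface ?T'" using card3' two li unfolding surface_def by (intro conjI ballI)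
  moreover have "card ?T' + 4 = 2 * card (\<Union>?T')"
  proof -
    have "s \<in> \<Union>T" using xs unfolding tri_edges_def by blast
    then have "card (\<Union>T - {s}) + 1 = card (\<Union>T)" using S(6) by (metis Suc_eq_plus1 card_Suc_Diff1)
    then show ?thesis unfolding V' using card_D eul by linarith
  qed
  ultimately show "sphere ?T'" unfolding sphere_def by blast
qed

section \<open>Vertices of small degree\<close>

lemma ex_small_degree:
  assumes "sphere T"
  shows "\<exists>v\<in>\<Union>T. card {f \<in> T. v \<in> f} \<le> 5"
proof (rule ccontr)
  assume no: "\<not> ?thesis"
  have su: "surface T" and eul: "card T + 4 = 2 * card (\<Union>T)" using assms unfolding sphere_def by auto
  note S = surfaceD[OF su]
  have k: "\<forall>f\<in>T. card {v \<in> \<Union>T. v \<in> f} = 3"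
  proof
    fix f assume f: "f \<in> T"
    then have "{v \<in> \<Union>T. v \<in> f} = f" by auto
    then show "card {v \<in> \<Union>T. v \<in> f} = 3" using S(3)[OF f] by simp
  qed
  have "(\<Sum>v\<in>\<Union>T. card {f \<in> T. v \<in> f}) = (\<Sum>f\<in>T. 3)"
    by (rule sum_multicount_gen) (use S k in auto)
  moreover have "(\<Sum>v\<in>\<Union>T. 6) \<le> (\<Sum>v\<in>\<Union>T. card {f \<in> T. v \<in> f})"
    by (rule sum_mono) (use no in force)
  ultimately show False using eul by simp
qed

lemma link_step:
  assumes su: "surface T" and f: "{v, p, q} \<in> T" and d: "p \<noteq> q" "v \<noteq> p" "v \<noteq> q"
  obtains r where "{v, q, r} \<in> T" "r \<noteq> p" "r \<noteq> v" "r \<noteq> q"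
    "\<And>h. h \<in> T \<Longrightarrow> {v, q} \<subseteq> h \<Longrightarrow> h = {v, p, q} \<or> h = {v, q, r}"
proof -
  obtain g where g: "g \<in> T" "g \<noteq> {v, p, q}" "{v, q} \<subseteq> g"
    "\<And>h. h \<in> T \<Longrightarrow> {v, q} \<subseteq> h \<Longrightarrow> h = {v, p, q} \<or> h = g"
    using other_face[OF su f, of "{v, q}"] d by auto
  obtain r where r: "g = {v, q, r}" "r \<noteq> v" "r \<noteq> q"
    using third_vertex[OF surfaceD(3)[OF su g(1)] g(3) d(3)] .
  have "r \<noteq> p" using g(2) r by auto
  then show ?thesis using that[of r] g r by blast
qed

lemma face_third:
  assumes "surface T" "h \<in> T" "v \<in> h"
  obtains p q where "h = {v, p, q}" "p \<noteq> q" "v \<noteq> p" "v \<noteq> q"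
proof -
  have "card (h - {v}) = 2" using surfaceD(3)[OF assms(1,2)] assms(3) by simp
  then have "\<exists>p q. h - {v} = {p, q} \<and> p \<noteq> q" by (auto simp: card_2_iff)
  then obtain p q where "h - {v} = {p, q}" "p \<noteq> q" by blast
  then have "h = {v, p, q}" "p \<noteq> q" "v \<noteq> p" "v \<noteq> q" using assms(3) by auto
  then show ?thesis using that by blast
qed

text \<open>The faces outside \<^term>\<open>M\<close> would form further cycles in the link, and a cycle has at least three edges.\<close>
lemma link_extra:
  assumes su: "surface T" and M: "M \<subseteq> {f \<in> T. v \<in> f}"
    and sat: "\<And>p h. p \<in> \<Union>M - {v} \<Longrightarrow> h \<in> T \<Longrightarrow> {v, p} \<subseteq> h \<Longrightarrow> h \<in> M"
    and le: "card {f \<in> T. v \<in> f} < card M + 3"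
  shows "{f \<in> T. v \<in> f} = M"
proof (rule ccontr)
  assume "\<not> ?thesis"
  then have "\<not> {f \<in> T. v \<in> f} \<subseteq> M" using M by blast
  then obtain h where h: "h \<in> T" "v \<in> h" "h \<notin> M" by blast
  obtain p q where pq: "h = {v, p, q}" "p \<noteq> q" "v \<noteq> p" "v \<noteq> q" by (rule face_third[OF su h(1,2)])
  have nin: "p \<notin> \<Union>M" "q \<notin> \<Union>M"
  proof -
    have "{v, p} \<subseteq> h" "{v, q} \<subseteq> h" using pq(1) by simp_all
    then show "p \<notin> \<Union>M" "q \<notin> \<Union>M" using sat[OF _ h(1)] h(3) pq(3,4) by blast+
  qed
  have h1: "{v, p, q} \<in> T" "{v, q, p} \<in> T" using h pq by (auto simp: insert_commute)
  obtain r where r: "{v, q, r} \<in> T" "r \<noteq> p" "r \<noteq> v" "r \<noteq> q" by (rule link_step[OF su h1(1)]) (use pq in auto)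
  obtain s where s: "{v, p, s} \<in> T" "s \<noteq> q" "s \<noteq> v" "s \<noteq> p" by (rule link_step[OF su h1(2)]) (use pq in auto)
  let ?X = "{{v, p, q}, {v, q, r}, {v, p, s}}"
  have "{v, p, q} \<noteq> {v, q, r}" using r pq by (metis insertE insertI1 insert_commute singletonD)
  moreover have "{v, p, q} \<noteq> {v, p, s}" using s pq by (metis insertE insertI1 insert_commute singletonD)
  moreover have "{v, q, r} \<noteq> {v, p, s}" using s r pq by (metis insertE insertI1 insert_commute singletonD)
  ultimately have "card ?X = 3" by (intro card_three)
  moreover have "x \<notin> M" if "p \<in> x \<or> q \<in> x" for x using nin that by blast
  then have "?X \<inter> M = {}" by simp
  moreover have fin: "finite {f \<in> T. v \<in> f}" using surfaceD(1)[OF su] by simp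
  moreover have "finite M" using finite_subset[OF M fin] .
  ultimately have "card (?X \<union> M) = 3 + card M" by (simp only: card_Un_disjoint finite.intros)
  moreover have "?X \<union> M \<subseteq> {f \<in> T. v \<in> f}" using M r s h1 by auto
  then have "card (?X \<union> M) \<le> card {f \<in> T. v \<in> f}" using fin card_mono by blast
  ultimately show False using le by simp
qed

lemma insert2_eq_iff:
  "v \<notin> {p, q, r, s} \<Longrightarrow> {v, p, q} = {v, r, s} \<longleftrightarrow> (p = r \<and> q = s \<or> p = s \<and> q = r)"
  by (simp add: insert_ident doubleton_eq_iff)

lemma link_cases:
  assumes su: "surface T" and v: "v \<in> \<Union>T" and le: "card {f \<in> T. v \<in> f} \<le> 5"
  obtains
    (three) p1 p2 p3 where "distinct [v, p1, p2, p3]"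
      "{f \<in> T. v \<in> f} = {{v, p1, p2}, {v, p2, p3}, {v, p3, p1}}"
  | (four) p1 p2 p3 p4 where "distinct [v, p1, p2, p3, p4]"
      "{f \<in> T. v \<in> f} = {{v, p1, p2}, {v, p2, p3}, {v, p3, p4}, {v, p4, p1}}"
  | (five) p1 p2 p3 p4 p5 where "distinct [v, p1, p2, p3, p4, p5]"
      "{f \<in> T. v \<in> f} = {{v, p1, p2}, {v, p2, p3}, {v, p3, p4}, {v, p4, p5}, {v, p5, p1}}"
proof -
  let ?L = "{f \<in> T. v \<in> f}"
  have fin: "finite ?L" using surfaceD(1)[OF su] by simp
  obtain f where f: "f \<in> T" "v \<in> f" using v by blast
  obtain p1 p2 where f1: "f = {v, p1, p2}" "p1 \<noteq> p2" "v \<noteq> p1" "v \<noteq> p2" by (rule face_third[OF su f])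
  have F1: "{v, p1, p2} \<in> T" using f f1 by simp
  obtain p3 where p3: "{v, p2, p3} \<in> T" "p3 \<noteq> p1" "p3 \<noteq> v" "p3 \<noteq> p2"
    and s2: "\<And>h. h \<in> T \<Longrightarrow> {v, p2} \<subseteq> h \<Longrightarrow> h = {v, p1, p2} \<or> h = {v, p2, p3}"
    by (rule link_step[OF su F1 f1(2-4)]; rule that; blast)
  obtain p4 where p4: "{v, p3, p4} \<in> T" "p4 \<noteq> p2" "p4 \<noteq> v" "p4 \<noteq> p3"
    and s3: "\<And>h. h \<in> T \<Longrightarrow> {v, p3} \<subseteq> h \<Longrightarrow> h = {v, p2, p3} \<or> h = {v, p3, p4}"
    using link_step[OF su p3(1) p3(4)[symmetric] f1(4) p3(3)[symmetric]] by (metis (no_types, lifting))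
  have sat1: "h = g \<or> h = g'" if "h \<in> T" "{v, p1} \<subseteq> h" "g \<in> T" "g' \<in> T" "g \<noteq> g'" "{v, p1} \<subseteq> g" "{v, p1} \<subseteq> g'" for h g g'
    using third_face_eq[OF surfaceD(1)[OF su] surface_le2[OF su], of "{v, p1}" g g' h] that f1 by simp
  show ?thesis
  proof (cases "p4 = p1")
    case True
    let ?M = "{{v, p1, p2}, {v, p2, p3}, {v, p3, p1}}"
    have F: "{v, p3, p1} \<in> T" using p4 True by simp
    have ne: "{v, p1, p2} \<noteq> {v, p2, p3}" "{v, p1, p2} \<noteq> {v, p3, p1}" "{v, p2, p3} \<noteq> {v, p3, p1}"
      using f1 p3 by (simp_all add: insert2_eq_iff)
    have "?L = ?M"
    proof (rule link_extra[OF su])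
      show "?M \<subseteq> ?L" using F1 p3 F by auto
      show "h \<in> ?M" if "p \<in> \<Union>?M - {v}" "h \<in> T" "{v, p} \<subseteq> h" for p h
      proof -
        have p: "p = p1 \<or> p = p2 \<or> p = p3" using that(1) by auto
        have "p = p1 \<Longrightarrow> h = {v, p1, p2} \<or> h = {v, p3, p1}" using sat1[OF that(2) _ F1 F ne(2)] that(3) by simp
        moreover have "p = p2 \<Longrightarrow> h = {v, p1, p2} \<or> h = {v, p2, p3}" using s2[OF that(2)] that(3) by simp
        moreover have "p = p3 \<Longrightarrow> h = {v, p2, p3} \<or> h = {v, p3, p1}" using s3[OF that(2)] that(3) True by simp
        ultimately show ?thesis using p unfolding insert_iff empty_iff by argo
      qed
      show "card ?L < card ?M + 3" using le ne by (simp add: card_three)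
    qed
    then show ?thesis using three[of p1 p2 p3] f1 p3 by auto
  next
    case False
    obtain p5 where p5: "{v, p4, p5} \<in> T" "p5 \<noteq> p3" "p5 \<noteq> v" "p5 \<noteq> p4"
      and s4: "\<And>h. h \<in> T \<Longrightarrow> {v, p4} \<subseteq> h \<Longrightarrow> h = {v, p3, p4} \<or> h = {v, p4, p5}"
      using link_step[OF su p4(1) p4(4)[symmetric] p3(3)[symmetric] p4(3)[symmetric]] by (metis (no_types, lifting))
    have "p5 \<noteq> p2"
    proof
      assume "p5 = p2"
      then have "{v, p4, p5} = {v, p1, p2} \<or> {v, p4, p5} = {v, p2, p3}" using s2[OF p5(1)] by auto
      then show False using \<open>p5 = p2\<close> False p4 p3 p5 f1 by (auto simp: insert2_eq_iff)
    qed
    show ?thesis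
    proof (cases "p5 = p1")
      case True
      let ?M = "{{v, p1, p2}, {v, p2, p3}, {v, p3, p4}, {v, p4, p1}}"
      have F: "{v, p4, p1} \<in> T" using p5 True by simp
      have d: "distinct [v, p1, p2, p3, p4]" using f1 p3 p4 False by auto
      have ne: "{v, p1, p2} \<noteq> {v, p4, p1}" using d by (simp add: insert2_eq_iff)
      have "{v, p3, p4} \<noteq> {v, p4, p1}" using d by auto
      then have cM: "card ?M = 4" using d by (simp add: insert2_eq_iff)
      have "?L = ?M"
      proof (rule link_extra[OF su])
        show "?M \<subseteq> ?L" using F1 p3 p4 F by auto
        show "h \<in> ?M" if "p \<in> \<Union>?M - {v}" "h \<in> T" "{v, p} \<subseteq> h" for p h
        proof -
          have p: "p = p1 \<or> p = p2 \<or> p = p3 \<or> p = p4" using that(1) by auto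
          have "p = p1 \<Longrightarrow> h = {v, p1, p2} \<or> h = {v, p4, p1}" using sat1[OF that(2) _ F1 F ne] that(3) by simp
          moreover have "p = p2 \<Longrightarrow> h = {v, p1, p2} \<or> h = {v, p2, p3}" using s2[OF that(2)] that(3) by simp
          moreover have "p = p3 \<Longrightarrow> h = {v, p2, p3} \<or> h = {v, p3, p4}" using s3[OF that(2)] that(3) by simp
          moreover have "p = p4 \<Longrightarrow> h = {v, p3, p4} \<or> h = {v, p4, p1}" using s4[OF that(2)] that(3) True by simp
          ultimately show ?thesis using p unfolding insert_iff empty_iff by argo
        qed
        show "card ?L < card ?M + 3" using le cM by simp
      qed
      then show ?thesis using four[OF d] by blast
    next
      case F5: False
      have d: "distinct [v, p1, p2, p3, p4, p5]" using f1 p3 p4 p5 False F5 \<open>p5 \<noteq> p2\<close> by auto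
      obtain p6 where p6: "{v, p5, p6} \<in> T" "p6 \<noteq> p4" "p6 \<noteq> v" "p6 \<noteq> p5"
        by (rule link_step[OF su p5(1)]) (use p5 p4 in auto)
      have "p6 \<noteq> p2"
      proof
        assume "p6 = p2"
        then have "{v, p5, p6} = {v, p1, p2} \<or> {v, p5, p6} = {v, p2, p3}" using s2[OF p6(1)] by auto
        then show False using \<open>p6 = p2\<close> d by (auto simp: insert2_eq_iff)
      qed
      have "p6 \<noteq> p3"
      proof
        assume "p6 = p3"
        then have "{v, p5, p6} = {v, p2, p3} \<or> {v, p5, p6} = {v, p3, p4}" using s3[OF p6(1)] by auto
        then show False using \<open>p6 = p3\<close> d by (auto simp: insert2_eq_iff)
      qed
      let ?M = "{{v, p1, p2}, {v, p2, p3}, {v, p3, p4}, {v, p4, p5}, {v, p5, p6}}"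
      have cM: "card ?M = 5"
        using d p6 \<open>p6 \<noteq> p2\<close> \<open>p6 \<noteq> p3\<close> by (simp add: insert2_eq_iff)
      have "?M \<subseteq> ?L" using F1 p3 p4 p5 p6 by auto
      then have L: "?M = ?L" using card_seteq[OF fin] le cM by (metis (no_types, lifting))
      have "p6 = p1"
      proof (rule ccontr)
        assume "p6 \<noteq> p1"
        have F1': "{v, p2, p1} \<in> T" using F1 by (simp add: insert_commute)
        obtain q where q: "{v, p1, q} \<in> T" "q \<noteq> p2" "q \<noteq> v" "q \<noteq> p1"
          by (rule link_step[OF su F1']) (use f1 in auto)
        then have "{v, p1, q} \<in> ?M" using L by auto
        then show False using q d \<open>p6 \<noteq> p1\<close> p6 by (auto simp: insert2_eq_iff)
      qed
      then show ?thesis using five[OF d] L by simp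
    qed
  qed
qed

text \<open>The fibres of \<open>\<pi>\<close> are connected, so the quotient is a minor of the triangulation. The induction is over
  all minors because merging two non-adjacent vertices of equal colour is a contraction of a smaller sphere.\<close>
definition admissible :: "'b set set \<Rightarrow> ('b \<Rightarrow> 'b) \<Rightarrow> ('b \<Rightarrow> 'c) \<Rightarrow> bool" where
  "admissible T \<pi> c \<longleftrightarrow>
     (\<forall>x\<in>\<Union>T. \<forall>y\<in>\<Union>T. \<pi> x = \<pi> y \<longrightarrow> conn {e \<in> tri_edges T. card (\<pi> ` e) = 1} x y) \<and>
     (\<forall>x y. {x, y} \<in> tri_edges T \<longrightarrow> \<pi> x \<noteq> \<pi> y \<longrightarrow> c (\<pi> x) \<noteq> c (\<pi> y))"

definition quot_edges :: "'b set set \<Rightarrow> ('b \<Rightarrow> 'b) \<Rightarrow> 'b set set" where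
  "quot_edges T \<pi> = {\<pi> ` e | e. e \<in> tri_edges T \<and> card (\<pi> ` e) = 2}"

lemma finite_quot_edges: "surface T \<Longrightarrow> finite (quot_edges T \<pi>)"
  using surfaceD(7)[of T] unfolding quot_edges_def by simp

lemma tri_edge_sub: "e \<in> tri_edges T \<Longrightarrow> e \<subseteq> \<Union>T \<and> card e = 2"
  unfolding tri_edges_def by blast

lemma star_decomp:
  "tri_edges T = {e \<in> tri_edges T. v \<notin> e} \<union> (\<lambda>u. {v, u}) ` {u. {v, u} \<in> tri_edges T}"
proof -
  have "e \<in> (\<lambda>u. {v, u}) ` {u. {v, u} \<in> tri_edges T}" if "e \<in> tri_edges T" "v \<in> e" for e
  proof -
    have "\<exists>u. e = {v, u}" using tri_edge_sub[OF that(1)] that(2) by (auto simp: card_2_iff)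
    then show ?thesis using that(1) by auto
  qed
  then show ?thesis by auto
qed

locale reducible_sphere =
  fixes T :: "'b set set" and c :: "'b \<Rightarrow> 'c"
  assumes sp: "sphere T" and fl: "flag T" and n5: "5 \<le> card (\<Union>T)"
    and pr: "\<And>x y. {x, y} \<in> tri_edges T \<Longrightarrow> c x \<noteq> c y"
    and IH: "\<And>T' \<pi>. sphere T' \<Longrightarrow> card (\<Union>T') < card (\<Union>T) \<Longrightarrow> admissible T' \<pi> c \<Longrightarrow>
       good (\<pi> ` \<Union>T') (quot_edges T' \<pi>) c"
begin

lemma su: "surface T"
  using sp unfolding sphere_def by simp

lemma contract_star:
  assumes pv: "{p, v} \<in> tri_edges T"
    and h: "\<And>q. h q = (if {v, q} \<in> tri_edges T \<and> c q = c p then p else q)"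
  shows "good (h ` (\<Union>T - {v})) (image h ` {e \<in> tri_edges T. v \<notin> e}) c"
proof -
  let ?k = "\<lambda>u. if u = v then p else u"
  let ?T' = "{?k ` f | f. f \<in> T \<and> card (?k ` f) = 3}"
  note cs = contract_sphere[OF sp fl n5 pv]
  have vT: "v \<in> \<Union>T" using tri_edge_sub[OF pv] by auto
  have pnv: "p \<noteq> v" using tri_edge_neq[OF pv] .
  have hp: "h p = p" by (simp add: h)
  have chq: "c (h q) = c q" for q by (simp add: h)
  have E'I: "e \<in> tri_edges ?T'" if "e \<in> tri_edges T" "v \<notin> e" for e
  proof -
    have "?k ` e = e" using that(2) by (auto simp: image_iff)
    moreover have "card e = 2" using tri_edge_sub[OF that(1)] by simp
    ultimately show ?thesis unfolding cs(3) using that(1) by (intro CollectI exI[of _ e]) simp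
  qed
  have E'v: "{p, q} \<in> tri_edges ?T'" if "{v, q} \<in> tri_edges T" "q \<noteq> p" for q
  proof -
    have "q \<noteq> v" using tri_edge_neq[OF that(1)] by simp
    then have "?k ` {v, q} = {p, q}" by (simp add: insert_commute)
    moreover have "card {p, q} = 2" using that(2) by simp
    ultimately show ?thesis unfolding cs(3) using that(1) by (intro CollectI exI[of _ "{v, q}"]) simp
  qed
  have E'D: "\<exists>x' y'. {x', y'} \<in> tri_edges T \<and> x = ?k x' \<and> y = ?k y'" if xy: "{x, y} \<in> tri_edges ?T'" for x y
  proof -
    obtain e where e: "e \<in> tri_edges T" "{x, y} = ?k ` e" using xy unfolding cs(3) by blast
    have "x \<in> ?k ` e" using e(2) by auto
    then obtain x' where x': "x' \<in> e" "x = ?k x'" by blast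
    have "y \<in> ?k ` e" using e(2) by auto
    then obtain y' where y': "y' \<in> e" "y = ?k y'" by blast
    have "x \<noteq> y" using tri_edge_neq[OF xy] .
    then have "x' \<noteq> y'" using x' y' by auto
    moreover have "card e = 2" using tri_edge_sub[OF e(1)] by simp
    ultimately have "e = {x', y'}" using x' y' by (auto simp: card_2_iff)
    then show ?thesis using e(1) x'(2) y'(2) by blast
  qed
  have ad: "admissible ?T' h c"
    unfolding admissible_def
  proof (intro conjI ballI allI impI)
    fix x y assume "x \<in> \<Union>?T'" "y \<in> \<Union>?T'" and hxy: "h x = h y"
    let ?M = "{e \<in> tri_edges ?T'. card (h ` e) = 1}"
    have toP: "conn ?M p q" if q: "{v, q} \<in> tri_edges T" "c q = c p" for q
    proof (cases "q = p")
      case False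
      have "h q = p" using q by (simp add: h)
      then have "card (h ` {p, q}) = 1" using hp by simp
      then show ?thesis using E'v[OF q(1) False] by (intro conn_edge) simp
    qed simp
    have pN: "{v, p} \<in> tri_edges T" using pv by (simp add: insert_commute)
    show "conn ?M x y"
    proof (cases "{v, x} \<in> tri_edges T \<and> c x = c p")
      case xN: True
      then have "h x = p" by (simp add: h)
      then have "{v, y} \<in> tri_edges T \<and> c y = c p" using hxy pN by (auto simp: h split: if_splits)
      then show ?thesis using conn_trans[OF conn_sym[OF toP] toP] xN by blast
    next
      case False
      then have "x = y" using hxy pN by (auto simp: h split: if_splits)
      then show ?thesis by simp
    qed
  next
    fix x y assume xy: "{x, y} \<in> tri_edges ?T'" and hxy: "h x \<noteq> h y"
    obtain x' y' where e: "{x', y'} \<in> tri_edges T" "x = ?k x'" "y = ?k y'" using E'D[OF xy] by blast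
    have "x' \<noteq> y'" using tri_edge_neq[OF e(1)] .
    have pq: "c q \<noteq> c p" if "{v, q} \<in> tri_edges T" "h q \<noteq> p" for q
      using that by (auto simp: h split: if_splits)
    have "c x \<noteq> c y"
    proof (cases "x' = v \<or> y' = v")
      case False
      then show ?thesis using pr e by simp
    next
      case True
      then consider "x' = v" | "y' = v" by blast
      then show ?thesis
      proof cases
        case 1
        then have "x = p" "y = y'" "{v, y} \<in> tri_edges T" using e \<open>x' \<noteq> y'\<close> by auto
        then show ?thesis using pq[of y] hxy hp by auto
      next
        case 2
        then have "y = p" "x = x'" "{v, x} \<in> tri_edges T" using e \<open>x' \<noteq> y'\<close> by (auto simp: insert_commute)
        then show ?thesis using pq[of x] hxy hp by auto
      qed
    qed
    then show "c (h x) \<noteq> c (h y)" using chq by simp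
  qed
  have "card (\<Union>?T') < card (\<Union>T)"
    unfolding cs(2) using vT surfaceD(6)[OF su] by (intro psubset_card_mono) auto
  from IH[OF cs(1) this ad] have "good (h ` (\<Union>T - {v})) (quot_edges ?T' h) c" unfolding cs(2) .
  moreover have "image h ` {e \<in> tri_edges T. v \<notin> e} \<subseteq> quot_edges ?T' h"
  proof
    fix e' assume "e' \<in> image h ` {e \<in> tri_edges T. v \<notin> e}"
    then obtain e where e: "e \<in> tri_edges T" "v \<notin> e" "e' = h ` e" by blast
    have "\<exists>x y. e = {x, y} \<and> x \<noteq> y" using tri_edge_sub[OF e(1)] by (auto simp: card_2_iff)
    then obtain x y where xy: "e = {x, y}" by blast
    have "c (h x) \<noteq> c (h y)" using pr e xy chq by simp
    then have "h x \<noteq> h y" by auto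
    then have "card (h ` e) = 2" using xy by simp
    then show "e' \<in> quot_edges ?T' h" unfolding quot_edges_def using E'I[OF e(1,2)] e(3) by blast
  qed
  moreover have "finite (quot_edges ?T' h)" using finite_quot_edges cs(1) unfolding sphere_def by blast
  ultimately show ?thesis by (rule good_subset)
qed

lemma reduce_unique:
  assumes N: "{u. {v, u} \<in> tri_edges T} = N" "p \<in> N" "\<And>q. q \<in> N \<Longrightarrow> c q = c p \<Longrightarrow> q = p"
    and N': "N' \<subseteq> N" "inj_on c N'" "card N \<le> card N' + 1"
  shows "good (\<Union>T) (tri_edges T) c"
proof -
  have vp: "{v, p} \<in> tri_edges T" using N by auto
  then have pv: "{p, v} \<in> tri_edges T" by (simp add: insert_commute)
  let ?h = "\<lambda>q. if {v, q} \<in> tri_edges T \<and> c q = c p then p else q"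
  have h: "?h = (\<lambda>q. q)"
  proof
    fix q
    show "?h q = q" using N(3)[of q] N(1) by auto
  qed
  have "good (?h ` (\<Union>T - {v})) (image ?h ` {e \<in> tri_edges T. v \<notin> e}) c"
    by (rule contract_star[OF pv refl])
  then have g: "good (\<Union>T - {v}) {e \<in> tri_edges T. v \<notin> e} c" unfolding h by simp
  have "good (\<Union>T) ({e \<in> tri_edges T. v \<notin> e} \<union> (\<lambda>u. {v, u}) ` N) c"
  proof (rule good_add_vertex[OF surfaceD(6)[OF su] _ _ g _ _ N'])
    show "v \<in> \<Union>T" using tri_edge_sub[OF vp] by auto
    show "e \<subseteq> \<Union>T - {v} \<and> card e = 2" if "e \<in> {e \<in> tri_edges T. v \<notin> e}" for e
      using that tri_edge_sub[of e T] by auto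
    have Nu: "{v, u} \<in> tri_edges T" if "u \<in> N" for u using that N(1) by auto
    show "N \<subseteq> \<Union>T - {v}"
    proof
      fix u assume "u \<in> N"
      then show "u \<in> \<Union>T - {v}" using tri_edge_sub[OF Nu[of u]] tri_edge_neq[OF Nu[of u]] by auto
    qed
    show "c u \<noteq> c v" if "u \<in> N" for u using pr[OF Nu[OF that]] by simp
  qed
  then show ?thesis using star_decomp[of T v] N(1) by simp
qed

lemma reduce_pair:
  assumes N: "{u. {v, u} \<in> tri_edges T} = N" and a: "a1 \<in> N" "a2 \<in> N" "a1 \<noteq> a2" "c a2 = c a1"
    and uniq: "\<And>q. q \<in> N \<Longrightarrow> c q = c a1 \<Longrightarrow> q = a1 \<or> q = a2"
    and b: "b \<in> N" "{a1, b} \<in> tri_edges T" "{a2, b} \<in> tri_edges T"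
    and W: "\<And>w. {a1, w} \<in> tri_edges T \<Longrightarrow> {a2, w} \<in> tri_edges T \<Longrightarrow> w \<noteq> v \<Longrightarrow> w \<in> W" "finite W" "card W \<le> 2"
    and N': "N' \<subseteq> N - {a2}" "a1 \<in> N'" "inj_on c N'" "card W + card N \<le> card N' + 4"
  shows "good (\<Union>T) (tri_edges T) c"
proof -
  have Nu: "{v, u} \<in> tri_edges T" if "u \<in> N" for u using that N by auto
  have pv: "{a1, v} \<in> tri_edges T" using Nu[OF a(1)] by (simp add: insert_commute)
  let ?E' = "{e \<in> tri_edges T. v \<notin> e}"
  let ?h = "\<lambda>x. if x = a2 then a1 else x"
  have NV: "N \<subseteq> \<Union>T - {v}"
  proof
    fix u assume "u \<in> N"
    then show "u \<in> \<Union>T - {v}" using tri_edge_sub[OF Nu[of u]] tri_edge_neq[OF Nu[of u]] by auto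
  qed
  have h: "?h q = (if {v, q} \<in> tri_edges T \<and> c q = c a1 then a1 else q)" for q
  proof (cases "{v, q} \<in> tri_edges T \<and> c q = c a1")
    case True
    then have "q = a1 \<or> q = a2" using uniq N by auto
    then show ?thesis using True by auto
  next
    case False
    then have "q \<noteq> a2" using Nu[OF a(2)] a(4) by auto
    then show ?thesis unfolding if_not_P[OF False] by simp
  qed
  have g: "good (?h ` (\<Union>T - {v})) (image ?h ` ?E') c"
    by (rule contract_star[OF pv h])
  have Wsub: "{w. {a1, w} \<in> ?E' \<and> {a2, w} \<in> ?E'} \<subseteq> W" using W(1) by auto
  have Wc: "card {w. {a1, w} \<in> ?E' \<and> {a2, w} \<in> ?E'} \<le> card W" by (rule card_mono[OF W(2) Wsub])
  have vn: "v \<noteq> a1" "v \<noteq> a2" "v \<noteq> b" using a b NV by auto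
  have "good (\<Union>T) (?E' \<union> (\<lambda>u. {v, u}) ` N) c"
  proof (rule good_merge[OF surfaceD(6)[OF su] _ _ _ a(1,2,3) a(4)[symmetric] g NV _ b(1) _ _ _ N'(1-3)])
    show "v \<in> \<Union>T" using tri_edge_sub[OF pv] by auto
    show "e \<subseteq> \<Union>T - {v} \<and> card e = 2" if "e \<in> ?E'" for e
      using that tri_edge_sub[of e T] by auto
    show "c x \<noteq> c y" if "{x, y} \<in> ?E'" for x y using that pr by simp
    show "c u \<noteq> c v" if "u \<in> N" for u using pr[OF Nu[OF that]] by simp
    show "{a1, b} \<in> ?E'" "{a2, b} \<in> ?E'" using b vn by auto
    show "card {w. {a1, w} \<in> ?E' \<and> {a2, w} \<in> ?E'} \<le> 2" using Wc W(3) by simp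
    show "card {w. {a1, w} \<in> ?E' \<and> {a2, w} \<in> ?E'} + card N \<le> card N' + 4" using Wc N'(4) by simp
  qed
  then show ?thesis using star_decomp[of T v] N by simp
qed

end

lemma square_common:
  assumes sp: "sphere T" and f: "{v, a, b1} \<in> T" "{v, a, b2} \<in> T" "b1 \<noteq> b2"
    and e: "{v, a'} \<in> tri_edges T" "{a', w} \<in> tri_edges T" "{w, a} \<in> tri_edges T"
    and d: "distinct [v, a', w, a]" and nb: "b1 \<notin> {v, a', w, a}" "b2 \<notin> {v, a', w, a}"
  obtains A where "A \<subseteq> T" "bd T A = {{v, a'}, {a', w}, {w, a}, {a, v}}" "A \<noteq> {}" "A \<noteq> T"
    "{v, a, b1} \<in> A" "{v, a, b2} \<in> T - A" "\<Union>A \<inter> \<Union>(T - A) = {v, a', w, a}"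
    "\<And>u. {b1, u} \<in> tri_edges T \<Longrightarrow> {b2, u} \<in> tri_edges T \<Longrightarrow> u \<in> {v, a', w, a}"
proof -
  have su: "surface T" using sp unfolding sphere_def by simp
  note S = surfaceD[OF su] and main = that
  have av: "{a, v} \<in> tri_edges T" using face_edge[OF su f(1), of a v] d by auto
  obtain A where A: "A \<subseteq> T" "A \<noteq> {}" "A \<noteq> T" "bd T A = {{v, a'}, {a', w}, {w, a}, {a, v}}"
    "\<Union>A \<inter> \<Union>(T - A) = {v, a', w, a}" using square_separation[OF sp e av d] by blast
  have opp: "{v, a, b1} \<in> X \<longleftrightarrow> {v, a, b2} \<in> T - X"
    if X: "X \<subseteq> T" "bd T X = {{v, a'}, {a', w}, {w, a}, {a, v}}" for X
  proof -
    have "{a, v} \<in> bd T X" using X by simp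
    then obtain f' g' where fg: "f' \<in> X" "g' \<in> T - X" "{a, v} \<subseteq> f'" "{a, v} \<subseteq> g'" unfolding bd_def by blast
    have ne: "{v, a, b1} \<noteq> {v, a, b2}" using f(3) nb by (auto simp: insert_eq_iff)
    have c2: "card {a, v} = 2" using d by auto
    have "f' = {v, a, b1} \<or> f' = {v, a, b2}" "g' = {v, a, b1} \<or> g' = {v, a, b2}"
      using third_face_eq[OF S(1) surface_le2[OF su c2] f(1,2) _ _ _ _ ne] fg X(1) by blast+
    then show ?thesis using fg by blast
  qed
  have fin: ?thesis if X: "X \<subseteq> T" "bd T X = {{v, a'}, {a', w}, {w, a}, {a, v}}" "X \<noteq> {}" "X \<noteq> T"
     "{v, a, b1} \<in> X" "\<Union>X \<inter> \<Union>(T - X) = {v, a', w, a}" for X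
  proof (rule main[OF X(1-5) _ X(6)])
    show o: "{v, a, b2} \<in> T - X" using opp[OF X(1,2)] X(5) by blast
    fix u assume u: "{b1, u} \<in> tri_edges T" "{b2, u} \<in> tri_edges T"
    obtain k where k: "k \<in> T" "{b1, u} \<subseteq> k" using u(1) unfolding tri_edges_def by blast
    obtain l where l: "l \<in> T" "{b2, u} \<subseteq> l" using u(2) unfolding tri_edges_def by blast
    have "b1 \<in> \<Union>X" "b2 \<in> \<Union>(T - X)" using X(5) o by blast+
    then have "b1 \<notin> \<Union>(T - X)" "b2 \<notin> \<Union>X" using X(6) nb by blast+
    then have "k \<in> X" "l \<in> T - X" using k l by blast+
    then have "u \<in> \<Union>X \<inter> \<Union>(T - X)" using k l by blast
    then show "u \<in> {v, a', w, a}" using X(6) by simp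
  qed
  show ?thesis
  proof (cases "{v, a, b1} \<in> A")
    case True
    then show ?thesis using fin A by blast
  next
    case False
    then have 1: "{v, a, b1} \<in> T - A" using f by simp
    have "T - (T - A) = A" "T - A \<noteq> T" using A(1,2) by blast+
    then show ?thesis using fin[of "T - A"] 1 A bd_compl[OF A(1)] by (simp add: Int_commute)
  qed
qed


lemma good_star:
  assumes "col_acy c F" "finite F" "finite N" "v \<notin> \<Union>F" "v \<notin> N" "inj_on c N"
  shows "col_acy c (F \<union> (\<lambda>u. {v, u}) ` N) \<and> finite (F \<union> (\<lambda>u. {v, u}) ` N) \<and>
     card (F \<union> (\<lambda>u. {v, u}) ` N) = card F + card N"
proof -
  have "inj_on (\<lambda>u. {v, u}) N" by (auto simp: inj_on_def doubleton_eq_iff)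
  moreover have "F \<inter> (\<lambda>u. {v, u}) ` N = {}" using assms(4) by blast
  ultimately have "card (F \<union> (\<lambda>u. {v, u}) ` N) = card F + card N"
    using assms(2,3) card_image[of "\<lambda>u. {v, u}" N] by (simp add: card_Un_disjoint)
  moreover have "col_acy c (F \<union> (\<lambda>u. {v, u}) ` N)"
    using assms by (intro col_acy_star) auto
  ultimately show ?thesis using assms(2,3) by simp
qed

lemma good_octahedron:
  fixes c :: "'b \<Rightarrow> 'c"
  assumes d: "distinct [v, w, p1, p2, p3, p4]" and V: "\<Union>T = {v, w, p1, p2, p3, p4}" and sp: "sphere T"
    and pr: "\<And>x y. {x, y} \<in> tri_edges T \<Longrightarrow> c x \<noteq> c y"
    and e: "{p1, p2} \<in> tri_edges T" "{p2, p3} \<in> tri_edges T" "{p3, p4} \<in> tri_edges T" "{p4, p1} \<in> tri_edges T"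
    and ev: "\<And>p. p \<in> {p1, p2, p3, p4} \<Longrightarrow> {v, p} \<in> tri_edges T \<and> {w, p} \<in> tri_edges T"
    and c: "c p1 = c p3" "c p2 = c p4"
  shows "good (\<Union>T) (tri_edges T) c"
proof -
  have su: "surface T" and eul: "card T + 4 = 2 * card (\<Union>T)" using sp unfolding sphere_def by auto
  have d': "p1 \<noteq> v" "p2 \<noteq> v" "p3 \<noteq> v" "p4 \<noteq> v" "p1 \<noteq> w" "p2 \<noteq> w" "p3 \<noteq> w" "p4 \<noteq> w" "w \<noteq> v"
    "p2 \<noteq> p1" "p3 \<noteq> p1" "p4 \<noteq> p1" "p3 \<noteq> p2" "p4 \<noteq> p2" "p4 \<noteq> p3" using d by auto
  have "card (\<Union>T) = 6" unfolding V using d by simp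
  then have cE: "card (tri_edges T) = 12" "card (\<Union>T) = 6" using card_tri_edges[OF su] eul by linarith+
  define S where "S = (\<lambda>x N. (\<lambda>u. {x, u}) ` (N :: 'b set))"
  have stars: "S v {p1, p2} \<union> S p3 {p2, v} \<union> S p4 {p1, v} \<union> S p2 {p1} \<union> S w {p1, p2, p3, p4} \<subseteq> tri_edges T"
    using e ev unfolding S_def by (auto simp: insert_commute)
  have cne: "c p1 \<noteq> c p2" "c v \<noteq> c p1" "c v \<noteq> c p2" "c w \<noteq> c p1" "c w \<noteq> c p2"
    using pr e(1) ev by simp_all
  note cne' = cne cne[THEN not_sym]
  have 0: "col_acy c {}" unfolding col_acy_def by simp
  define F1 where "F1 = {} \<union> S p2 {p1}"
  have U1: "\<Union>F1 = {p1, p2}" unfolding F1_def S_def by auto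
  have 1: "col_acy c F1 \<and> finite F1 \<and> card F1 = card ({} :: 'b set set) + card {p1}"
    unfolding F1_def S_def by (rule good_star[OF 0]) (use d d' in simp_all)
  define F2 where "F2 = F1 \<union> S v {p1, p2}"
  have U2: "\<Union>F2 = {p1, p2, v}" unfolding F2_def using U1 by (auto simp: S_def)
  have 2: "col_acy c F2 \<and> finite F2 \<and> card F2 = card F1 + card {p1, p2}"
    unfolding F2_def S_def by (rule good_star) (use 1 U1 d d' cne' in simp_all)
  define F3 where "F3 = F2 \<union> S p3 {p2, v}"
  have U3: "\<Union>F3 = {p1, p2, v, p3}" unfolding F3_def using U2 by (auto simp: S_def)
  have 3: "col_acy c F3 \<and> finite F3 \<and> card F3 = card F2 + card {p2, v}"
    unfolding F3_def S_def by (rule good_star) (use 2 U2 d d' cne' in simp_all)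
  define F4 where "F4 = F3 \<union> S p4 {p1, v}"
  have U4: "\<Union>F4 = {p1, p2, v, p3, p4}" unfolding F4_def using U3 by (auto simp: S_def)
  have 4: "col_acy c F4 \<and> finite F4 \<and> card F4 = card F3 + card {p1, v}"
    unfolding F4_def S_def by (rule good_star) (use 3 U3 d d' cne' in simp_all)
  have cards: "card {p1, p2} = 2" "card {p2, v} = 2" "card {p1, v} = 2" using d by auto
  have F4: "col_acy c F4" "finite F4" "card F4 = 7" using 1 2 3 4 by (simp_all add: cards)
  have F4E: "F4 \<subseteq> tri_edges T" using stars unfolding F1_def F2_def F3_def F4_def by auto
  have cV: "c ` \<Union>T = {c v, c w, c p1, c p2}" unfolding V using c by auto
  show ?thesis
  proof (cases "c w = c v")
    case True
    have 5: "col_acy c (F4 \<union> S w {p1, p2}) \<and> finite (F4 \<union> S w {p1, p2}) \<and> card (F4 \<union> S w {p1, p2}) = card F4 + card {p1, p2}"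
      unfolding S_def by (rule good_star) (use F4 U4 d d' cne' in simp_all)
    have "c ` \<Union>T = {c v, c p1, c p2}" using cV True by auto
    then have "card (c ` \<Union>T) = 3" using cne by simp
    moreover have "F4 \<union> S w {p1, p2} \<subseteq> tri_edges T" using F4E stars unfolding S_def by auto
    ultimately show ?thesis unfolding good_def using 5 F4 cE d
      by (intro exI[of _ "F4 \<union> S w {p1, p2}"]) simp
  next
    case False
    have a: "col_acy c (F4 \<union> S w {p1, p2, p3, p4})"
      unfolding S_def
    proof (rule col_acy_star_unique[OF _ F4(1)])
      show "finite {p1, p2, p3, p4}" by simp
      show "c u \<noteq> c w" if "u \<in> {p1, p2, p3, p4}" for u using that c cne by auto
      show "c x \<noteq> c w" if "x \<in> \<Union>F4" for x using that c cne False unfolding U4 by auto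
    qed
    have "w \<notin> \<Union>F4" unfolding U4 using d by auto
    then have "F4 \<inter> S w {p1, p2, p3, p4} = {}" unfolding S_def by blast
    moreover have "card (S w {p1, p2, p3, p4}) = card {p1, p2, p3, p4}"
      unfolding S_def by (rule card_image) (auto simp: inj_on_def doubleton_eq_iff)
    moreover have "finite (S w {p1, p2, p3, p4})" unfolding S_def by simp
    ultimately have "card (F4 \<union> S w {p1, p2, p3, p4}) = 11"
      using F4 d by (simp add: card_Un_disjoint)
    moreover have "card (c ` \<Union>T) \<le> 4" unfolding cV using card_length[of "[c v, c w, c p1, c p2]"] by simp
    moreover have "F4 \<union> S w {p1, p2, p3, p4} \<subseteq> tri_edges T" using F4E stars by auto
    ultimately show ?thesis unfolding good_def using a cE
      by (intro exI[of _ "F4 \<union> S w {p1, p2, p3, p4}"]) simp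
  qed
qed

lemma link_neighbours:
  assumes su: "surface T"
  shows "{u. {v, u} \<in> tri_edges T} = \<Union>{f \<in> T. v \<in> f} - {v}"
proof (intro equalityI subsetI)
  fix u assume "u \<in> {u. {v, u} \<in> tri_edges T}"
  then have u: "{v, u} \<in> tri_edges T" by simp
  then obtain f where "f \<in> T" "{v, u} \<subseteq> f" by (rule tri_edgesE)
  then show "u \<in> \<Union>{f \<in> T. v \<in> f} - {v}" using tri_edge_neq[OF u] by auto
next
  fix u assume "u \<in> \<Union>{f \<in> T. v \<in> f} - {v}"
  then obtain f where "f \<in> T" "{v, u} \<subseteq> f" "u \<noteq> v" by auto
  then show "u \<in> {u. {v, u} \<in> tri_edges T}" using face_edge[OF su, of f v u] by simp
qed

lemma octahedron:
  assumes sp: "sphere T" and fl: "flag T" and d: "distinct [v, w, p1, p2, p3, p4]"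
    and f: "{v, p1, p2} \<in> T" "{v, p2, p3} \<in> T" "{v, p3, p4} \<in> T" "{v, p4, p1} \<in> T"
    and w: "\<And>p. p \<in> {p1, p2, p3, p4} \<Longrightarrow> {w, p} \<in> tri_edges T"
  shows "\<Union>T = {v, w, p1, p2, p3, p4}"
proof -
  have su: "surface T" using sp unfolding sphere_def by simp
  have e: "{p1, p2} \<in> tri_edges T" "{p2, p3} \<in> tri_edges T" "{p3, p4} \<in> tri_edges T" "{p4, p1} \<in> tri_edges T"
    using face_edge[OF su f(1), of p1 p2] face_edge[OF su f(2), of p2 p3]
      face_edge[OF su f(3), of p3 p4] face_edge[OF su f(4), of p4 p1] d by auto
  have w': "{p, w} \<in> tri_edges T" if "p \<in> {p1, p2, p3, p4}" for p using w[OF that] by (simp add: insert_commute)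
  have g: "{w, p1, p2} \<in> T" "{w, p2, p3} \<in> T" "{w, p3, p4} \<in> T" "{w, p4, p1} \<in> T"
    using flagD[OF fl w e(1) w'] flagD[OF fl w e(2) w'] flagD[OF fl w e(3) w'] flagD[OF fl w e(4) w'] d by auto
  have d': "p1 \<noteq> v" "p2 \<noteq> v" "p3 \<noteq> v" "p4 \<noteq> v" "p1 \<noteq> w" "p2 \<noteq> w" "p3 \<noteq> w" "p4 \<noteq> w" "w \<noteq> v"
    "p2 \<noteq> p1" "p3 \<noteq> p1" "p4 \<noteq> p1" "p3 \<noteq> p2" "p4 \<noteq> p2" "p4 \<noteq> p3" using d by auto
  define A where "A = {{v, p1, p2}, {v, p2, p3}, {v, p3, p4}, {v, p4, p1},
     {w, p1, p2}, {w, p2, p3}, {w, p3, p4}, {w, p4, p1}}"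
  define dbl where "dbl = (\<lambda>e. \<exists>f1\<in>A. \<exists>f2\<in>A. f1 \<noteq> f2 \<and> e \<subseteq> f1 \<and> e \<subseteq> f2)"
  have dblI: "dbl e" if "f1 \<in> A" "f2 \<in> A" "f1 \<noteq> f2" "e \<subseteq> f1" "e \<subseteq> f2" for e f1 f2
    using that unfolding dbl_def by blast
  have memA: "{v, p1, p2} \<in> A" "{v, p2, p3} \<in> A" "{v, p3, p4} \<in> A" "{v, p4, p1} \<in> A"
     "{w, p1, p2} \<in> A" "{w, p2, p3} \<in> A" "{w, p3, p4} \<in> A" "{w, p4, p1} \<in> A" unfolding A_def by simp_all
  have db: "dbl {v, p1}" "dbl {v, p2}" "dbl {v, p3}" "dbl {v, p4}"
    "dbl {w, p1}" "dbl {w, p2}" "dbl {w, p3}" "dbl {w, p4}"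
    "dbl {p1, p2}" "dbl {p2, p3}" "dbl {p3, p4}" "dbl {p4, p1}"
  proof -
    show "dbl {v, p1}" by (rule dblI[OF memA(4) memA(1)]) (use d d' in \<open>simp_all add: insert2_eq_iff\<close>)
    show "dbl {v, p2}" by (rule dblI[OF memA(1) memA(2)]) (use d d' in \<open>simp_all add: insert2_eq_iff\<close>)
    show "dbl {v, p3}" by (rule dblI[OF memA(2) memA(3)]) (use d d' in \<open>simp_all add: insert2_eq_iff\<close>)
    show "dbl {v, p4}" by (rule dblI[OF memA(3) memA(4)]) (use d d' in \<open>simp_all add: insert2_eq_iff\<close>)
    show "dbl {w, p1}" by (rule dblI[OF memA(8) memA(5)]) (use d d' in \<open>simp_all add: insert2_eq_iff\<close>)
    show "dbl {w, p2}" by (rule dblI[OF memA(5) memA(6)]) (use d d' in \<open>simp_all add: insert2_eq_iff\<close>)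
    show "dbl {w, p3}" by (rule dblI[OF memA(6) memA(7)]) (use d d' in \<open>simp_all add: insert2_eq_iff\<close>)
    show "dbl {w, p4}" by (rule dblI[OF memA(7) memA(8)]) (use d d' in \<open>simp_all add: insert2_eq_iff\<close>)
    show "dbl {p1, p2}" by (rule dblI[OF memA(1) memA(5)]) (use d in auto)
    show "dbl {p2, p3}" by (rule dblI[OF memA(2) memA(6)]) (use d in auto)
    show "dbl {p3, p4}" by (rule dblI[OF memA(3) memA(7)]) (use d in auto)
    show "dbl {p4, p1}" by (rule dblI[OF memA(4) memA(8)]) (use d in auto)
  qed
  have dt: "dbl e" if "dbl {p, q}" "dbl {q, r}" "dbl {p, r}" "e \<subseteq> {p, q, r}" "card e = 2" for e p q r
    using tri_sub2[OF that(4,5)] that(1-3) by (elim disjE) simp_all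
  have sym: "dbl {y, x}" if "dbl {x, y}" for x y using that by (simp add: insert_commute)
  have "A = T"
  proof (rule surface_closed_eqI[OF su])
    show "A \<subseteq> T" "A \<noteq> {}" using f g unfolding A_def by simp_all
    fix h e assume h: "h \<in> A" "e \<subseteq> h" "card e = 2"
    have "dbl e"
      using h(1) unfolding A_def insert_iff empty_iff simp_thms
      by (elim disjE) (use h(2,3) db sym dt in metis)+
    then show "\<exists>f1\<in>A. \<exists>f2\<in>A. f1 \<noteq> f2 \<and> e \<subseteq> f1 \<and> e \<subseteq> f2" unfolding dbl_def .
  qed
  then have "\<Union>T = \<Union>A" by simp
  also have "\<Union>A = {v, w, p1, p2, p3, p4}" unfolding A_def by auto
  finally show ?thesis .
qed

context reducible_sphere
begin

lemma degree4:
  assumes d: "distinct [v, p1, p2, p3, p4]"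
    and L: "{f \<in> T. v \<in> f} = {{v, p1, p2}, {v, p2, p3}, {v, p3, p4}, {v, p4, p1}}"
  shows "good (\<Union>T) (tri_edges T) c"
proof -
  have f: "{v, p1, p2} \<in> T" "{v, p2, p3} \<in> T" "{v, p3, p4} \<in> T" "{v, p4, p1} \<in> T" using L by blast+
  have "\<Union>{f \<in> T. v \<in> f} - {v} = {p1, p2, p3, p4}" unfolding L using d by auto
  then have N: "{u. {v, u} \<in> tri_edges T} = {p1, p2, p3, p4}" using link_neighbours[OF su] by metis
  have e: "{p1, p2} \<in> tri_edges T" "{p2, p3} \<in> tri_edges T" "{p3, p4} \<in> tri_edges T" "{p4, p1} \<in> tri_edges T"
    using face_edge[OF su f(1), of p1 p2] face_edge[OF su f(2), of p2 p3]
      face_edge[OF su f(3), of p3 p4] face_edge[OF su f(4), of p4 p1] d by auto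
  then have e': "{p2, p1} \<in> tri_edges T" "{p3, p2} \<in> tri_edges T" "{p4, p3} \<in> tri_edges T" "{p1, p4} \<in> tri_edges T"
    by (simp_all add: insert_commute)
  note cc = pr[OF e(1)] pr[OF e(2)] pr[OF e(3)] pr[OF e(4)]
  consider (a) "c p1 \<noteq> c p3" | (b) "c p2 \<noteq> c p4" | (c) "c p1 = c p3" "c p2 = c p4" by blast
  then show ?thesis
  proof cases
    case a
    show ?thesis
      by (rule reduce_unique[OF N, of p1 "{p1, p2, p3}"]) (use a cc d in \<open>auto simp: inj_on_def\<close>)
  next
    case b
    show ?thesis
      by (rule reduce_unique[OF N, of p2 "{p2, p3, p4}"]) (use b cc d in \<open>auto simp: inj_on_def\<close>)
  next
    case c
    show ?thesis
    proof (cases "\<exists>w. {p1, w} \<in> tri_edges T \<and> {p3, w} \<in> tri_edges T \<and> w \<noteq> v \<and> w \<notin> {p2, p4}")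
      case False
      show ?thesis
        by (rule reduce_pair[OF N, of p1 p3 p2 "{p2, p4}" "{p1, p2}"])
          (use False c cc d e e' in \<open>auto simp: inj_on_def\<close>)
    next
      case True
      then obtain w where w: "{p1, w} \<in> tri_edges T" "{p3, w} \<in> tri_edges T" "w \<noteq> v" "w \<notin> {p2, p4}" by blast
      show ?thesis
      proof (cases "\<exists>w'. {p2, w'} \<in> tri_edges T \<and> {p4, w'} \<in> tri_edges T \<and> w' \<noteq> v \<and> w' \<notin> {p1, p3}")
        case False
        show ?thesis
          by (rule reduce_pair[OF N, of p2 p4 p3 "{p1, p3}" "{p2, p3}"])
            (use False c cc d e e' in \<open>auto simp: inj_on_def\<close>)
      next
        case True
        then obtain w' where w': "{p2, w'} \<in> tri_edges T" "{p4, w'} \<in> tri_edges T" "w' \<noteq> v" "w' \<notin> {p1, p3}" by blast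
        have wp: "w \<noteq> p1" "w \<noteq> p3" using tri_edge_neq[OF w(1)] tri_edge_neq[OF w(2)] by auto
        have f': "{v, p3, p2} \<in> T" "{v, p3, p4} \<in> T" using f by (simp_all add: insert_commute)
        have vp1: "{v, p1} \<in> tri_edges T" using N by auto
        have ww: "{w, p3} \<in> tri_edges T" using w(2) by (simp add: insert_commute)
        have d4: "distinct [v, p1, w, p3]" using d w wp by auto
        have "w' \<in> {v, p1, w, p3}"
          by (rule square_common[OF sp f' _ vp1 w(1) ww d4])
            (use w' w d in auto)
        then have "w' = w" using w' by auto
        then have wN: "{w, p} \<in> tri_edges T" if "p \<in> {p1, p2, p3, p4}" for p
          using that w w' by (auto simp: insert_commute)
        have vN: "{v, p} \<in> tri_edges T" if "p \<in> {p1, p2, p3, p4}" for p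
          using that N by blast
        have d6: "distinct [v, w, p1, p2, p3, p4]" using d w wp by auto
        have V: "\<Union>T = {v, w, p1, p2, p3, p4}" by (rule octahedron[OF sp fl d6 f wN])
        show ?thesis by (rule good_octahedron[OF d6 V sp pr e _ c]) (use wN vN in auto)
      qed
    qed
  qed
qed

lemma degree5_one:
  assumes d: "distinct [v, p1, p2, p3, p4, p5]"
    and L: "{f \<in> T. v \<in> f} = {{v, p1, p2}, {v, p2, p3}, {v, p3, p4}, {v, p4, p5}, {v, p5, p1}}"
    and c: "c p2 \<noteq> c p4" "c p3 \<noteq> c p5" "c p4 \<noteq> c p1" "c p5 \<noteq> c p2"
  shows "good (\<Union>T) (tri_edges T) c"
proof -
  have f: "{v, p1, p2} \<in> T" "{v, p2, p3} \<in> T" "{v, p3, p4} \<in> T" "{v, p4, p5} \<in> T" "{v, p5, p1} \<in> T" using L by blast+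
  have "\<Union>{f \<in> T. v \<in> f} - {v} = {p1, p2, p3, p4, p5}" unfolding L using d by auto
  then have N: "{u. {v, u} \<in> tri_edges T} = {p1, p2, p3, p4, p5}" using link_neighbours[OF su] by metis
  have e: "{p1, p2} \<in> tri_edges T" "{p2, p3} \<in> tri_edges T" "{p3, p4} \<in> tri_edges T" "{p4, p5} \<in> tri_edges T"
     "{p5, p1} \<in> tri_edges T"
    using face_edge[OF su f(1), of p1 p2] face_edge[OF su f(2), of p2 p3]
      face_edge[OF su f(3), of p3 p4] face_edge[OF su f(4), of p4 p5] face_edge[OF su f(5), of p5 p1] d by auto
  note cc = pr[OF e(1)] pr[OF e(2)] pr[OF e(3)] pr[OF e(4)] pr[OF e(5)]
  show ?thesis
    by (rule reduce_unique[OF N, of p2 "{p1, p2, p4, p5}"]) (use c cc d in \<open>auto simp: inj_on_def\<close>)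
qed

lemma degree5_two:
  assumes d: "distinct [v, p1, p2, p3, p4, p5]"
    and L: "{f \<in> T. v \<in> f} = {{v, p1, p2}, {v, p2, p3}, {v, p3, p4}, {v, p4, p5}, {v, p5, p1}}"
    and c: "c p1 = c p3" "c p2 = c p4"
    and no4: "\<And>u p q r s. distinct [u, p, q, r, s] \<Longrightarrow> {f \<in> T. u \<in> f} \<noteq> {{u, p, q}, {u, q, r}, {u, r, s}, {u, s, p}}"
  shows "good (\<Union>T) (tri_edges T) c"
proof -
  note S = surfaceD[OF su]
  have f: "{v, p1, p2} \<in> T" "{v, p2, p3} \<in> T" "{v, p3, p4} \<in> T" "{v, p4, p5} \<in> T" "{v, p5, p1} \<in> T" using L by blast+
  have "\<Union>{f \<in> T. v \<in> f} - {v} = {p1, p2, p3, p4, p5}" unfolding L using d by auto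
  then have N: "{u. {v, u} \<in> tri_edges T} = {p1, p2, p3, p4, p5}" using link_neighbours[OF su] by metis
  have vN: "{v, p} \<in> tri_edges T" "{p, v} \<in> tri_edges T" if "p \<in> {p1, p2, p3, p4, p5}" for p
  proof -
    show "{v, p} \<in> tri_edges T" using that N by blast
    then show "{p, v} \<in> tri_edges T" by (simp add: insert_commute)
  qed
  have e: "{p1, p2} \<in> tri_edges T" "{p2, p3} \<in> tri_edges T" "{p3, p4} \<in> tri_edges T" "{p4, p5} \<in> tri_edges T"
     "{p5, p1} \<in> tri_edges T"
    using face_edge[OF su f(1), of p1 p2] face_edge[OF su f(2), of p2 p3]
      face_edge[OF su f(3), of p3 p4] face_edge[OF su f(4), of p4 p5] face_edge[OF su f(5), of p5 p1] d by auto
  then have e': "{p2, p1} \<in> tri_edges T" "{p3, p2} \<in> tri_edges T" "{p4, p3} \<in> tri_edges T" "{p5, p4} \<in> tri_edges T"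
     "{p1, p5} \<in> tri_edges T"
    by (simp_all add: insert_commute)
  note cc = pr[OF e(1)] pr[OF e(2)] pr[OF e(3)] pr[OF e(4)] pr[OF e(5)]
  have face_v: "{v, p, q} \<in> {{v, p1, p2}, {v, p2, p3}, {v, p3, p4}, {v, p4, p5}, {v, p5, p1}}"
    if "{p, q} \<in> tri_edges T" "p \<in> {p1, p2, p3, p4, p5}" "q \<in> {p1, p2, p3, p4, p5}" for p q
  proof -
    have "{v, p, q} \<in> T"
      using flagD[OF fl vN(1)[OF that(2)] that(1) vN(2)[OF that(3)]] tri_edge_neq[OF that(1)] that(2,3) d by auto
    then have "{v, p, q} \<in> {f \<in> T. v \<in> f}" by simp
    then show ?thesis unfolding L .
  qed
  have chord: "{p1, p3} \<notin> tri_edges T" "{p1, p4} \<notin> tri_edges T" "{p2, p4} \<notin> tri_edges T" "{p2, p5} \<notin> tri_edges T"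
     "{p3, p5} \<notin> tri_edges T"
    using face_v[of p1 p3] face_v[of p1 p4] face_v[of p2 p4] face_v[of p2 p5] face_v[of p3 p5] d
    by (auto simp: insert2_eq_iff)
  have chord': "{p4, p1} \<notin> tri_edges T" using chord(2) by (simp add: insert_commute)
  show ?thesis
  proof (cases "\<exists>w. {p1, w} \<in> tri_edges T \<and> {p3, w} \<in> tri_edges T \<and> w \<noteq> v \<and> w \<notin> {p2}")
    case False
    show ?thesis
      by (rule reduce_pair[OF N, of p1 p3 p2 "{p2}" "{p1, p2, p5}"])
        (use False c cc d e e' in \<open>auto simp: inj_on_def\<close>)
  next
    case True
    then obtain w where w: "{p1, w} \<in> tri_edges T" "{p3, w} \<in> tri_edges T" "w \<noteq> v" "w \<noteq> p2" by blast
    show ?thesis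
    proof (cases "\<exists>w'. {p2, w'} \<in> tri_edges T \<and> {p4, w'} \<in> tri_edges T \<and> w' \<noteq> v \<and> w' \<notin> {p3}")
      case False
      show ?thesis
        by (rule reduce_pair[OF N, of p2 p4 p3 "{p3}" "{p2, p3, p5}"])
          (use False c cc d e e' in \<open>auto simp: inj_on_def\<close>)
    next
      case True
      then obtain w' where w': "{p2, w'} \<in> tri_edges T" "{p4, w'} \<in> tri_edges T" "w' \<noteq> v" "w' \<noteq> p3" by blast
      have "w' \<noteq> p1" using w' chord' by auto
      have wp: "w \<noteq> p1" "w \<noteq> p3" "w \<noteq> p4"
        using tri_edge_neq[OF w(1)] tri_edge_neq[OF w(2)] w chord by auto
      have f': "{v, p3, p2} \<in> T" "{v, p3, p4} \<in> T" using f by (simp_all add: insert_commute)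
      have vp1: "{v, p1} \<in> tri_edges T" using vN by simp
      have ww: "{w, p3} \<in> tri_edges T" "{w, p1} \<in> tri_edges T" using w(1,2) by (simp_all add: insert_commute)
      have d4: "distinct [v, p1, w, p3]" using d w wp by auto
      have "p2 \<noteq> p4" "p2 \<notin> {v, p1, w, p3}" "p4 \<notin> {v, p1, w, p3}" using d w wp by auto
      note p2C = this(2)
      from \<open>p2 \<noteq> p4\<close> p2C \<open>p4 \<notin> {v, p1, w, p3}\<close>
      have "p2 \<noteq> p4" "p2 \<notin> {v, p1, w, p3}" "p4 \<notin> {v, p1, w, p3}" by simp_all
      from square_common[OF sp f' this(1) vp1 w(1) ww(1) d4 this(2,3)]
      obtain A where A: "A \<subseteq> T" "bd T A = {{v, p1}, {p1, w}, {w, p3}, {p3, v}}" "A \<noteq> {}" "A \<noteq> T"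
        "{v, p3, p2} \<in> A" "{v, p3, p4} \<in> T - A" "\<Union>A \<inter> \<Union>(T - A) = {v, p1, w, p3}"
        and cm: "\<And>u. {p2, u} \<in> tri_edges T \<Longrightarrow> {p4, u} \<in> tri_edges T \<Longrightarrow> u \<in> {v, p1, w, p3}"
        by metis
      have "w' = w" using cm[OF w'(1,2)] w' \<open>w' \<noteq> p1\<close> by auto
      then have wp2: "{p2, w} \<in> tri_edges T" "{w, p2} \<in> tri_edges T" using w' by (simp_all add: insert_commute)
      have g: "{w, p1, p2} \<in> T" "{w, p2, p3} \<in> T"
        using flagD[OF fl ww(2) e(1) wp2(1)] flagD[OF fl wp2(2) e(2) w(2)] d w wp by auto
      have inA: "h \<in> A" if "h' \<in> A" "h \<in> T" "{p2, q} \<subseteq> h" "{p2, q} \<subseteq> h'" "p2 \<noteq> q" for h h' q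
      proof (rule ccontr)
        assume "h \<notin> A"
        then have "{p2, q} \<in> bd T A" using that by (intro bdI[of _ h' A h]) auto
        then have "{p2, q} = {v, p1} \<or> {p2, q} = {p1, w} \<or> {p2, q} = {w, p3} \<or> {p2, q} = {p3, v}"
          unfolding A(2) by simp
        then have "p2 \<in> {v, p1, w, p3}" by (elim disjE) (simp_all add: doubleton_eq_iff, blast+)
        then show False using p2C by contradiction
      qed
      have f23: "{v, p2, p3} \<in> A" using A(5) by (simp add: insert_commute)
      have mem: "{v, p1, p2} \<in> A" by (rule inA[OF f23 f(1), of v]) (use d in auto)
      have mem2: "{w, p1, p2} \<in> A" by (rule inA[OF mem g(1), of p1]) (use d in auto)
      have mem3: "{w, p2, p3} \<in> A" by (rule inA[OF f23 g(2), of p3]) (use d in auto)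
      define M where "M = {{v, p1, p2}, {v, p2, p3}, {w, p1, p2}, {w, p2, p3}}"
      have MA: "M \<subseteq> A" unfolding M_def using mem f23 mem2 mem3 by simp
      have no_third: "h \<in> M" if h: "h \<in> A" "m \<in> M" "e \<subseteq> h" "e \<subseteq> m" "card e = 2" for h m e
      proof (cases "e \<in> bd T A")
        case True
        then obtain h1 h2 where hh: "h1 \<in> A" "e \<subseteq> h1" "h2 \<in> T" "h2 \<notin> A" "e \<subseteq> h2" by (rule bdE)
        have "h = m"
        proof (rule ccontr)
          assume "h \<noteq> m"
          then have "h2 = h \<or> h2 = m"
            using third_face_eq[OF S(1) surface_le2[OF su h(5)], of h m h2] h hh A(1) MA by blast
          then show False using hh h MA by auto
        qed
        then show ?thesis using h by simp
      next
        case False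
        have "\<exists>m1\<in>M. \<exists>m2\<in>M. m1 \<noteq> m2 \<and> e \<subseteq> m1 \<and> e \<subseteq> m2"
        proof -
          have two: "{v, p2} \<subseteq> {v, p1, p2} \<and> {v, p2} \<subseteq> {v, p2, p3} \<and> {v, p1, p2} \<noteq> {v, p2, p3}"
            "{w, p2} \<subseteq> {w, p1, p2} \<and> {w, p2} \<subseteq> {w, p2, p3} \<and> {w, p1, p2} \<noteq> {w, p2, p3}"
            "{p1, p2} \<subseteq> {v, p1, p2} \<and> {p1, p2} \<subseteq> {w, p1, p2} \<and> {v, p1, p2} \<noteq> {w, p1, p2}"
            "{p2, p3} \<subseteq> {v, p2, p3} \<and> {p2, p3} \<subseteq> {w, p2, p3} \<and> {v, p2, p3} \<noteq> {w, p2, p3}"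
          proof -
            have "{v, p1, p2} \<noteq> {v, p2, p3}" "{w, p1, p2} \<noteq> {w, p2, p3}"
              using d w wp by (simp_all add: insert2_eq_iff)
            moreover have "v \<notin> {w, p1, p2}" "v \<notin> {w, p2, p3}" using d w by auto
            then have "{v, p1, p2} \<noteq> {w, p1, p2}" "{v, p2, p3} \<noteq> {w, p2, p3}" by (metis insertI1)+
            ultimately show "{v, p2} \<subseteq> {v, p1, p2} \<and> {v, p2} \<subseteq> {v, p2, p3} \<and> {v, p1, p2} \<noteq> {v, p2, p3}"
              "{w, p2} \<subseteq> {w, p1, p2} \<and> {w, p2} \<subseteq> {w, p2, p3} \<and> {w, p1, p2} \<noteq> {w, p2, p3}"
              "{p1, p2} \<subseteq> {v, p1, p2} \<and> {p1, p2} \<subseteq> {w, p1, p2} \<and> {v, p1, p2} \<noteq> {w, p1, p2}"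
              "{p2, p3} \<subseteq> {v, p2, p3} \<and> {p2, p3} \<subseteq> {w, p2, p3} \<and> {v, p2, p3} \<noteq> {w, p2, p3}"
              by simp_all
          qed
          have "e \<in> {{v, p2}, {w, p2}, {p1, p2}, {p2, p3}}"
          proof -
            have "m = {v, p1, p2} \<or> m = {v, p2, p3} \<or> m = {w, p1, p2} \<or> m = {w, p2, p3}"
              using h(2) unfolding M_def by simp
            then have "e \<in> {{v, p2}, {w, p2}, {p1, p2}, {p2, p3}} \<union> bd T A"
            proof (elim disjE)
              assume "m = {v, p1, p2}"
              then have "e = {v, p1} \<or> e = {p1, p2} \<or> e = {v, p2}" using tri_sub2[OF _ h(5)] h(4) by simp
              then show ?thesis unfolding A(2) by (elim disjE) simp_all
            next
              assume "m = {v, p2, p3}"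
              then have "e = {v, p2} \<or> e = {p2, p3} \<or> e = {p3, v}"
                using tri_sub2[OF _ h(5), of v p2 p3] h(4) by (simp add: insert_commute)
              then show ?thesis unfolding A(2) by (elim disjE) simp_all
            next
              assume "m = {w, p1, p2}"
              then have "e = {p1, w} \<or> e = {p1, p2} \<or> e = {w, p2}"
                using tri_sub2[OF _ h(5), of w p1 p2] h(4) by (simp add: insert_commute)
              then show ?thesis unfolding A(2) by (elim disjE) simp_all
            next
              assume "m = {w, p2, p3}"
              then have "e = {w, p2} \<or> e = {p2, p3} \<or> e = {w, p3}" using tri_sub2[OF _ h(5)] h(4) by simp
              then show ?thesis unfolding A(2) by (elim disjE) simp_all
            qed
            then show ?thesis using False by simp
          qed
          then have e4: "e = {v, p2} \<or> e = {w, p2} \<or> e = {p1, p2} \<or> e = {p2, p3}" by simp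
          have mm: "{v, p1, p2} \<in> M" "{v, p2, p3} \<in> M" "{w, p1, p2} \<in> M" "{w, p2, p3} \<in> M"
            unfolding M_def by simp_all
          have pairI: "\<exists>m1\<in>M. \<exists>m2\<in>M. m1 \<noteq> m2 \<and> e \<subseteq> m1 \<and> e \<subseteq> m2"
            if "m1 \<in> M" "m2 \<in> M" "e \<subseteq> m1 \<and> e \<subseteq> m2 \<and> m1 \<noteq> m2" for m1 m2 using that by blast
          from e4 show ?thesis
          proof (elim disjE)
            assume "e = {v, p2}"
            then show ?thesis using pairI[OF mm(1,2)] two(1) by simp
          next
            assume "e = {w, p2}"
            then show ?thesis using pairI[OF mm(3,4)] two(2) by simp
          next
            assume "e = {p1, p2}"
            then show ?thesis using pairI[OF mm(1,3)] two(3) by simp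
          next
            assume "e = {p2, p3}"
            then show ?thesis using pairI[OF mm(2,4)] two(4) by simp
          qed
        qed
        then obtain m1 m2 where mm: "m1 \<in> M" "m2 \<in> M" "m1 \<noteq> m2" "e \<subseteq> m1" "e \<subseteq> m2" by (elim bexE conjE)
        then have "h = m1 \<or> h = m2"
          using third_face_eq[OF S(1) surface_le2[OF su h(5)], of m1 m2 h] h MA A(1) by blast
        then show ?thesis using mm by auto
      qed
      have "A - M = {}"
      proof (rule ccontr)
        assume ne: "A - M \<noteq> {}"
        have sub: "A - M \<subseteq> T" using A(1) by auto
        have "x \<notin> bd T (A - M)" for x
        proof
          assume "x \<in> bd T (A - M)"
          then obtain k l where kl: "card x = 2" "k \<in> A - M" "x \<subseteq> k" "l \<in> T" "l \<notin> A - M" "x \<subseteq> l" by (rule bdE)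
          show False
          proof (cases "l \<in> M")
            case True
            then show False using no_third[of k l x] kl by auto
          next
            case False
            then have "l \<notin> A" using kl by auto
            then have "x \<in> bd T A" using kl by (intro bdI[of x k A l]) auto
            then have "x \<in> {{v, p1}, {p1, w}, {w, p3}, {p3, v}}" unfolding A(2) .
            then have "x = {v, p1} \<or> x = {p1, w} \<or> x = {w, p3} \<or> x = {p3, v}" by simp
            then have "x \<subseteq> {v, p1, p2} \<or> x \<subseteq> {w, p1, p2} \<or> x \<subseteq> {w, p2, p3} \<or> x \<subseteq> {v, p2, p3}"
              by (elim disjE) simp_all
            then have "\<exists>m\<in>M. x \<subseteq> m" unfolding M_def by (simp only: bex_simps) blast
            then obtain m where "m \<in> M" "x \<subseteq> m" by (elim bexE)
            then show False using no_third[of k m x] kl by auto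
          qed
        qed
        then have "bd T (A - M) = {}" by blast
        then have "A - M = T" by (rule surface_eqI[OF su sub ne])
        then show False using A by auto
      qed
      then have AM: "A = M" using MA by auto
      have "p2 \<in> \<Union>A" by (rule UnionI[OF f23]) simp
      then have "p2 \<in> \<Union>(T - A) \<Longrightarrow> p2 \<in> \<Union>A \<inter> \<Union>(T - A)" by (rule IntI)
      then have "p2 \<notin> \<Union>(T - A)" unfolding A(7) using p2C by (rule contrapos_nn[rotated])
      then have "{f \<in> T. p2 \<in> f} = {f \<in> A. p2 \<in> f}" using A(1) by auto
      also have "\<dots> = {{p2, v, p1}, {p2, p1, w}, {p2, w, p3}, {p2, p3, v}}"
        unfolding AM M_def by (auto simp: insert_commute)
      finally show ?thesis using no4[of p2 v p1 w p3] d w wp by auto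
    qed
  qed
qed

theorem reducible_good: "good (\<Union>T) (tri_edges T) c"
proof (cases "\<exists>v p1 p2 p3 p4. distinct [v, p1, p2, p3, p4] \<and>
    {f \<in> T. v \<in> f} = {{v, p1, p2}, {v, p2, p3}, {v, p3, p4}, {v, p4, p1}}")
  case True
  then show ?thesis by (elim exE conjE) (rule degree4)
next
  case no4: False
  obtain v where v: "v \<in> \<Union>T" "card {f \<in> T. v \<in> f} \<le> 5" using ex_small_degree[OF sp] by blast
  from su v show ?thesis
  proof (cases rule: link_cases)
    case (three p1 p2 p3)
    have f: "{v, p1, p2} \<in> T" "{v, p2, p3} \<in> T" "{v, p3, p1} \<in> T" using three(2) by blast+
    have e: "{p1, p2} \<in> tri_edges T" "{p2, p3} \<in> tri_edges T" "{p3, p1} \<in> tri_edges T"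
      using face_edge[OF su f(1), of p1 p2] face_edge[OF su f(2), of p2 p3]
        face_edge[OF su f(3), of p3 p1] three(1) by auto
    have "{p1, p2, p3} \<in> T" using flagD[OF fl e] three(1) by auto
    moreover have "{v, p1, p3} \<in> T" using f(3) by (simp add: insert_commute)
    ultimately have "T = {{v, p1, p2}, {v, p1, p3}, {v, p2, p3}, {p1, p2, p3}}"
      using f(1,2) three(1) by (intro tetrahedron[OF su]) auto
    then have "\<Union>T = {v, p1, p2, p3}" by auto
    then have "card (\<Union>T) \<le> 4" using card_length[of "[v, p1, p2, p3]"] by simp
    then show ?thesis using n5 by simp
  next
    case (four p1 p2 p3 p4)
    then show ?thesis by (rule degree4)
  next
    case (five p1 p2 p3 p4 p5)
    have f: "{v, p1, p2} \<in> T" "{v, p2, p3} \<in> T" "{v, p3, p4} \<in> T" "{v, p4, p5} \<in> T" "{v, p5, p1} \<in> T"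
      using five(2) by blast+
    have cc: "c p1 \<noteq> c p2" "c p2 \<noteq> c p3" "c p3 \<noteq> c p4" "c p4 \<noteq> c p5" "c p5 \<noteq> c p1"
      using face_edge[OF su f(1), of p1 p2] face_edge[OF su f(2), of p2 p3] face_edge[OF su f(3), of p3 p4]
        face_edge[OF su f(4), of p4 p5] face_edge[OF su f(5), of p5 p1] five(1) pr by auto
    have no4': "{f \<in> T. u \<in> f} \<noteq> {{u, p, q}, {u, q, r}, {u, r, s}, {u, s, p}}"
      if "distinct [u, p, q, r, s]" for u p q r s
    proof
      assume "{f \<in> T. u \<in> f} = {{u, p, q}, {u, q, r}, {u, r, s}, {u, s, p}}"
      with that have "\<exists>v p1 p2 p3 p4. distinct [v, p1, p2, p3, p4] \<and>
        {f \<in> T. v \<in> f} = {{v, p1, p2}, {v, p2, p3}, {v, p3, p4}, {v, p4, p1}}" by (intro exI conjI)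
      then show False using no4 by contradiction
    qed
    let ?R = "\<lambda>q1 q2 q3 q4 q5. distinct [v, q1, q2, q3, q4, q5] \<and>
      {f \<in> T. v \<in> f} = {{v, q1, q2}, {v, q2, q3}, {v, q3, q4}, {v, q4, q5}, {v, q5, q1}}"
    have R: "?R p1 p2 p3 p4 p5" "?R p2 p3 p4 p5 p1" "?R p3 p4 p5 p1 p2" "?R p4 p5 p1 p2 p3" "?R p5 p1 p2 p3 p4"
      using five by auto
    have two: "good (\<Union>T) (tri_edges T) c" if "?R q1 q2 q3 q4 q5" "c q1 = c q3" "c q2 = c q4" for q1 q2 q3 q4 q5
      by (rule degree5_two[OF conjunct1[OF that(1)] conjunct2[OF that(1)] that(2,3) no4'])
    have one: "good (\<Union>T) (tri_edges T) c"
      if "?R q1 q2 q3 q4 q5" "c q2 \<noteq> c q4" "c q3 \<noteq> c q5" "c q4 \<noteq> c q1" "c q5 \<noteq> c q2" for q1 q2 q3 q4 q5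
      by (rule degree5_one[OF conjunct1[OF that(1)] conjunct2[OF that(1)] that(2-5)])
    show ?thesis
    proof (cases "c p1 = c p3")
      case 13: True
      show ?thesis
      proof (cases "c p2 = c p4 \<or> c p5 = c p2")
        case True
        then show ?thesis using two[OF R(1)] two[OF R(5)] 13 by auto
      next
        case False
        then show ?thesis using one[OF R(1)] 13 cc by auto
      qed
    next
      case n13: False
      show ?thesis
      proof (cases "c p2 = c p4")
        case 24: True
        show ?thesis
        proof (cases "c p3 = c p5")
          case True
          then show ?thesis using two[OF R(2)] 24 by auto
        next
          case False
          then show ?thesis using one[OF R(2)] n13 24 cc by auto
        qed
      next
        case n24: False
        show ?thesis
        proof (cases "c p3 = c p5")
          case 35: True
          show ?thesis
          proof (cases "c p4 = c p1")
            case True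
            then show ?thesis using two[OF R(3)] 35 by auto
          next
            case False
            then show ?thesis using one[OF R(3)] n13 n24 35 cc by auto
          qed
        next
          case n35: False
          show ?thesis
          proof (cases "c p4 = c p1")
            case 41: True
            show ?thesis
            proof (cases "c p5 = c p2")
              case True
              then show ?thesis using two[OF R(4)] 41 by auto
            next
              case False
              then show ?thesis using one[OF R(4)] n13 n24 n35 cc by auto
            qed
          next
            case False
            then show ?thesis using one[OF R(5)] n13 n24 n35 cc by auto
          qed
        qed
      qed
    qed
  qed
qed

end

section \<open>Coloured minors of spheres\<close>

lemma conn_fibre:
  assumes "conn {e \<in> E. card (\<pi> ` e) = 1} x y"
  shows "\<pi> x = \<pi> y"
  using assms
proof (induction rule: conn_induct)
  case (step y z)
  then have "card {\<pi> y, \<pi> z} = 1" by simp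
  then have "\<pi> y = \<pi> z" by (cases "\<pi> y = \<pi> z") simp_all
  then show ?case using step by simp
qed simp

lemma admissibleD:
  assumes "admissible T \<pi> c"
  shows "x \<in> \<Union>T \<Longrightarrow> y \<in> \<Union>T \<Longrightarrow> \<pi> x = \<pi> y \<Longrightarrow> conn {e \<in> tri_edges T. card (\<pi> ` e) = 1} x y"
    and "{x, y} \<in> tri_edges T \<Longrightarrow> \<pi> x \<noteq> \<pi> y \<Longrightarrow> c (\<pi> x) \<noteq> c (\<pi> y)"
proof -
  note a = assms[unfolded admissible_def]
  show "x \<in> \<Union>T \<Longrightarrow> y \<in> \<Union>T \<Longrightarrow> \<pi> x = \<pi> y \<Longrightarrow> conn {e \<in> tri_edges T. card (\<pi> ` e) = 1} x y"
    by (rule conjunct1[OF a, rule_format])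
  show "{x, y} \<in> tri_edges T \<Longrightarrow> \<pi> x \<noteq> \<pi> y \<Longrightarrow> c (\<pi> x) \<noteq> c (\<pi> y)"
    by (rule conjunct2[OF a, rule_format])
qed

lemma split_conn:
  assumes E: "tri_edges T \<subseteq> tri_edges T1 \<union> tri_edges T2" and t: "t \<in> T1" and V: "\<Union>T1 \<inter> \<Union>T2 = t"
    and x: "x \<in> \<Union>T1" and co: "conn {e \<in> tri_edges T. card (\<pi> ` e) = 1} x z"
  shows "if z \<in> \<Union>T1 then conn {e \<in> tri_edges T1. card (\<pi> ` e) = 1} x z
     else \<exists>s\<in>t. conn {e \<in> tri_edges T1. card (\<pi> ` e) = 1} x s"
proof -
  let ?M = "{e \<in> tri_edges T. card (\<pi> ` e) = 1}" and ?M1 = "{e \<in> tri_edges T1. card (\<pi> ` e) = 1}"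
  have tM: "conn ?M1 p q" if "p \<in> t" "q \<in> t" "\<pi> p = \<pi> q" for p q
  proof (cases "p = q")
    case False
    then have "{p, q} \<in> tri_edges T1" using that t by (intro tri_edgesI[of _ t]) auto
    then show ?thesis using that(3) by (intro conn_edge) simp
  qed simp
  have inE1: "p \<in> t" if "{p, q} \<in> tri_edges T" "p \<in> \<Union>T1" "q \<notin> \<Union>T1" for p q
  proof -
    have "{p, q} \<notin> tri_edges T1" using tri_edge_sub[of "{p, q}" T1] that(3) by auto
    then have "{p, q} \<in> tri_edges T2" using E that(1) by auto
    then have "p \<in> \<Union>T2" using tri_edge_sub[of "{p, q}" T2] by auto
    then show ?thesis using V that(2) by auto
  qed
  show ?thesis
    using co
  proof (induction rule: conn_induct)
    case refl
    then show ?case using x by simp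
  next
    case (step y z)
    have yz: "{y, z} \<in> tri_edges T" "{y, z} \<in> ?M" using step.hyps(2) by simp_all
    have p: "\<pi> x = \<pi> y" "\<pi> y = \<pi> z" using conn_fibre[OF step.hyps(1)] conn_fibre[OF conn_edge[OF yz(2)]] by simp_all
    show ?case
    proof (cases "y \<in> \<Union>T1")
      case y: True
      then have xy: "conn ?M1 x y" using step.IH by simp
      show ?thesis
      proof (cases "z \<in> \<Union>T1")
        case z: True
        have "conn ?M1 y z"
        proof (cases "{y, z} \<in> tri_edges T1")
          case True
          then show ?thesis using yz(2) by (intro conn_edge) simp
        next
          case False
          then have "{y, z} \<in> tri_edges T2" using E yz by auto
          then have "y \<in> \<Union>T2" "z \<in> \<Union>T2" using tri_edge_sub[of "{y, z}" T2] by auto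
          then have "y \<in> t" "z \<in> t" using y z V by auto
          then show ?thesis using tM p by simp
        qed
        then show ?thesis using z conn_trans[OF xy] by simp
      next
        case False
        then have "y \<in> t" using inE1[OF yz(1) y] by simp
        then show ?thesis using False xy by auto
      qed
    next
      case y: False
      then obtain s where s: "s \<in> t" "conn ?M1 x s" using step.IH by auto
      show ?thesis
      proof (cases "z \<in> \<Union>T1")
        case True
        have "{z, y} \<in> tri_edges T" using yz by (simp add: insert_commute)
        then have "z \<in> t" using inE1[OF _ True y] by simp
        moreover have "\<pi> s = \<pi> z" using conn_fibre[OF s(2)] p by simp
        ultimately show ?thesis using True conn_trans[OF s(2) tM[OF s(1)]] by simp
      next
        case False
        then show ?thesis using s by auto
      qed
    qed
  qed
qed

lemma admissible_split:
  assumes ad: "admissible T \<pi> c" and E: "tri_edges T = tri_edges T1 \<union> tri_edges T2"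
    and t: "t \<in> T1" and V: "\<Union>T1 \<inter> \<Union>T2 = t" and sub: "\<Union>T1 \<subseteq> \<Union>T"
  shows "admissible T1 \<pi> c"
  unfolding admissible_def
proof (intro conjI ballI allI impI)
  fix x y assume xy: "x \<in> \<Union>T1" "y \<in> \<Union>T1" "\<pi> x = \<pi> y"
  then have "x \<in> \<Union>T" "y \<in> \<Union>T" using sub by auto
  then have "conn {e \<in> tri_edges T. card (\<pi> ` e) = 1} x y" using xy(3) by (rule admissibleD(1)[OF ad])
  from split_conn[OF _ t V xy(1) this] show "conn {e \<in> tri_edges T1. card (\<pi> ` e) = 1} x y"
    using E xy(2) by simp
next
  fix x y assume "{x, y} \<in> tri_edges T1" "\<pi> x \<noteq> \<pi> y"
  then show "c (\<pi> x) \<noteq> c (\<pi> y)" using admissibleD(2)[OF ad] E by simp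
qed

lemma good_split:
  assumes ad: "admissible T \<pi> c" and sp: "surface T" "surface T1" "surface T2" and E: "tri_edges T = tri_edges T1 \<union> tri_edges T2"
    and VT: "\<Union>T = \<Union>T1 \<union> \<Union>T2"
    and t: "t \<in> T1" "t \<in> T2" and V: "\<Union>T1 \<inter> \<Union>T2 = t"
    and g: "good (\<pi> ` \<Union>T1) (quot_edges T1 \<pi>) c" "good (\<pi> ` \<Union>T2) (quot_edges T2 \<pi>) c"
  shows "good (\<pi> ` \<Union>T) (quot_edges T \<pi>) c"
proof -
  have sub: "e \<subseteq> \<pi> ` \<Union>X \<and> card e = 2" if e: "e \<in> quot_edges X \<pi>" for X e
  proof -
    obtain d where "d \<in> tri_edges X" "card (\<pi> ` d) = 2" "e = \<pi> ` d" using e unfolding quot_edges_def by blast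
    then show ?thesis using tri_edge_sub[of d X] by auto
  qed
  note pr = admissibleD(2)[OF ad]
  have W: "\<pi> ` \<Union>T1 \<inter> \<pi> ` \<Union>T2 = \<pi> ` t"
  proof (intro equalityI subsetI)
    fix w assume "w \<in> \<pi> ` \<Union>T1 \<inter> \<pi> ` \<Union>T2"
    then obtain x y where xy: "x \<in> \<Union>T1" "y \<in> \<Union>T2" "w = \<pi> x" "w = \<pi> y" by blast
    show "w \<in> \<pi> ` t"
    proof (cases "y \<in> \<Union>T1")
      case True
      then have "y \<in> t" using V xy by auto
      then show ?thesis unfolding xy(4) by (rule imageI)
    next
      case False
      have "\<pi> x = \<pi> y" "x \<in> \<Union>T" "y \<in> \<Union>T" using xy VT by auto
      then have "conn {e \<in> tri_edges T. card (\<pi> ` e) = 1} x y" by (intro admissibleD(1)[OF ad])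
      from split_conn[OF _ t(1) V xy(1) this] False E
      obtain s where s: "s \<in> t" "conn {e \<in> tri_edges T1. card (\<pi> ` e) = 1} x s" by auto
      have "w = \<pi> s" using conn_fibre[OF s(2)] xy(3) by simp
      then show ?thesis using s(1) by simp
    qed
  next
    fix w assume "w \<in> \<pi> ` t"
    then show "w \<in> \<pi> ` \<Union>T1 \<inter> \<pi> ` \<Union>T2" using t by auto
  qed
  have te: "{x, y} \<in> tri_edges X" if "x \<in> t" "y \<in> t" "x \<noteq> y" "t \<in> X" for x y X
    using that by (intro tri_edgesI[of _ t]) auto
  have "good (\<pi> ` \<Union>T1 \<union> \<pi> ` \<Union>T2) (quot_edges T1 \<pi> \<union> quot_edges T2 \<pi>) c"
  proof (rule good_clique_sum[OF _ _ sub sub g])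
    show "finite (\<pi> ` \<Union>T1)" "finite (\<pi> ` \<Union>T2)" using surfaceD(6)[OF sp(2)] surfaceD(6)[OF sp(3)] by simp_all
    show "inj_on c (\<pi> ` \<Union>T1 \<inter> \<pi> ` \<Union>T2)"
      unfolding W
    proof (rule inj_onI, rule ccontr)
      fix p q assume pq: "p \<in> \<pi> ` t" "q \<in> \<pi> ` t" "c p = c q" "p \<noteq> q"
      then obtain x y where xy: "x \<in> t" "y \<in> t" "p = \<pi> x" "q = \<pi> y" by blast
      then have "x \<noteq> y" using pq by auto
      then have "{x, y} \<in> tri_edges T" using te[OF xy(1,2) _ t(1)] E by simp
      then show False using pr[of x y] pq(3,4) xy(3,4) by simp
    qed
    show "e \<in> quot_edges T1 \<pi> \<inter> quot_edges T2 \<pi>" if e: "e \<subseteq> \<pi> ` \<Union>T1 \<inter> \<pi> ` \<Union>T2" "card e = 2" for e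
    proof -
      have "\<exists>p q. e = {p, q} \<and> p \<noteq> q" using e(2) by (auto simp: card_2_iff)
      then obtain p q where pq: "e = {p, q}" "p \<noteq> q" by (elim exE conjE)
      then have "p \<in> \<pi> ` t" "q \<in> \<pi> ` t" using e(1) unfolding W by auto
      then obtain x y where xy: "x \<in> t" "y \<in> t" "p = \<pi> x" "q = \<pi> y" by blast
      then have "x \<noteq> y" using pq by auto
      then have "{x, y} \<in> tri_edges T1" "{x, y} \<in> tri_edges T2" using te xy t by simp_all
      moreover have "e = \<pi> ` {x, y}" using pq xy by simp
      ultimately show ?thesis using e(2) unfolding quot_edges_def by blast
    qed
  qed
  moreover have "quot_edges T \<pi> = quot_edges T1 \<pi> \<union> quot_edges T2 \<pi>"
    unfolding quot_edges_def E by blast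
  ultimately show ?thesis unfolding VT by (simp add: image_Un)
qed

lemma good_contract:
  fixes x s :: 'b and \<pi> :: "'b \<Rightarrow> 'b" and c :: "'b \<Rightarrow> 'c"
  assumes sp: "sphere T" and fl: "flag T" and n5: "5 \<le> card (\<Union>T)" and xs: "{x, s} \<in> tri_edges T"
    and ad: "admissible T \<pi> c" and eq: "\<pi> x = \<pi> s"
    and IH: "\<And>T'. sphere T' \<Longrightarrow> card (\<Union>T') < card (\<Union>T) \<Longrightarrow> admissible T' \<pi> c \<Longrightarrow>
       good (\<pi> ` \<Union>T') (quot_edges T' \<pi>) c"
  shows "good (\<pi> ` \<Union>T) (quot_edges T \<pi>) c"
proof -
  let ?k = "\<lambda>u. if u = s then x else u"
  let ?T' = "{?k ` f | f. f \<in> T \<and> card (?k ` f) = 3}"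
  note cs = contract_sphere[OF sp fl n5 xs]
  have su: "surface T" using sp unfolding sphere_def by simp
  have xV: "x \<in> \<Union>T" "s \<in> \<Union>T" using tri_edge_sub[OF xs] by auto
  have nxs: "x \<noteq> s" using tri_edge_neq[OF xs] .
  have pk: "\<pi> (?k u) = \<pi> u" for u using eq by simp
  have pkI: "\<pi> ` ?k ` e = \<pi> ` e" for e by (simp only: image_image pk)
  have E'D: "\<exists>a' b'. {a', b'} \<in> tri_edges T \<and> a = ?k a' \<and> b = ?k b'" if ab: "{a, b} \<in> tri_edges ?T'" for a b
  proof -
    obtain e where e: "e \<in> tri_edges T" "{a, b} = ?k ` e" using ab unfolding cs(3) by blast
    have "a \<in> ?k ` e" using e(2) by auto
    then obtain x' where x': "x' \<in> e" "a = ?k x'" by blast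
    have "b \<in> ?k ` e" using e(2) by auto
    then obtain y' where y': "y' \<in> e" "b = ?k y'" by blast
    have "a \<noteq> b" using tri_edge_neq[OF ab] .
    then have "x' \<noteq> y'" using x' y' by auto
    moreover have "card e = 2" using tri_edge_sub[OF e(1)] by simp
    ultimately have "e = {x', y'}" using x' y' by (auto simp: card_2_iff)
    then show ?thesis using e(1) x'(2) y'(2) by blast
  qed
  let ?M = "{e \<in> tri_edges T. card (\<pi> ` e) = 1}" and ?M' = "{e \<in> tri_edges ?T'. card (\<pi> ` e) = 1}"
  have "admissible ?T' \<pi> c"
    unfolding admissible_def
  proof (intro conjI ballI allI impI)
    fix a b assume ab: "a \<in> \<Union>?T'" "b \<in> \<Union>?T'" "\<pi> a = \<pi> b"
    then have V: "a \<in> \<Union>T" "b \<in> \<Union>T" "a \<noteq> s" "b \<noteq> s" unfolding cs(2) by simp_all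
    have "conn ?M a b" by (rule admissibleD(1)[OF ad V(1,2) ab(3)])
    then have "conn ?M' (?k a) (?k b)"
    proof (rule conn_hom)
      fix p q assume pq: "{p, q} \<in> ?M"
      show "conn ?M' (?k p) (?k q)"
      proof (cases "?k p = ?k q")
        case True
        then show ?thesis by (simp only: conn_refl)
      next
        case False
        have im: "?k ` {p, q} = {?k p, ?k q}" by (simp only: image_insert image_empty)
        then have "card (?k ` {p, q}) = 2" using False by (simp only: card_2_iff) blast
        then have "?k ` {p, q} \<in> tri_edges ?T'" unfolding cs(3) using pq by blast
        moreover have "card (\<pi> ` ?k ` {p, q}) = 1" unfolding pkI using pq by simp
        ultimately have "{?k p, ?k q} \<in> ?M'" unfolding im by simp
        then show ?thesis by (rule conn_edge)
      qed
    qed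
    then show "conn ?M' a b" using V by simp
  next
    fix a b assume ab: "{a, b} \<in> tri_edges ?T'" "\<pi> a \<noteq> \<pi> b"
    obtain a' b' where e: "{a', b'} \<in> tri_edges T" "a = ?k a'" "b = ?k b'" using E'D[OF ab(1)] by blast
    have "\<pi> a = \<pi> a'" "\<pi> b = \<pi> b'" unfolding e(2,3) by (rule pk)+
    then show "c (\<pi> a) \<noteq> c (\<pi> b)" using admissibleD(2)[OF ad e(1)] ab(2) by simp
  qed
  moreover have "card (\<Union>?T') < card (\<Union>T)"
    unfolding cs(2) using xV surfaceD(6)[OF su] by (intro psubset_card_mono) auto
  ultimately have "good (\<pi> ` \<Union>?T') (quot_edges ?T' \<pi>) c" by (intro IH[OF cs(1)])
  moreover have "\<pi> ` \<Union>?T' = \<pi> ` \<Union>T"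
  proof (intro equalityI subsetI)
    fix w assume "w \<in> \<pi> ` \<Union>T"
    then obtain u where u: "u \<in> \<Union>T" "w = \<pi> u" by blast
    then have "w = \<pi> (?k u)" "?k u \<in> \<Union>T - {s}" using pk xV nxs by auto
    then show "w \<in> \<pi> ` \<Union>?T'" unfolding cs(2) by blast
  next
    fix w assume "w \<in> \<pi> ` \<Union>?T'"
    then show "w \<in> \<pi> ` \<Union>T" unfolding cs(2) by auto
  qed
  moreover have "quot_edges ?T' \<pi> = quot_edges T \<pi>"
  proof (intro equalityI subsetI)
    fix w assume "w \<in> quot_edges ?T' \<pi>"
    then obtain e' where e': "e' \<in> tri_edges ?T'" "card (\<pi> ` e') = 2" "w = \<pi> ` e'" unfolding quot_edges_def by blast
    then obtain e where "e \<in> tri_edges T" "e' = ?k ` e" unfolding cs(3) by blast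
    then show "w \<in> quot_edges T \<pi>" using e'(2,3) pkI[of e] unfolding quot_edges_def by auto
  next
    fix w assume "w \<in> quot_edges T \<pi>"
    then obtain e where e: "e \<in> tri_edges T" "card (\<pi> ` e) = 2" "w = \<pi> ` e" unfolding quot_edges_def by blast
    have "card e = 2" using tri_edge_sub[OF e(1)] by simp
    then have "finite e" by (auto intro: card_ge_0_finite)
    then have "card (\<pi> ` ?k ` e) \<le> card (?k ` e)" "card (?k ` e) \<le> card e"
      by (rule card_image_le[OF finite_imageI], rule card_image_le)
    then have "card (?k ` e) = 2" unfolding pkI using e(2) \<open>card e = 2\<close> by linarith
    then have "?k ` e \<in> tri_edges ?T'" unfolding cs(3) using e(1) by blast
    moreover have "card (\<pi> ` ?k ` e) = 2" "w = \<pi> ` ?k ` e" unfolding pkI using e by simp_all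
    ultimately show "w \<in> quot_edges ?T' \<pi>" unfolding quot_edges_def by blast
  qed
  ultimately show ?thesis by metis
qed

theorem sphere_good:
  fixes \<pi> :: "'b \<Rightarrow> 'b" and c :: "'b \<Rightarrow> 'c"
  assumes "sphere T" "admissible T \<pi> c"
  shows "good (\<pi> ` \<Union>T) (quot_edges T \<pi>) c"
  using assms
proof (induction "card (\<Union>T)" arbitrary: T \<pi> c rule: less_induct)
  case less
  have IH: "good (\<pi>' ` \<Union>T') (quot_edges T' \<pi>') c'"
    if "sphere T'" "card (\<Union>T') < card (\<Union>T)" "admissible T' \<pi>' c'" for T' \<pi>' and c' :: "'b \<Rightarrow> 'c"
    using less.hyps that by blast
  have su: "surface T" and eul: "card T + 4 = 2 * card (\<Union>T)" using less.prems unfolding sphere_def by auto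
  note S = surfaceD[OF su]
  show ?case
  proof (cases "flag T")
    case False
    then obtain p q r where d: "p \<noteq> q" "q \<noteq> r" "r \<noteq> p"
      and e: "{p, q} \<in> tri_edges T" "{q, r} \<in> tri_edges T" "{r, p} \<in> tri_edges T" and nf: "{p, q, r} \<notin> T"
      unfolding flag_def by blast
    obtain T1 T2 where T: "sphere T1" "sphere T2" "T1 \<union> T2 = insert {p, q, r} T" "{p, q, r} \<in> T1 \<inter> T2"
      "\<Union>T1 \<inter> \<Union>T2 = {p, q, r}" "card (\<Union>T1) < card (\<Union>T)" "card (\<Union>T2) < card (\<Union>T)"
      using split_sphere[OF less.prems(1) e d nf] by blast
    define t where "t = {p, q, r}"
    have tE: "x \<in> tri_edges T" if "x \<subseteq> t" "card x = 2" for x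
      using tri_sub2[OF that[unfolded t_def]] e by (auto simp: insert_commute)
    have t12: "t \<in> T1" "t \<in> T2" "\<Union>T1 \<inter> \<Union>T2 = t" "\<Union>T2 \<inter> \<Union>T1 = t" using T(4,5) by (auto simp: t_def)
    have E: "tri_edges T = tri_edges T1 \<union> tri_edges T2"
    proof -
      have "tri_edges T1 \<union> tri_edges T2 = tri_edges (insert t T)"
        unfolding t_def T(3)[symmetric] tri_edges_def by blast
      also have "\<dots> = tri_edges T" unfolding tri_edges_insert using tE by auto
      finally show ?thesis by simp
    qed
    have tT: "t \<subseteq> \<Union>T" using tri_edge_sub[OF e(1)] tri_edge_sub[OF e(2)] unfolding t_def by auto
    have "\<Union>(T1 \<union> T2) = \<Union>(insert t T)" using T(3) by (simp add: t_def)
    then have V: "\<Union>T = \<Union>T1 \<union> \<Union>T2" using tT by auto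
    have "admissible T1 \<pi> c" by (rule admissible_split[OF less.prems(2) E t12(1,3)]) (use V in auto)
    moreover have "tri_edges T = tri_edges T2 \<union> tri_edges T1" using E by blast
    then have "admissible T2 \<pi> c" by (rule admissible_split[OF less.prems(2) _ t12(2,4)]) (use V in auto)
    ultimately have "good (\<pi> ` \<Union>T1) (quot_edges T1 \<pi>) c" "good (\<pi> ` \<Union>T2) (quot_edges T2 \<pi>) c"
      using IH T by blast+
    moreover have "surface T1" "surface T2" using T unfolding sphere_def by auto
    ultimately show ?thesis by (intro good_split[OF less.prems(2) su _ _ E V t12(1,2,3)])
  next
    case fl: True
    show ?thesis
    proof (cases "5 \<le> card (\<Union>T)")
      case False
      then have c4: "card (\<Union>T) = 4" using sphere_card_ge4[OF su] by simp
      then have "card (tri_edges T) = 6" using card_tri_edges[OF su] eul by simp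
      moreover have "card {e. e \<subseteq> \<Union>T \<and> card e = 2} = 6"
        using n_subsets[OF S(6), of 2] c4 by (simp add: choose_two)
      moreover have "tri_edges T \<subseteq> {e. e \<subseteq> \<Union>T \<and> card e = 2}" using tri_edge_sub by blast
      moreover have "finite {e. e \<subseteq> \<Union>T \<and> card e = 2}" using S(6) by simp
      ultimately have E: "tri_edges T = {e. e \<subseteq> \<Union>T \<and> card e = 2}" using card_subset_eq by metis
      have inj: "inj_on c (\<pi> ` \<Union>T)"
      proof (rule inj_onI, rule ccontr)
        fix p q assume pq: "p \<in> \<pi> ` \<Union>T" "q \<in> \<pi> ` \<Union>T" "c p = c q" "p \<noteq> q"
        then obtain x y where xy: "x \<in> \<Union>T" "y \<in> \<Union>T" "p = \<pi> x" "q = \<pi> y" by blast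
        then have "x \<noteq> y" using pq by auto
        then have "{x, y} \<in> tri_edges T" unfolding E using xy by simp
        moreover have "\<pi> x \<noteq> \<pi> y" using pq(4) xy(3,4) by simp
        ultimately have "c (\<pi> x) \<noteq> c (\<pi> y)" by (rule admissibleD(2)[OF less.prems(2)])
        then show False using pq(3) xy(3,4) by simp
      qed
      have "col_acy c (quot_edges T \<pi>)"
      proof (rule col_acy_inj[OF inj])
        fix e assume "e \<in> quot_edges T \<pi>"
        then obtain d where "d \<in> tri_edges T" "card (\<pi> ` d) = 2" "e = \<pi> ` d" unfolding quot_edges_def by blast
        then show "e \<subseteq> \<pi> ` \<Union>T \<and> card e = 2" using tri_edge_sub[of d T] by auto
      qed
      then show ?thesis unfolding good_def using card_image[OF inj] by auto
    next
      case n5: True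
      show ?thesis
      proof (cases "\<exists>x s. {x, s} \<in> tri_edges T \<and> \<pi> x = \<pi> s")
        case True
        then obtain x s where "{x, s} \<in> tri_edges T" "\<pi> x = \<pi> s" by blast
        then show ?thesis using good_contract[OF less.prems(1) fl n5 _ less.prems(2)] IH by blast
      next
        case False
        have c2: "card (\<pi> ` e) = 2" if e: "e \<in> tri_edges T" for e
        proof -
          have "\<exists>p q. e = {p, q} \<and> p \<noteq> q" using tri_edge_sub[OF e] by (auto simp: card_2_iff)
          then obtain p q where "e = {p, q}" by blast
          then show ?thesis using False e by auto
        qed
        have "{e \<in> tri_edges T. card (\<pi> ` e) = 1} = {}" using c2 by auto
        then have cE: "\<forall>x\<in>\<Union>T. \<forall>y\<in>\<Union>T. \<pi> x = \<pi> y \<longrightarrow> conn {} x y"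
          using admissibleD(1)[OF less.prems(2)] by (intro ballI impI) (simp only:)
        have inj: "inj_on \<pi> (\<Union>T)"
        proof (rule inj_onI)
          fix x y assume "x \<in> \<Union>T" "y \<in> \<Union>T" "\<pi> x = \<pi> y"
          then have "conn {} x y" using cE by blast
          then show "x = y" by (rule conn_isolated) simp
        qed
        interpret reducible_sphere T "c \<circ> \<pi>"
        proof
          show "sphere T" "flag T" "5 \<le> card (\<Union>T)" using less.prems fl n5 by simp_all
          show "(c \<circ> \<pi>) x \<noteq> (c \<circ> \<pi>) y" if "{x, y} \<in> tri_edges T" for x y
            using admissibleD(2)[OF less.prems(2) that] that False by auto
        qed (rule IH)
        have "good (\<pi> ` \<Union>T) (image \<pi> ` tri_edges T) c"
          by (rule good_transport[OF reducible_good inj tri_edge_sub])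
        moreover have "quot_edges T \<pi> = image \<pi> ` tri_edges T" unfolding quot_edges_def using c2 by blast
        ultimately show ?thesis by simp
      qed
    qed
  qed
qed

section \<open>The grid sphere\<close>

definition fA :: "int \<Rightarrow> int \<Rightarrow> (int \<times> int) set" where
  "fA i j = {(i, j), (i + 1, j), (i + 1, j + 1)}"
definition fB :: "int \<Rightarrow> int \<Rightarrow> (int \<times> int) set" where
  "fB i j = {(i, j), (i, j + 1), (i + 1, j + 1)}"
definition fH :: "int \<Rightarrow> int \<Rightarrow> (int \<times> int) set" where
  "fH i j = {(-1, -1), (i, j), (i + 1, j)}"
definition fV :: "int \<Rightarrow> int \<Rightarrow> (int \<times> int) set" where
  "fV i j = {(-1, -1), (i, j), (i, j + 1)}"

text \<open>The square grid \<open>{0..n} \<times> {0..n}\<close> with one diagonal in each cell, closed up to a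
  sphere by the apex \<open>(-1, -1)\<close>.\<close>
definition grid :: "int \<Rightarrow> (int \<times> int) set set" where
  "grid n = {f. \<exists>i j. 0 \<le> i \<and> i < n \<and> 0 \<le> j \<and> j < n \<and> (f = fA i j \<or> f = fB i j)} \<union>
     {f. \<exists>i. 0 \<le> i \<and> i < n \<and> (f = fH i 0 \<or> f = fH i n \<or> f = fV 0 i \<or> f = fV n i)}"

lemma gridE:
  assumes "f \<in> grid n"
  obtains (A) i j where "0 \<le> i" "i < n" "0 \<le> j" "j < n" "f = fA i j"
  | (B) i j where "0 \<le> i" "i < n" "0 \<le> j" "j < n" "f = fB i j"
  | (H0) i where "0 \<le> i" "i < n" "f = fH i 0"
  | (Hn) i where "0 \<le> i" "i < n" "f = fH i n"
  | (V0) i where "0 \<le> i" "i < n" "f = fV 0 i"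
  | (Vn) i where "0 \<le> i" "i < n" "f = fV n i"
  using assms unfolding grid_def
  by (elim UnE CollectE exE conjE disjE) (fact A B H0 Hn V0 Vn | rule A B H0 Hn V0 Vn; assumption)+

lemma gridI:
  "0 \<le> i \<Longrightarrow> i < n \<Longrightarrow> 0 \<le> j \<Longrightarrow> j < n \<Longrightarrow> fA i j \<in> grid n"
  "0 \<le> i \<Longrightarrow> i < n \<Longrightarrow> 0 \<le> j \<Longrightarrow> j < n \<Longrightarrow> fB i j \<in> grid n"
  "0 \<le> i \<Longrightarrow> i < n \<Longrightarrow> fH i 0 \<in> grid n"
  "0 \<le> i \<Longrightarrow> i < n \<Longrightarrow> fH i n \<in> grid n"
  "0 \<le> i \<Longrightarrow> i < n \<Longrightarrow> fV 0 i \<in> grid n"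
  "0 \<le> i \<Longrightarrow> i < n \<Longrightarrow> fV n i \<in> grid n"
  unfolding grid_def by blast+

lemmas face_defs = fA_def fB_def fH_def fV_def

lemma grid_card3:
  assumes "f \<in> grid n" "1 \<le> n"
  shows "card f = 3"
  using assms by (cases rule: gridE) (simp_all add: face_defs)

lemma finite_grid: "finite (grid n)"
proof -
  have "grid n \<subseteq> (\<lambda>(i, j). fA i j) ` ({0..<n} \<times> {0..<n}) \<union> (\<lambda>(i, j). fB i j) ` ({0..<n} \<times> {0..<n})
     \<union> (\<lambda>i. fH i 0) ` {0..<n} \<union> (\<lambda>i. fH i n) ` {0..<n} \<union> (\<lambda>i. fV 0 i) ` {0..<n} \<union> (\<lambda>i. fV n i) ` {0..<n}"
    unfolding grid_def by force
  then show ?thesis by (rule finite_subset) simp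
qed

lemma card_grid_le: "card (grid n) \<le> 2 * (nat n * nat n) + 4 * nat n"
proof -
  let ?I = "{0..<n}"
  have sub: "grid n \<subseteq> (((((\<lambda>(i, j). fA i j) ` (?I \<times> ?I) \<union> (\<lambda>(i, j). fB i j) ` (?I \<times> ?I))
     \<union> (\<lambda>i. fH i 0) ` ?I) \<union> (\<lambda>i. fH i n) ` ?I) \<union> (\<lambda>i. fV 0 i) ` ?I) \<union> (\<lambda>i. fV n i) ` ?I"
    (is "_ \<subseteq> (((((?a \<union> ?b) \<union> ?c) \<union> ?d) \<union> ?e) \<union> ?f)")
    unfolding grid_def by force
  have I: "card ?I = nat n" "card (?I \<times> ?I) = nat n * nat n" by (simp_all add: card_cartesian_product)
  have c: "card ?a \<le> nat n * nat n" "card ?b \<le> nat n * nat n" "card ?c \<le> nat n" "card ?d \<le> nat n"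
    "card ?e \<le> nat n" "card ?f \<le> nat n"
    by (rule order_trans[OF card_image_le], simp, simp add: I)+
  have "card (grid n) \<le> card (((((?a \<union> ?b) \<union> ?c) \<union> ?d) \<union> ?e) \<union> ?f)"
    using sub by (rule card_mono[rotated]) simp
  also have "\<dots> \<le> card ?a + card ?b + card ?c + card ?d + card ?e + card ?f"
    by (intro order_trans[OF card_Un_le] add_mono order_refl)
  finally show ?thesis using c by linarith
qed

lemma grid_vertices: "1 \<le> n \<Longrightarrow> {0..n} \<times> {0..n} \<union> {(-1, -1)} \<subseteq> \<Union>(grid n)"
proof
  fix p :: "int \<times> int" assume n: "1 \<le> n" and p: "p \<in> {0..n} \<times> {0..n} \<union> {(-1, -1)}"
  show "p \<in> \<Union>(grid n)"
  proof (cases "p = (-1, -1)")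
    case True
    have "fH 0 0 \<in> grid n" using n by (intro gridI) auto
    then show ?thesis using True by (intro UnionI[of "fH 0 0"]) (auto simp: face_defs)
  next
    case False
    then obtain x y where xy: "p = (x, y)" "0 \<le> x" "x \<le> n" "0 \<le> y" "y \<le> n" using p by auto
    define i where "i = (if x = n then x - 1 else x)"
    define j where "j = (if y = n then y - 1 else y)"
    have ij: "0 \<le> i" "i < n" "0 \<le> j" "j < n" using xy n unfolding i_def j_def by auto
    have "p \<in> fA i j \<or> p \<in> fB i j" using xy unfolding i_def j_def face_defs by auto
    then show ?thesis using gridI(1,2)[OF ij] by blast
  qed
qed

lemma card_grid_vertices:
  assumes "1 \<le> n"
  shows "nat n * nat n + 2 * nat n + 2 \<le> card (\<Union>(grid n))"
proof -
  have fin: "finite (\<Union>(grid n))" using finite_Union_faces[OF finite_grid] grid_card3 assms by blast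
  have "card ({0..n} \<times> {0..n} \<union> {(-1, -1)} :: (int \<times> int) set) = nat (n + 1) * nat (n + 1) + 1"
    by (subst card_Un_disjoint) (auto simp: card_cartesian_product)
  moreover have "nat (n + 1) = nat n + 1" using assms by simp
  moreover have "card ({0..n} \<times> {0..n} \<union> {(-1, -1)} :: (int \<times> int) set) \<le> card (\<Union>(grid n))"
    by (rule card_mono[OF fin grid_vertices[OF assms]])
  ultimately show ?thesis by (simp add: algebra_simps)
qed

lemma two_facesI:
  assumes "f \<in> T" "g \<in> T" "f \<noteq> g" "e \<subseteq> f" "e \<subseteq> g" "\<And>h. h \<in> T \<Longrightarrow> e \<subseteq> h \<Longrightarrow> h = f \<or> h = g"
  shows "card {h \<in> T. e \<subseteq> h} = 2"
proof -
  have "{h \<in> T. e \<subseteq> h} = {f, g}" using assms by blast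
  then show ?thesis using assms(3) by simp
qed

lemma grid_H:
  assumes n: "1 \<le> n" and i: "0 \<le> i" "i < n" and j: "0 \<le> j" "j \<le> n"
  shows "card {f \<in> grid n. {(i, j), (i + 1, j)} \<subseteq> f} = 2"
proof (rule two_facesI)
  show "(if j < n then fA i j else fH i n) \<in> grid n" "(if 0 < j then fB i (j - 1) else fH i 0) \<in> grid n"
    using assms by (auto intro!: gridI)
  show "(if j < n then fA i j else fH i n) \<noteq> (if 0 < j then fB i (j - 1) else fH i 0)"
    using assms by (auto simp: face_defs insert_eq_iff doubleton_eq_iff)
  show "{(i, j), (i + 1, j)} \<subseteq> (if j < n then fA i j else fH i n)"
    "{(i, j), (i + 1, j)} \<subseteq> (if 0 < j then fB i (j - 1) else fH i 0)"
    using assms by (auto simp: face_defs)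
  fix h assume h: "h \<in> grid n" "{(i, j), (i + 1, j)} \<subseteq> h"
  show "h = (if j < n then fA i j else fH i n) \<or> h = (if 0 < j then fB i (j - 1) else fH i 0)"
    using h(1)
  proof (cases rule: gridE)
    case (A a b)
    then have "a = i \<and> b = j" using h(2) by (auto simp: face_defs)
    then show ?thesis using A by auto
  next
    case (B a b)
    then have "a = i \<and> b + 1 = j" using h(2) by (auto simp: face_defs)
    then show ?thesis using B by auto
  next
    case (H0 a)
    then have "a = i \<and> j = 0" using h(2) i j by (auto simp: face_defs)
    then show ?thesis using H0 by auto
  next
    case (Hn a)
    then have "a = i \<and> j = n" using h(2) i j by (auto simp: face_defs)
    then show ?thesis using Hn by auto
  next
    case (V0 a)
    then show ?thesis using h(2) i j by (auto simp: face_defs)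
  next
    case (Vn a)
    then show ?thesis using h(2) i j by (auto simp: face_defs)
  qed
qed

lemma grid_V:
  assumes n: "1 \<le> n" and i: "0 \<le> i" "i \<le> n" and j: "0 \<le> j" "j < n"
  shows "card {f \<in> grid n. {(i, j), (i, j + 1)} \<subseteq> f} = 2"
proof (rule two_facesI)
  show "(if i < n then fB i j else fV n j) \<in> grid n" "(if 0 < i then fA (i - 1) j else fV 0 j) \<in> grid n"
    using assms by (auto intro!: gridI)
  show "(if i < n then fB i j else fV n j) \<noteq> (if 0 < i then fA (i - 1) j else fV 0 j)"
    using assms by (auto simp: face_defs insert_eq_iff doubleton_eq_iff)
  show "{(i, j), (i, j + 1)} \<subseteq> (if i < n then fB i j else fV n j)"
    "{(i, j), (i, j + 1)} \<subseteq> (if 0 < i then fA (i - 1) j else fV 0 j)"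
    using assms by (auto simp: face_defs)
  fix h assume h: "h \<in> grid n" "{(i, j), (i, j + 1)} \<subseteq> h"
  show "h = (if i < n then fB i j else fV n j) \<or> h = (if 0 < i then fA (i - 1) j else fV 0 j)"
    using h(1)
  proof (cases rule: gridE)
    case (A a b)
    then have "a + 1 = i \<and> b = j" using h(2) by (auto simp: face_defs)
    then show ?thesis using A by auto
  next
    case (B a b)
    then have "a = i \<and> b = j" using h(2) by (auto simp: face_defs)
    then show ?thesis using B by auto
  next
    case (H0 a)
    then show ?thesis using h(2) i j by (auto simp: face_defs)
  next
    case (Hn a)
    then show ?thesis using h(2) i j by (auto simp: face_defs)
  next
    case (V0 a)
    then have "a = j \<and> i = 0" using h(2) i j by (auto simp: face_defs)
    then show ?thesis using V0 by auto
  next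
    case (Vn a)
    then have "a = j \<and> i = n" using h(2) i j by (auto simp: face_defs)
    then show ?thesis using Vn by auto
  qed
qed

lemma grid_D:
  assumes n: "1 \<le> n" and i: "0 \<le> i" "i < n" and j: "0 \<le> j" "j < n"
  shows "card {f \<in> grid n. {(i, j), (i + 1, j + 1)} \<subseteq> f} = 2"
proof (rule two_facesI)
  show "fA i j \<in> grid n" "fB i j \<in> grid n" using assms by (auto intro!: gridI)
  show "fA i j \<noteq> fB i j" by (auto simp: face_defs insert_eq_iff doubleton_eq_iff)
  show "{(i, j), (i + 1, j + 1)} \<subseteq> fA i j" "{(i, j), (i + 1, j + 1)} \<subseteq> fB i j" by (auto simp: face_defs)
  fix h assume h: "h \<in> grid n" "{(i, j), (i + 1, j + 1)} \<subseteq> h"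
  show "h = fA i j \<or> h = fB i j"
    using h(1)
  proof (cases rule: gridE)
    case (A a b)
    then have "a = i \<and> b = j" using h(2) by (auto simp: face_defs)
    then show ?thesis using A by auto
  next
    case (B a b)
    then have "a = i \<and> b = j" using h(2) by (auto simp: face_defs)
    then show ?thesis using B by auto
  qed (use h(2) i j in \<open>auto simp: face_defs\<close>)
qed

text \<open>The next two functions list the two cone faces at a boundary vertex: the one following and
  the one preceding it on the boundary cycle.\<close>
definition bnext :: "int \<Rightarrow> int \<times> int \<Rightarrow> (int \<times> int) set" where
  "bnext n = (\<lambda>(x, y). if y = 0 \<and> x < n then fH x 0 else if x = n \<and> y < n then fV n y
     else if y = n \<and> 0 < x then fH (x - 1) n else fV 0 (y - 1))"
definition bprev :: "int \<Rightarrow> int \<times> int \<Rightarrow> (int \<times> int) set" where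
  "bprev n = (\<lambda>(x, y). if y = 0 \<and> 0 < x then fH (x - 1) 0 else if x = n \<and> 0 < y then fV n (y - 1)
     else if y = n \<and> x < n then fH x n else fV 0 y)"

lemma grid_spoke:
  assumes n: "1 \<le> n" and p: "p \<noteq> (-1, -1)" and ex: "f0 \<in> grid n" "{(-1, -1), p} \<subseteq> f0"
  shows "card {f \<in> grid n. {(-1, -1), p} \<subseteq> f} = 2"
proof -
  obtain x y where xy: "p = (x, y)" by (cases p)
  have bd: "0 \<le> x \<and> x \<le> n \<and> 0 \<le> y \<and> y \<le> n \<and> (x = 0 \<or> x = n \<or> y = 0 \<or> y = n)"
    using ex(1) by (cases rule: gridE) (use ex(2) xy p n in \<open>auto simp: face_defs\<close>)
  show ?thesis
  proof (rule two_facesI)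
    show "bnext n p \<in> grid n" "bprev n p \<in> grid n"
      using bd n unfolding xy bnext_def bprev_def by (auto intro!: gridI)
    show "{(-1, -1), p} \<subseteq> bnext n p" "{(-1, -1), p} \<subseteq> bprev n p"
      using bd n unfolding xy bnext_def bprev_def by (auto simp: face_defs)
    show "bnext n p \<noteq> bprev n p"
      using bd n unfolding xy bnext_def bprev_def by (auto simp: face_defs insert_eq_iff doubleton_eq_iff)
    fix h assume h: "h \<in> grid n" "{(-1, -1), p} \<subseteq> h"
    show "h = bnext n p \<or> h = bprev n p"
      using h(1)
    proof (cases rule: gridE)
      case (H0 a)
      then have "y = 0 \<and> (x = a \<or> x = a + 1)" using h(2) xy p by (auto simp: face_defs)
      then show ?thesis using H0 unfolding xy bnext_def bprev_def by auto
    next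
      case (Hn a)
      then have "y = n \<and> (x = a \<or> x = a + 1)" using h(2) xy p by (auto simp: face_defs)
      then show ?thesis using Hn n unfolding xy bnext_def bprev_def by auto
    next
      case (V0 a)
      then have "x = 0 \<and> (y = a \<or> y = a + 1)" using h(2) xy p by (auto simp: face_defs)
      then show ?thesis using V0 n unfolding xy bnext_def bprev_def by auto
    next
      case (Vn a)
      then have "x = n \<and> (y = a \<or> y = a + 1)" using h(2) xy p by (auto simp: face_defs)
      then show ?thesis using Vn n unfolding xy bnext_def bprev_def by auto
    qed (use h(2) in \<open>auto simp: face_defs\<close>)
  qed
qed

lemma grid_edge_two:
  assumes n: "1 \<le> n" and e: "e \<in> tri_edges (grid n)"
  shows "card {f \<in> grid n. e \<subseteq> f} = 2"
proof -
  obtain f where f: "card e = 2" "f \<in> grid n" "e \<subseteq> f" using e by (rule tri_edgesE)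
  show ?thesis
  proof (cases "(-1, -1) \<in> e")
    case True
    then have "\<exists>p. e = {(-1, -1), p} \<and> p \<noteq> (-1, -1)" using f(1) by (auto simp: card_2_iff)
    then show ?thesis using grid_spoke[OF n _ f(2)] f(3) by auto
  next
    case False
    from f(2) show ?thesis
    proof (cases rule: gridE)
      case (A i j)
      then have "e = {(i, j), (i + 1, j)} \<or> e = {(i + 1, j), (i + 1, j + 1)} \<or> e = {(i, j), (i + 1, j + 1)}"
        using tri_sub2[OF _ f(1)] f(3) unfolding fA_def by blast
      then show ?thesis using grid_H[OF n, of i j] grid_V[OF n, of "i + 1" j] grid_D[OF n, of i j] A by auto
    next
      case (B i j)
      then have "e = {(i, j), (i, j + 1)} \<or> e = {(i, j + 1), (i + 1, j + 1)} \<or> e = {(i, j), (i + 1, j + 1)}"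
        using tri_sub2[OF _ f(1)] f(3) unfolding fB_def by blast
      then show ?thesis using grid_V[OF n, of i j] grid_H[OF n, of i "j + 1"] grid_D[OF n, of i j] B by auto
    next
      case (H0 i)
      then have "e = {(i, 0), (i + 1, 0)}" using tri_sub2[OF _ f(1)] f(3) False unfolding fH_def by blast
      then show ?thesis using grid_H[OF n, of i 0] H0 n by simp
    next
      case (Hn i)
      then have "e = {(i, n), (i + 1, n)}" using tri_sub2[OF _ f(1)] f(3) False unfolding fH_def by blast
      then show ?thesis using grid_H[OF n, of i n] Hn n by simp
    next
      case (V0 i)
      then have "e = {(0, i), (0, i + 1)}" using tri_sub2[OF _ f(1)] f(3) False unfolding fV_def by blast
      then show ?thesis using grid_V[OF n, of 0 i] V0 n by simp
    next
      case (Vn i)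
      then have "e = {(n, i), (n, i + 1)}" using tri_sub2[OF _ f(1)] f(3) False unfolding fV_def by blast
      then show ?thesis using grid_V[OF n, of n i] Vn n by simp
    qed
  qed
qed

lemma grid_linked:
  assumes n: "1 \<le> n"
  shows "linked (grid n) {}"
  unfolding linked_def
proof (intro allI impI, rule ccontr)
  fix X assume X: "X \<subseteq> grid n" "X \<noteq> {} \<and> X \<noteq> grid n"
    and no: "\<not> (\<exists>f\<in>X. \<exists>g\<in>grid n - X. \<exists>e. card e = 2 \<and> e \<subseteq> f \<and> e \<subseteq> g \<and> e \<notin> {})"
  have adj: "f \<in> X \<longleftrightarrow> g \<in> X" if "f \<in> grid n" "g \<in> grid n" "{p, q} \<subseteq> f" "{p, q} \<subseteq> g" "p \<noteq> q" for f g p q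
  proof -
    have "card {p, q} = 2" using that(5) by simp
    then show ?thesis using no that(1-4) X(1) by blast
  qed
  have AB: "fA i j \<in> X \<longleftrightarrow> fB i j \<in> X" if "0 \<le> i" "i < n" "0 \<le> j" "j < n" for i j
    by (rule adj[where p = "(i, j)" and q = "(i + 1, j + 1)", OF gridI(1)[OF that] gridI(2)[OF that]]) (auto simp: face_defs)
  have up: "fB i j \<in> X \<longleftrightarrow> fA i (j + 1) \<in> X" if "0 \<le> i" "i < n" "0 \<le> j" "j + 1 < n" for i j
    by (rule adj[where p = "(i, j + 1)" and q = "(i + 1, j + 1)", OF gridI(2) gridI(1)]) (use that in \<open>auto simp: face_defs\<close>)
  have right: "fA i j \<in> X \<longleftrightarrow> fB (i + 1) j \<in> X" if "0 \<le> i" "i + 1 < n" "0 \<le> j" "j < n" for i j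
    by (rule adj[where p = "(i + 1, j)" and q = "(i + 1, j + 1)", OF gridI(1) gridI(2)]) (use that in \<open>auto simp: face_defs\<close>)
  have row: "fA (int i) 0 \<in> X \<longleftrightarrow> fA 0 0 \<in> X" if "int i < n" for i
    using that
  proof (induction i)
    case (Suc i)
    then have "fA (int i) 0 \<in> X \<longleftrightarrow> fB (int i + 1) 0 \<in> X" by (intro right) auto
    also have "\<dots> \<longleftrightarrow> fA (int i + 1) 0 \<in> X" using AB[of "int i + 1" 0] Suc.prems by auto
    finally show ?case using Suc by (simp add: add.commute)
  qed simp
  have col: "fA (int i) (int j) \<in> X \<longleftrightarrow> fA 0 0 \<in> X" if "int i < n" "int j < n" for i j
    using that(2)
  proof (induction j)
    case 0
    then show ?case using row that by simp
  next
    case (Suc j)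
    then have "fA (int i) (int j) \<in> X \<longleftrightarrow> fB (int i) (int j) \<in> X" using that by (intro AB) auto
    also have "\<dots> \<longleftrightarrow> fA (int i) (int j + 1) \<in> X" using Suc.prems that by (intro up) auto
    finally show ?case using Suc by (simp add: add.commute)
  qed
  have allA: "fA i j \<in> X \<longleftrightarrow> fA 0 0 \<in> X" if "0 \<le> i" "i < n" "0 \<le> j" "j < n" for i j
    using col[of "nat i" "nat j"] that by simp
  have all: "f \<in> X \<longleftrightarrow> fA 0 0 \<in> X" if "f \<in> grid n" for f
    using that
  proof (cases rule: gridE)
    case (A i j)
    then show ?thesis using allA[of i j] by simp
  next
    case (B i j)
    then show ?thesis using allA[of i j] AB[of i j] by simp
  next
    case (H0 i)
    have "f \<in> X \<longleftrightarrow> fA i 0 \<in> X"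
      by (rule adj[where p = "(i, 0)" and q = "(i + 1, 0)", OF that gridI(1)]) (use H0 n in \<open>auto simp: face_defs\<close>)
    then show ?thesis using allA[of i 0] H0 n by simp
  next
    case (Hn i)
    have "f \<in> X \<longleftrightarrow> fB i (n - 1) \<in> X"
      by (rule adj[where p = "(i, n)" and q = "(i + 1, n)", OF that gridI(2)]) (use Hn n in \<open>auto simp: face_defs\<close>)
    then show ?thesis using allA[of i "n - 1"] AB[of i "n - 1"] Hn n by simp
  next
    case (V0 i)
    have "f \<in> X \<longleftrightarrow> fB 0 i \<in> X"
      by (rule adj[where p = "(0, i)" and q = "(0, i + 1)", OF that gridI(2)]) (use V0 n in \<open>auto simp: face_defs\<close>)
    then show ?thesis using allA[of 0 i] AB[of 0 i] V0 n by simp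
  next
    case (Vn i)
    have "f \<in> X \<longleftrightarrow> fA (n - 1) i \<in> X"
      by (rule adj[where p = "(n, i)" and q = "(n, i + 1)", OF that gridI(1)]) (use Vn n in \<open>auto simp: face_defs\<close>)
    then show ?thesis using allA[of "n - 1" i] Vn n by simp
  qed
  then show False using X by blast
qed

lemma grid_sphere:
  assumes n: "1 \<le> n"
  shows "sphere (grid n)"
proof -
  have "fH 0 0 \<in> grid n" using n by (intro gridI) auto
  then have "surface (grid n)"
    unfolding surface_def using finite_grid grid_card3[OF _ n] grid_edge_two[OF n] grid_linked[OF n] by blast
  moreover have "card (grid n) + 4 = 2 * card (\<Union>(grid n))"
    using euler_le[OF \<open>surface (grid n)\<close>] card_grid_le[of n] card_grid_vertices[OF n] by linarith
  ultimately show ?thesis unfolding sphere_def by simp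
qed

lemma grid_adjacent:
  assumes "{(a, b), (a', b')} \<in> tri_edges (grid n)" "0 \<le> a" "0 \<le> a'"
  shows "\<bar>a - a'\<bar> \<le> 1 \<and> \<bar>b - b'\<bar> \<le> 1"
proof -
  obtain f where f: "f \<in> grid n" "{(a, b), (a', b')} \<subseteq> f" using assms(1) by (rule tri_edgesE)
  from f(1) show ?thesis
    by (cases rule: gridE) (use f(2) assms(2,3) in \<open>auto simp: face_defs\<close>)
qed

lemma grid_H_edge:
  assumes "0 \<le> i" "i < n" "0 \<le> j" "j \<le> n"
  shows "{(i, j), (i + 1, j)} \<in> tri_edges (grid n)"
proof (cases "j < n")
  case True
  then show ?thesis using assms gridI(1)[of i n j] by (intro tri_edgesI[of _ "fA i j"]) (auto simp: face_defs)
next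
  case False
  then show ?thesis using assms gridI(4)[of i n] by (intro tri_edgesI[of _ "fH i n"]) (auto simp: face_defs)
qed

lemma grid_V_edge:
  assumes "0 \<le> i" "i \<le> n" "0 \<le> j" "j < n"
  shows "{(i, j), (i, j + 1)} \<in> tri_edges (grid n)"
proof (cases "i < n")
  case True
  then show ?thesis using assms gridI(2)[of i n j] by (intro tri_edgesI[of _ "fB i j"]) (auto simp: face_defs)
next
  case False
  then show ?thesis using assms gridI(6)[of j n] by (intro tri_edgesI[of _ "fV n j"]) (auto simp: face_defs)
qed

section \<open>Induced minors\<close>

lemma col_acy_recolor:
  assumes "col_acy c' F" and c2: "\<And>e. e \<in> F \<Longrightarrow> card e = 2"
    and G: "\<And>u v. {u, v} \<in> F \<Longrightarrow> c' v = G u (c v)"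
  shows "col_acy c F"
  unfolding col_acy_def
proof (rule acy_lift)
  let ?h = "\<lambda>(u, j). (u, G u j)"
  have eq: "?h ` spl c e = spl c' e" if eF: "e \<in> F" for e
  proof -
    have "\<exists>u v. e = {u, v}" using c2[OF eF] by (auto simp: card_2_iff)
    then obtain u v where e: "e = {u, v}" by (elim exE)
    have "c' v = G u (c v)" using G eF e by simp
    moreover have "c' u = G v (c u)" using G eF e by (simp add: insert_commute)
    ultimately show ?thesis using e by simp
  qed
  have "image ?h ` (spl c ` F) = spl c' ` F"
    unfolding image_image[of "image ?h"] by (rule image_cong) (use eq in auto)
  then show "acy (image ?h ` (spl c ` F))" using assms(1) by (simp add: col_acy_def)
  show "inj_on (image ?h) (spl c ` F)"
  proof (rule inj_onI)
    fix s t assume "s \<in> spl c ` F" "t \<in> spl c ` F" and st: "?h ` s = ?h ` t"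
    then obtain d e where de: "d \<in> F" "e \<in> F" "s = spl c d" "t = spl c e" by auto
    then have eqs: "spl c' d = spl c' e" using st eq by simp
    have "fst ` spl c' d = d" "fst ` spl c' e = e" using fst_spl[OF c2[OF de(1)]] fst_spl[OF c2[OF de(2)]] by simp_all
    then have "d = e" using eqs by metis
    then show "s = t" using de by simp
  qed
qed

lemma minor_good:
  fixes T :: "'b set set" and B :: "'a \<Rightarrow> 'b set" and \<phi> :: "'a \<Rightarrow> 'c"
  assumes sp: "sphere T" and fV: "finite V" and E: "\<And>e. e \<in> E \<Longrightarrow> e \<subseteq> V \<and> card e = 2"
    and pr: "\<And>u v. {u, v} \<in> E \<Longrightarrow> \<phi> u \<noteq> \<phi> v"
    and B: "\<And>v. v \<in> V \<Longrightarrow> B v \<noteq> {} \<and> B v \<subseteq> \<Union>T"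
    and dis: "\<And>u v x. u \<in> V \<Longrightarrow> v \<in> V \<Longrightarrow> x \<in> B u \<Longrightarrow> x \<in> B v \<Longrightarrow> u = v"
    and con: "\<And>v x y. v \<in> V \<Longrightarrow> x \<in> B v \<Longrightarrow> y \<in> B v \<Longrightarrow> conn {e \<in> tri_edges T. e \<subseteq> B v} x y"
    and adj1: "\<And>u v. {u, v} \<in> E \<Longrightarrow> \<exists>x\<in>B u. \<exists>y\<in>B v. {x, y} \<in> tri_edges T"
    and adj2: "\<And>u v x y. u \<in> V \<Longrightarrow> v \<in> V \<Longrightarrow> u \<noteq> v \<Longrightarrow> x \<in> B u \<Longrightarrow> y \<in> B v \<Longrightarrow>
       {x, y} \<in> tri_edges T \<Longrightarrow> {u, v} \<in> E"
  shows "good V E \<phi>"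
proof -
  have su: "surface T" using sp unfolding sphere_def by simp
  note S = surfaceD[OF su]
  define r where "r = (\<lambda>v. SOME x. x \<in> B v)"
  have r: "r v \<in> B v" if "v \<in> V" for v unfolding r_def by (rule someI_ex) (use B[OF that] in blast)
  have rinj: "inj_on r V" by (rule inj_onI) (metis dis r)
  define own where "own = (\<lambda>x. THE v. v \<in> V \<and> x \<in> B v)"
  have own: "own x = v" if "v \<in> V" "x \<in> B v" for x v
    unfolding own_def by (rule the_equality) (use that dis in blast)+
  define cov where "cov = (\<Union>v\<in>V. B v)"
  have covI: "x \<in> cov" if "v \<in> V" "x \<in> B v" for x v using that unfolding cov_def by blast
  have covE: "own x \<in> V \<and> x \<in> B (own x)" if "x \<in> cov" for x
    using that own unfolding cov_def by auto
  define \<pi> where "\<pi> = (\<lambda>x. if x \<in> cov then r (own x) else x)"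
  define c :: "'b \<Rightarrow> 'c + 'b" where "c = (\<lambda>x. if x \<in> cov then Inl (\<phi> (own x)) else Inr x)"
  have pi_in: "\<pi> x = r v" if "v \<in> V" "x \<in> B v" for x v
    using own[OF that] covI[OF that] unfolding \<pi>_def by simp
  have pi_cov: "\<pi> x \<in> cov \<longleftrightarrow> x \<in> cov" for x
    using covI r covE unfolding \<pi>_def by auto
  have c_r: "c (r v) = Inl (\<phi> v)" if "v \<in> V" for v
    using own[OF that r[OF that]] covI[OF that r[OF that]] unfolding c_def by simp
  have c_pi: "c (\<pi> x) = c x" for x
  proof (cases "x \<in> cov")
    case True
    then have "\<pi> x = r (own x)" "c x = Inl (\<phi> (own x))" unfolding \<pi>_def c_def by simp_all
    then show ?thesis using c_r covE[OF True] by simp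
  qed (simp add: \<pi>_def)
  have ad: "admissible T \<pi> c"
    unfolding admissible_def
  proof (intro conjI ballI allI impI)
    fix x y assume xy: "x \<in> \<Union>T" "y \<in> \<Union>T" "\<pi> x = \<pi> y"
    show "conn {e \<in> tri_edges T. card (\<pi> ` e) = 1} x y"
    proof (cases "x \<in> cov")
      case True
      then have y: "y \<in> cov" using pi_cov xy(3) by metis
      define v where "v = own x"
      have v: "v \<in> V" "x \<in> B v" using covE[OF True] unfolding v_def by auto
      have "r v = r (own y)" using xy(3) True y unfolding \<pi>_def v_def by simp
      then have "v = own y" using rinj v(1) covE[OF y] by (auto simp: inj_on_def)
      then have "y \<in> B v" using covE[OF y] by simp
      from con[OF v this] show ?thesis
      proof (rule conn_mono)
        show "{e \<in> tri_edges T. e \<subseteq> B v} \<subseteq> {e \<in> tri_edges T. card (\<pi> ` e) = 1}"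
        proof
          fix e assume e: "e \<in> {e \<in> tri_edges T. e \<subseteq> B v}"
          then have "e \<noteq> {}" using tri_edge_sub[of e T] by auto
          moreover have "\<pi> x = r v" if "x \<in> e" for x using pi_in[OF v(1)] e that by auto
          ultimately have "\<pi> ` e = {r v}" by auto
          then show "e \<in> {e \<in> tri_edges T. card (\<pi> ` e) = 1}" using e by simp
        qed
      qed
    next
      case False
      then have "x = y" using xy(3) pi_cov[of y] unfolding \<pi>_def by (auto split: if_splits)
      then show ?thesis by simp
    qed
  next
    fix x y assume xy: "{x, y} \<in> tri_edges T" "\<pi> x \<noteq> \<pi> y"
    have "x \<noteq> y" using tri_edge_neq[OF xy(1)] .
    have "c x \<noteq> c y"
    proof (cases "x \<in> cov \<and> y \<in> cov")
      case True
      then have "own x \<noteq> own y" using xy(2) unfolding \<pi>_def by auto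
      then have "{own x, own y} \<in> E" using adj2[OF _ _ _ _ _ xy(1)] covE True by blast
      then have "\<phi> (own x) \<noteq> \<phi> (own y)" by (rule pr)
      then show ?thesis using True unfolding c_def by simp
    next
      case False
      then show ?thesis using \<open>x \<noteq> y\<close> unfolding c_def by auto
    qed
    then show "c (\<pi> x) \<noteq> c (\<pi> y)" unfolding c_pi .
  qed
  have g0: "good (\<pi> ` \<Union>T) (quot_edges T \<pi>) c" by (rule sphere_good[OF sp ad])
  have rE: "image r ` E \<subseteq> quot_edges T \<pi>"
  proof
    fix w assume "w \<in> image r ` E"
    then obtain e where e: "e \<in> E" "w = r ` e" by blast
    have "\<exists>u v. e = {u, v} \<and> u \<noteq> v" using E[OF e(1)] by (auto simp: card_2_iff)
    then obtain u v where uv: "e = {u, v}" "u \<noteq> v" by (elim exE conjE)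
    then have V: "u \<in> V" "v \<in> V" using E[OF e(1)] by auto
    have "{u, v} \<in> E" using e uv by simp
    from adj1[OF this] obtain x y where xy: "x \<in> B u" "y \<in> B v" "{x, y} \<in> tri_edges T" by (elim bexE)
    have "\<pi> ` {x, y} = w" using pi_in V xy e uv by simp
    moreover have "r u \<noteq> r v" using inj_onD[OF rinj _ V] uv(2) by blast
    then have "card w = 2" using e uv by simp
    ultimately show "w \<in> quot_edges T \<pi>" unfolding quot_edges_def using xy(3) by blast
  qed
  have "good (\<pi> ` \<Union>T) (image r ` E) c" by (rule good_subset[OF g0 rE finite_quot_edges[OF su]])
  then obtain F' where F': "F' \<subseteq> image r ` E" "col_acy c F'"
    "card (image r ` E) + card (c ` \<pi> ` \<Union>T) \<le> card F' + card (\<pi> ` \<Union>T)" unfolding good_def by blast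
  have injE: "inj_on (image r) E"
    by (rule inj_on_subset[OF inj_on_image_Pow[OF rinj]]) (use E in auto)
  obtain F where F: "F \<subseteq> E" "F' = image r ` F" using F'(1) by (auto simp: subset_image_iff)
  have injF: "inj_on (image r) F" by (rule inj_on_subset[OF injE F(1)])
  have FV: "x \<in> V" if "x \<in> \<Union>F" for x using that F(1) E by blast
  have "col_acy (Inl \<circ> \<phi> :: 'a \<Rightarrow> 'c + 'b) F"
  proof (rule col_acy_lift[OF _ injF])
    show "col_acy c (image r ` F)" using F' F by simp
    show "c (r x) = (Inl \<circ> \<phi>) x" if "x \<in> \<Union>F" for x using c_r[OF FV[OF that]] by simp
    show "card e = 2 \<and> card (r ` e) = 2" if "e \<in> F" for e
      using E[of e] that F(1) card_image[OF inj_on_subset[OF rinj, of e]] by auto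
  qed
  then have "col_acy \<phi> F"
    by (rule col_acy_recolor[where G = "\<lambda>u. Inl"]) (use F(1) E in auto)
  moreover have "card E + card (\<phi> ` V) \<le> card F + card V"
  proof -
    define R where "R = \<Union>T - cov"
    have fR: "finite R" using S(6) unfolding R_def by simp
    have W: "\<pi> ` \<Union>T = r ` V \<union> R"
    proof (intro equalityI subsetI)
      fix w assume "w \<in> \<pi> ` \<Union>T"
      then obtain x where x: "x \<in> \<Union>T" "w = \<pi> x" by blast
      show "w \<in> r ` V \<union> R"
        using x covE[of x] unfolding \<pi>_def R_def by (cases "x \<in> cov") auto
    next
      fix w assume w: "w \<in> r ` V \<union> R"
      show "w \<in> \<pi> ` \<Union>T"
      proof (cases "w \<in> R")
        case True
        then have "w \<in> \<Union>T" "\<pi> w = w" unfolding R_def \<pi>_def by auto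
        then show ?thesis by force
      next
        case False
        then obtain v where v: "v \<in> V" "w = r v" using w by blast
        then have "\<pi> w = w" "w \<in> \<Union>T" using pi_in[OF v(1) r[OF v(1)]] B[OF v(1)] r[OF v(1)] by auto
        then show ?thesis by force
      qed
    qed
    have "r ` V \<inter> R = {}" using covI r unfolding R_def by auto
    then have 1: "card (\<pi> ` \<Union>T) = card V + card R"
      unfolding W using fV fR card_image[OF rinj] by (simp add: card_Un_disjoint)
    have "c ` R = Inr ` R" unfolding c_def R_def by auto
    moreover have "c ` r ` V = Inl ` \<phi> ` V" using c_r by (auto simp: image_image)
    ultimately have cW: "c ` \<pi> ` \<Union>T = Inl ` \<phi> ` V \<union> Inr ` R" unfolding W by (simp add: image_Un)
    have "(Inl ` \<phi> ` V :: ('c + 'b) set) \<inter> Inr ` R = {}" by auto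
    then have 2: "card (c ` \<pi> ` \<Union>T) = card (\<phi> ` V) + card R"
      unfolding cW using fV fR by (simp add: card_Un_disjoint card_image)
    have 3: "card (image r ` E) = card E" "card F' = card F"
      using card_image[OF injE] card_image[OF injF] F(2) by simp_all
    show ?thesis using F'(3) 1 2 3 by simp
  qed
  ultimately show ?thesis unfolding good_def using F(1) by blast
qed

section \<open>Planar drawings\<close>

lemma compact_family_separated:
  fixes F :: "'b::heine_borel set set"
  assumes "finite F" "\<And>K. K \<in> F \<Longrightarrow> compact K"
  shows "\<exists>d>0. \<forall>K\<in>F. \<forall>L\<in>F. K \<inter> L = {} \<longrightarrow> (\<forall>x\<in>K. \<forall>y\<in>L. d \<le> dist x y)"
proof -
  have "\<exists>d>0. K \<inter> L = {} \<longrightarrow> (\<forall>x\<in>K. \<forall>y\<in>L. d \<le> dist x y)" if "K \<in> F" "L \<in> F" for K L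
  proof (cases "K \<inter> L = {}")
    case True
    have "compact K" "closed L" using assms(2) that compact_imp_closed by auto
    then obtain d where "d > 0" "\<forall>x\<in>K. \<forall>y\<in>L. d \<le> dist x y"
      using separate_compact_closed True by metis
    then show ?thesis by blast
  next
    case False
    then show ?thesis by (intro exI[of _ 1]) simp
  qed
  then obtain d where d: "\<And>K L. K \<in> F \<Longrightarrow> L \<in> F \<Longrightarrow> d K L > (0::real)"
    "\<And>K L. K \<in> F \<Longrightarrow> L \<in> F \<Longrightarrow> K \<inter> L = {} \<Longrightarrow> (\<forall>x\<in>K. \<forall>y\<in>L. d K L \<le> dist x y)" by metis
  define m where "m = Min (insert 1 ((\<lambda>(K, L). d K L) ` (F \<times> F)))"
  have fin: "finite (insert 1 ((\<lambda>(K, L). d K L) ` (F \<times> F)))" using assms(1) by simp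
  have "m > 0" unfolding m_def using fin d(1) by (subst Min_gr_iff) auto
  moreover have "m \<le> d K L" if "K \<in> F" "L \<in> F" for K L
    unfolding m_def by (rule Min_le[OF fin]) (use that in auto)
  ultimately show ?thesis using d(2) by (intro exI[of _ m]) (meson order_trans)
qed

locale mesh =
  fixes R h :: real and n :: int
  assumes R: "R > 0" and h: "h > 0" and n: "n = \<lfloor>2 * R / h\<rfloor> + 1"
begin

definition cx :: "complex \<Rightarrow> int" where "cx z = \<lfloor>(Re z + R) / h\<rfloor>"
definition cy :: "complex \<Rightarrow> int" where "cy z = \<lfloor>(Im z + R) / h\<rfloor>"
definition cor :: "complex \<Rightarrow> (int \<times> int) set" where
  "cor z = {(cx z, cy z), (cx z + 1, cy z), (cx z, cy z + 1), (cx z + 1, cy z + 1)}"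
definition raster :: "complex set \<Rightarrow> (int \<times> int) set" where
  "raster K = (\<Union>z\<in>K. cor z)"

lemma n1: "1 \<le> n"
  using R h unfolding n by simp

lemma cell_range:
  assumes "norm z \<le> R"
  shows "0 \<le> cx z" "cx z + 1 \<le> n" "0 \<le> cy z" "cy z + 1 \<le> n"
proof -
  have "\<bar>Re z\<bar> \<le> R" "\<bar>Im z\<bar> \<le> R" using assms abs_Re_le_cmod[of z] abs_Im_le_cmod[of z] by linarith+
  then have "0 \<le> (Re z + R) / h" "(Re z + R) / h \<le> 2 * R / h" "0 \<le> (Im z + R) / h" "(Im z + R) / h \<le> 2 * R / h"
    using h by (auto intro!: divide_right_mono divide_nonneg_pos)
  then show "0 \<le> cx z" "cx z + 1 \<le> n" "0 \<le> cy z" "cy z + 1 \<le> n"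
    unfolding cx_def cy_def n by (simp_all add: floor_mono)
qed

lemma cor_conn:
  assumes "norm z \<le> R" "p \<in> cor z" "q \<in> cor z"
  shows "conn {e \<in> tri_edges (grid n). e \<subseteq> cor z} p q"
proof -
  note cr = cell_range[OF assms(1)]
  let ?X = "{e \<in> tri_edges (grid n). e \<subseteq> cor z}"
  let ?o = "(cx z, cy z)"
  have 1: "{?o, (cx z + 1, cy z)} \<in> ?X" "{(cx z, cy z + 1), (cx z + 1, cy z + 1)} \<in> ?X" "{?o, (cx z, cy z + 1)} \<in> ?X"
    using cr grid_H_edge[of "cx z" n "cy z"] grid_H_edge[of "cx z" n "cy z + 1"] grid_V_edge[of "cx z" n "cy z"]
    unfolding cor_def by auto
  have a: "conn ?X ?o (cx z + 1, cy z)" "conn ?X ?o (cx z, cy z + 1)" using 1 by (auto intro: conn_edge)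
  have b: "conn ?X ?o (cx z + 1, cy z + 1)" by (rule conn_trans[OF a(2) conn_edge[OF 1(2)]])
  have o: "conn ?X ?o s" if "s \<in> cor z" for s
  proof -
    have "s = ?o \<or> s = (cx z + 1, cy z) \<or> s = (cx z, cy z + 1) \<or> s = (cx z + 1, cy z + 1)"
      using that unfolding cor_def by simp
    then show ?thesis using a b conn_refl by (elim disjE) simp_all
  qed
  show ?thesis by (rule conn_trans[OF conn_sym[OF o[OF assms(2)]] o[OF assms(3)]])
qed

lemma floor_close:
  assumes "\<bar>a - b\<bar> < h"
  shows "\<bar>\<lfloor>(a + R) / h\<rfloor> - \<lfloor>(b + R) / h\<rfloor>\<bar> \<le> 1"
proof -
  have "\<bar>(a + R) / h - (b + R) / h\<bar> = \<bar>a - b\<bar> / h"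
    using h by (simp add: diff_divide_distrib[symmetric])
  also have "\<dots> < 1" using assms h by simp
  finally show ?thesis by linarith
qed

lemma cor_meet:
  assumes "dist z w < h"
  shows "cor z \<inter> cor w \<noteq> {}"
proof -
  have "\<bar>Re z - Re w\<bar> < h" "\<bar>Im z - Im w\<bar> < h"
    using assms abs_Re_le_cmod[of "z - w"] abs_Im_le_cmod[of "z - w"] by (simp_all add: dist_norm)
  then have c: "\<bar>cx z - cx w\<bar> \<le> 1" "\<bar>cy z - cy w\<bar> \<le> 1" unfolding cx_def cy_def by (simp_all only: floor_close)
  define i where "i = max (cx z) (cx w)"
  define j where "j = max (cy z) (cy w)"
  have i: "i = cx z \<or> i = cx z + 1" "i = cx w \<or> i = cx w + 1" using c(1) unfolding i_def by linarith+
  have j: "j = cy z \<or> j = cy z + 1" "j = cy w \<or> j = cy w + 1" using c(2) unfolding j_def by linarith+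
  have "(i, j) \<in> cor z" using i(1) j(1) unfolding cor_def by auto
  moreover have "(i, j) \<in> cor w" using i(2) j(2) unfolding cor_def by auto
  ultimately show ?thesis by blast
qed

lemma raster_conn:
  assumes K: "connected K" "\<And>z. z \<in> K \<Longrightarrow> norm z \<le> R" and pq: "p \<in> raster K" "q \<in> raster K"
  shows "conn {e \<in> tri_edges (grid n). e \<subseteq> raster K} p q"
proof -
  let ?X = "{e \<in> tri_edges (grid n). e \<subseteq> raster K}"
  have corX: "conn ?X s t" if "z \<in> K" "s \<in> cor z" "t \<in> cor z" for z s t
    using cor_conn[OF K(2)[OF that(1)] that(2,3)]
    by (rule conn_mono) (use that(1) in \<open>auto simp: raster_def\<close>)
  obtain z w where zw: "z \<in> K" "p \<in> cor z" "w \<in> K" "q \<in> cor w" using pq unfolding raster_def by blast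
  let ?R = "\<lambda>z w. \<forall>s\<in>cor z. \<forall>t\<in>cor w. conn ?X s t"
  have "?R z w"
  proof (rule connected_equivalence_relation[OF K(1) zw(1,3)])
    show "?R y x" if "?R x y" for x y
    proof (intro ballI)
      fix s t assume st: "s \<in> cor y" "t \<in> cor x"
      show "conn ?X s t" by (rule conn_sym[OF that[rule_format, OF st(2,1)]])
    qed
    show "?R x z" if "?R x y" "?R y z" for x y z
    proof (intro ballI)
      fix s t assume st: "s \<in> cor x" "t \<in> cor z"
      have o: "(cx y, cy y) \<in> cor y" unfolding cor_def by simp
      show "conn ?X s t" by (rule conn_trans[OF that(1)[rule_format, OF st(1) o] that(2)[rule_format, OF o st(2)]])
    qed
    fix a assume a: "a \<in> K"
    show "\<exists>U. openin (top_of_set K) U \<and> a \<in> U \<and> (\<forall>x\<in>U. ?R a x)"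
    proof (intro exI[of _ "K \<inter> ball a h"] conjI ballI)
      show "openin (top_of_set K) (K \<inter> ball a h)" by (simp add: openin_open_Int)
      show "a \<in> K \<inter> ball a h" using a h by simp
      fix x s t assume x: "x \<in> K \<inter> ball a h" and st: "s \<in> cor a" "t \<in> cor x"
      have "dist a x < h" using x by simp
      then obtain u where u: "u \<in> cor a" "u \<in> cor x" using cor_meet by blast
      have "x \<in> K" using x by simp
      then show "conn ?X s t" using conn_trans[OF corX[OF a st(1) u(1)] corX[OF _ u(2) st(2)]] by blast
    qed
  qed
  then show ?thesis using zw by blast
qed

lemma raster_near:
  assumes "p \<in> raster K"
  obtains z where "z \<in> K" "\<bar>Re z + R - h * fst p\<bar> \<le> h" "\<bar>Im z + R - h * snd p\<bar> \<le> h"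
proof -
  obtain z where z: "z \<in> K" "p \<in> cor z" using assms unfolding raster_def by blast
  have fl: "\<bar>a + R - h * of_int i\<bar> \<le> h" if "i = \<lfloor>(a + R) / h\<rfloor> \<or> i = \<lfloor>(a + R) / h\<rfloor> + 1" for a i
  proof -
    have "of_int \<lfloor>(a + R) / h\<rfloor> \<le> (a + R) / h" "(a + R) / h < of_int \<lfloor>(a + R) / h\<rfloor> + 1" by linarith+
    then have "\<bar>(a + R) / h - of_int i\<bar> \<le> 1" using that by (elim disjE) (simp_all add: abs_le_iff, linarith)
    then have "h * \<bar>(a + R) / h - of_int i\<bar> \<le> h" using h by simp
    moreover have "h * \<bar>(a + R) / h - of_int i\<bar> = \<bar>h * ((a + R) / h - of_int i)\<bar>" using h by (simp add: abs_mult)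
    moreover have "h * ((a + R) / h - of_int i) = a + R - h * of_int i" using h by (simp add: right_diff_distrib)
    ultimately show ?thesis by simp
  qed
  have "fst p = cx z \<or> fst p = cx z + 1" "snd p = cy z \<or> snd p = cy z + 1"
    using z(2) unfolding cor_def by auto
  then show ?thesis using that[OF z(1)] fl unfolding cx_def cy_def by blast
qed

lemma raster_apart:
  assumes K: "\<And>z. z \<in> K \<Longrightarrow> norm z \<le> R" and L: "\<And>z. z \<in> L \<Longrightarrow> norm z \<le> R"
    and far: "\<And>z w. z \<in> K \<Longrightarrow> w \<in> L \<Longrightarrow> 7 * h \<le> dist z w"
    and p: "p \<in> raster K" and q: "q \<in> raster L"
  shows "p \<noteq> q" "{p, q} \<notin> tri_edges (grid n)"
proof -
  have key: False if pq: "\<bar>fst p - fst q\<bar> \<le> 1" "\<bar>snd p - snd q\<bar> \<le> 1"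
  proof -
    obtain z where z: "z \<in> K" "\<bar>Re z + R - h * fst p\<bar> \<le> h" "\<bar>Im z + R - h * snd p\<bar> \<le> h"
      using raster_near[OF p] .
    obtain w where w: "w \<in> L" "\<bar>Re w + R - h * fst q\<bar> \<le> h" "\<bar>Im w + R - h * snd q\<bar> \<le> h"
      using raster_near[OF q] .
    have hm: "\<bar>h * real_of_int i - h * real_of_int j\<bar> \<le> h" if "\<bar>i - j\<bar> \<le> 1" for i j
    proof -
      have "real_of_int \<bar>i - j\<bar> \<le> 1" using that by linarith
      then have "h * \<bar>real_of_int i - real_of_int j\<bar> \<le> h" using h by simp
      moreover have "\<bar>h * real_of_int i - h * real_of_int j\<bar> = h * \<bar>real_of_int i - real_of_int j\<bar>"
        using h by (simp add: right_diff_distrib[symmetric] abs_mult)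
      ultimately show ?thesis by simp
    qed
    have "\<bar>Re z - Re w\<bar> \<le> 3 * h" using z(2) w(2) hm[OF pq(1)] by linarith
    moreover have "\<bar>Im z - Im w\<bar> \<le> 3 * h" using z(3) w(3) hm[OF pq(2)] by linarith
    moreover have "dist z w \<le> \<bar>Re (z - w)\<bar> + \<bar>Im (z - w)\<bar>" unfolding dist_norm by (rule cmod_le)
    ultimately have "dist z w \<le> 6 * h" by simp
    then show False using far[OF z(1) w(1)] h by simp
  qed
  show "p \<noteq> q" using key by auto
  have nonneg: "0 \<le> fst s" if sM: "s \<in> raster M" "\<And>z. z \<in> M \<Longrightarrow> norm z \<le> R" for s M
  proof -
    obtain z where z: "z \<in> M" "s \<in> cor z" using sM(1) unfolding raster_def by blast
    then show ?thesis using cell_range[OF sM(2)[OF z(1)]] unfolding cor_def by auto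
  qed
  show "{p, q} \<notin> tri_edges (grid n)"
  proof
    assume "{p, q} \<in> tri_edges (grid n)"
    then have "\<bar>fst p - fst q\<bar> \<le> 1 \<and> \<bar>snd p - snd q\<bar> \<le> 1"
      using grid_adjacent[of "fst p" "snd p" "fst q" "snd q" n] nonneg[OF p K] nonneg[OF q L] by simp
    then show False using key by blast
  qed
qed

lemma raster_sub:
  assumes "\<And>z. z \<in> K \<Longrightarrow> norm z \<le> R"
  shows "raster K \<subseteq> \<Union>(grid n)"
proof
  fix p assume "p \<in> raster K"
  then obtain z where z: "z \<in> K" "p \<in> cor z" unfolding raster_def by blast
  have "p \<in> {0..n} \<times> {0..n}" using cell_range[OF assms[OF z(1)]] z(2) unfolding cor_def by auto
  then show "p \<in> \<Union>(grid n)" using grid_vertices[OF n1] by blast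
qed

lemma raster_mem: "z \<in> K \<Longrightarrow> (cx z, cy z) \<in> raster K"
  unfolding raster_def cor_def by blast

end

lemma reach_before:
  assumes X: "\<And>x y. x \<in> X \<Longrightarrow> y \<in> X \<Longrightarrow> conn {e \<in> G. e \<subseteq> X} x y"
    and ab: "a \<in> X" "a \<in> A" "b \<in> X" "b \<in> B" "A \<inter> B = {}"
  shows "\<exists>Q. Q \<subseteq> X - B \<and> (\<forall>z\<in>Q. \<exists>a'\<in>A. conn {e \<in> G. e \<subseteq> Q} a' z) \<and> (\<exists>r\<in>Q. \<exists>b'\<in>B. {r, b'} \<in> G)"
proof -
  define Q where "Q = {z \<in> X - B. \<exists>a'\<in>A \<inter> X. conn {e \<in> G. e \<subseteq> X - B} a' z}"
  have AQ: "a' \<in> Q" if "a' \<in> A" "a' \<in> X" for a' using that ab(5) unfolding Q_def by blast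
  have 1: "\<exists>a'\<in>A. conn {e \<in> G. e \<subseteq> Q} a' z" if zQ: "z \<in> Q" for z
  proof -
    obtain a' where a': "a' \<in> A" "a' \<in> X" "conn {e \<in> G. e \<subseteq> X - B} a' z" using zQ unfolding Q_def by blast
    from a'(3) have "z \<in> Q \<and> conn {e \<in> G. e \<subseteq> Q} a' z"
    proof (induction rule: conn_induct)
      case refl
      then show ?case using AQ a' by simp
    next
      case (step y z)
      have zX: "z \<in> X - B" using step.hyps(2) by simp
      have "conn {e \<in> G. e \<subseteq> X - B} a' z" using step.hyps by (intro conn_trans[OF step.hyps(1)] conn_edge)
      then have z: "z \<in> Q" using zX a' unfolding Q_def by blast
      have "{y, z} \<in> {e \<in> G. e \<subseteq> Q}" using step z by simp
      then show ?case using z conn_trans[OF conjunct2[OF step.IH] conn_edge] by blast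
    qed
    then show ?thesis using a'(1) by blast
  qed
  have 2: "\<exists>r\<in>Q. \<exists>b'\<in>B. {r, b'} \<in> G"
  proof (rule ccontr)
    assume no: "\<not> ?thesis"
    from X[OF ab(1,3)] have "b \<in> Q"
    proof (induction rule: conn_induct)
      case refl
      then show ?case using AQ ab by simp
    next
      case (step y z)
      have yz: "{y, z} \<in> G" "z \<in> X" using step.hyps(2) by simp_all
      have zB: "z \<notin> B" using no step.IH yz by blast
      obtain a' where a': "a' \<in> A \<inter> X" "conn {e \<in> G. e \<subseteq> X - B} a' y" "y \<in> X - B"
        using step.IH unfolding Q_def by blast
      have "{y, z} \<in> {e \<in> G. e \<subseteq> X - B}" using yz zB a'(3) by simp
      then have "conn {e \<in> G. e \<subseteq> X - B} a' z" using conn_trans[OF a'(2) conn_edge] by blast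
      then show ?case using a'(1) yz(2) zB unfolding Q_def by blast
    qed
    then show False using ab(4) unfolding Q_def by blast
  qed
  show ?thesis by (rule exI[of _ Q]) (use 1 2 in \<open>auto simp: Q_def\<close>)
qed

lemma ball_avoiding:
  assumes "finite V" and "\<And>v. v \<in> V \<Longrightarrow> closed (C v) \<and> p v \<notin> C v"
  shows "\<exists>r>0. \<forall>v\<in>V. cball (p v :: 'b::metric_space) r \<inter> C v = {}"
  using assms
proof (induction V rule: finite_induct)
  case empty
  then show ?case by (intro exI[of _ 1]) simp
next
  case (insert v V)
  obtain r where r: "r > 0" "\<forall>v\<in>V. cball (p v) r \<inter> C v = {}" using insert by auto
  have "open (- C v)" "p v \<in> - C v" using insert.prems[of v] by auto
  then obtain s where s: "s > 0" "cball (p v) s \<subseteq> - C v" using open_contains_cball by blast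
  have "cball (p v) (min r s) \<inter> C v = {}" using s subset_cball[of "min r s" s "p v"] by (auto simp: subset_iff)
  moreover have "cball (p u) (min r s) \<inter> C u = {}" if "u \<in> V" for u
    using r(2)[rule_format, OF that] subset_cball[of "min r s" r "p u"] by (simp add: disjoint_iff subset_iff)
  ultimately show ?case using r(1) s(1) by (intro exI[of _ "min r s"]) auto
qed

lemma arc_core:
  assumes g: "arc g" and r: "r > (0::real)"
  shows "\<exists>s t. 0 < s \<and> s \<le> t \<and> t < 1 \<and> dist (g s) (pathstart g) \<le> r \<and> dist (g t) (pathfinish g :: complex) \<le> r"
proof -
  have co: "continuous_on {0..1} g" using g unfolding arc_def path_def by blast
  obtain d where d: "d > 0" "\<And>x. x \<in> {0..1} \<Longrightarrow> dist x 0 < d \<Longrightarrow> dist (g x) (g 0) < r"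
    using co r unfolding continuous_on_iff by (metis atLeastAtMost_iff order_refl zero_le_one)
  obtain d' where d': "d' > 0" "\<And>x. x \<in> {0..1} \<Longrightarrow> dist x 1 < d' \<Longrightarrow> dist (g x) (g 1) < r"
    using co r unfolding continuous_on_iff by (metis atLeastAtMost_iff order_refl zero_le_one)
  define s where "s = min (1/2) (d/2)"
  define t where "t = max (1/2) (1 - d'/2)"
  have s: "0 < s" "s \<le> 1/2" "s < d" using d(1) unfolding s_def by auto
  have t: "t < 1" "1/2 \<le> t" "1 - t < d'" using d'(1) unfolding t_def by auto
  have "dist (g s) (g 0) < r" by (rule d(2)) (use s in \<open>auto simp: dist_real_def\<close>)
  moreover have "dist (g t) (g 1) < r" by (rule d'(2)) (use t in \<open>auto simp: dist_real_def\<close>)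
  ultimately show ?thesis unfolding pathstart_def pathfinish_def using s t
    by (intro exI[of _ s] exI[of _ t]) auto
qed

text \<open>The branch set of a vertex is the raster of a small disc around it together with a raster of the
  part of each outgoing arc that lies before the disc of the other end.\<close>
lemma planar_branch_sets:
  fixes V :: "'a set" and E :: "'a set set"
  assumes "planar_graph V E"
  shows "\<exists>n B. 1 \<le> n \<and> (\<forall>v\<in>V. B v \<noteq> {} \<and> B v \<subseteq> \<Union>(grid n)) \<and>
    (\<forall>u\<in>V. \<forall>v\<in>V. \<forall>x. x \<in> B u \<longrightarrow> x \<in> B v \<longrightarrow> u = v) \<and>
    (\<forall>v\<in>V. \<forall>x\<in>B v. \<forall>y\<in>B v. conn {e \<in> tri_edges (grid n). e \<subseteq> B v} x y) \<and>
    (\<forall>u v. {u, v} \<in> E \<longrightarrow> (\<exists>x\<in>B u. \<exists>y\<in>B v. {x, y} \<in> tri_edges (grid n))) \<and>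
    (\<forall>u\<in>V. \<forall>v\<in>V. u \<noteq> v \<longrightarrow> (\<forall>x\<in>B u. \<forall>y\<in>B v. {x, y} \<in> tri_edges (grid n) \<longrightarrow> {u, v} \<in> E))"
proof -
  have fV: "finite V" and E2: "\<And>e. e \<in> E \<Longrightarrow> e \<subseteq> V \<and> card e = 2"
    using assms unfolding planar_graph_def simple_graph_def by auto
  obtain p \<gamma> where "plane_drawing V E p \<gamma>" using assms unfolding planar_graph_def by blast
  then have pinj: "inj_on p V"
    and arcE: "\<And>e. e \<in> E \<Longrightarrow> arc (\<gamma> e)"
    and ends: "\<And>e. e \<in> E \<Longrightarrow> {pathstart (\<gamma> e), pathfinish (\<gamma> e)} = p ` e"
    and meetV: "\<And>e. e \<in> E \<Longrightarrow> path_image (\<gamma> e) \<inter> p ` V = p ` e"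
    and meetE: "\<And>e f. e \<in> E \<Longrightarrow> f \<in> E \<Longrightarrow> e \<noteq> f \<Longrightarrow> path_image (\<gamma> e) \<inter> path_image (\<gamma> f) = p ` (e \<inter> f)"
    unfolding plane_drawing_def by auto
  have fE: "finite E" using E2 fV finite_subset[of E "Pow V"] by blast
  have "\<exists>a b. e = {a, b} \<and> a \<noteq> b \<and> p a = pathstart (\<gamma> e) \<and> p b = pathfinish (\<gamma> e)" if e: "e \<in> E" for e
  proof -
    have "\<exists>x y. e = {x, y} \<and> x \<noteq> y" using E2[OF e] by (auto simp: card_2_iff)
    then obtain x y where xy: "e = {x, y}" "x \<noteq> y" by (elim exE conjE)
    have "{pathstart (\<gamma> e), pathfinish (\<gamma> e)} = {p x, p y}" using ends[OF e] xy by simp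
    then have "p x = pathstart (\<gamma> e) \<and> p y = pathfinish (\<gamma> e) \<or> p y = pathstart (\<gamma> e) \<and> p x = pathfinish (\<gamma> e)"
      by (auto simp: doubleton_eq_iff)
    then show ?thesis using xy by (metis insert_commute)
  qed
  then obtain tl hd where th: "\<And>e. e \<in> E \<Longrightarrow> e = {tl e, hd e} \<and> tl e \<noteq> hd e \<and>
      p (tl e) = pathstart (\<gamma> e) \<and> p (hd e) = pathfinish (\<gamma> e)" by metis
  have thV: "tl e \<in> V" "hd e \<in> V" if "e \<in> E" for e using th[OF that] E2[OF that] by auto

  define C where "C = (\<lambda>v. p ` (V - {v}) \<union> (\<Union>e\<in>{e \<in> E. v \<notin> e}. path_image (\<gamma> e)))"
  have "closed (C v) \<and> p v \<notin> C v" if v: "v \<in> V" for v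
  proof
    have "closed (path_image (\<gamma> e))" if "e \<in> E" for e
      using arcE[OF that] by (intro closed_path_image) (simp add: arc_def)
    then show "closed (C v)" unfolding C_def using fV fE
      by (intro closed_Un closed_UN) (auto intro: finite_imp_closed)
    have "p v \<notin> path_image (\<gamma> e)" if "e \<in> E" "v \<notin> e" for e
    proof
      assume "p v \<in> path_image (\<gamma> e)"
      then have "p v \<in> p ` e" using meetV[OF that(1)] v by blast
      then show False using pinj v that E2 by (auto simp: inj_on_def subset_iff)
    qed
    then show "p v \<notin> C v" unfolding C_def using pinj v by (auto simp: inj_on_def)
  qed
  then obtain r0 where r0: "r0 > 0" "\<And>v. v \<in> V \<Longrightarrow> cball (p v) r0 \<inter> C v = {}"
    using ball_avoiding[OF fV, of C p] by blast
  define r where "r = r0 / 2"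
  have r: "r > 0" "r + r = r0" using r0(1) unfolding r_def by auto
  define D where "D = (\<lambda>v. cball (p v) r)"
  have DD: "D u \<inter> D v = {}" if uv: "u \<in> V" "v \<in> V" "u \<noteq> v" for u v
  proof (rule ccontr)
    assume "D u \<inter> D v \<noteq> {}"
    then obtain x where "dist (p u) x \<le> r" "dist (p v) x \<le> r" unfolding D_def by auto
    then have "dist (p u) (p v) \<le> r0" using dist_triangle2[of "p u" "p v" x] r(2) by linarith
    then have "p v \<in> cball (p u) r0" by simp
    moreover have "p v \<in> C u" unfolding C_def using uv by auto
    ultimately show False using r0(2)[OF uv(1)] by blast
  qed
  have "\<exists>s t. 0 < s \<and> s \<le> t \<and> t < 1 \<and> dist (\<gamma> e s) (pathstart (\<gamma> e)) \<le> r \<and> dist (\<gamma> e t) (pathfinish (\<gamma> e)) \<le> r"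
    if "e \<in> E" for e by (rule arc_core[OF arcE[OF that] r(1)])
  then obtain s t where st: "\<And>e. e \<in> E \<Longrightarrow> 0 < s e \<and> s e \<le> t e \<and> t e < 1 \<and>
     dist (\<gamma> e (s e)) (pathstart (\<gamma> e)) \<le> r \<and> dist (\<gamma> e (t e)) (pathfinish (\<gamma> e)) \<le> r" by metis
  define M where "M = (\<lambda>e. \<gamma> e ` {s e..t e})"
  have Msub: "M e \<subseteq> path_image (\<gamma> e)" if "e \<in> E" for e
    unfolding M_def path_image_def using st[OF that] by (intro image_mono) auto
  have Mco: "continuous_on {s e..t e} (\<gamma> e)" if "e \<in> E" for e
  proof -
    have "continuous_on {0..1} (\<gamma> e)" using arcE[OF that] unfolding arc_def path_def by blast
    then show ?thesis by (rule continuous_on_subset) (use st[OF that] in auto)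
  qed
  have MM: "M e \<inter> M f = {}" if ef: "e \<in> E" "f \<in> E" "e \<noteq> f" for e f
  proof (rule ccontr)
    assume "M e \<inter> M f \<noteq> {}"
    then obtain z where z: "z \<in> M e" "z \<in> M f" by blast
    then have "z \<in> p ` (e \<inter> f)" using meetE[OF ef] Msub ef by blast
    then have "z \<in> {pathstart (\<gamma> e), pathfinish (\<gamma> e)}" using ends[OF ef(1)] by auto
    then have "z = \<gamma> e 0 \<or> z = \<gamma> e 1" unfolding pathstart_def pathfinish_def by auto
    moreover obtain x where x: "x \<in> {s e..t e}" "z = \<gamma> e x" using z(1) unfolding M_def by blast
    moreover have "inj_on (\<gamma> e) {0..1}" using arcE[OF ef(1)] unfolding arc_def by blast
    ultimately show False using st[OF ef(1)] inj_onD[of "\<gamma> e" "{0..1}" x 0] inj_onD[of "\<gamma> e" "{0..1}" x 1] by auto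
  qed
  have MD: "v \<in> e" if ev: "e \<in> E" "v \<in> V" "M e \<inter> D v \<noteq> {}" for e v
  proof (rule ccontr)
    assume "v \<notin> e"
    then have "M e \<subseteq> C v" using Msub[OF ev(1)] ev(1) unfolding C_def by blast
    moreover have "D v \<subseteq> cball (p v) r0" using r unfolding D_def by (intro subset_cball) auto
    ultimately show False using r0(2)[OF ev(2)] ev(3) by blast
  qed
  have Mtl: "\<gamma> e (s e) \<in> M e \<inter> D (tl e)" and Mhd: "\<gamma> e (t e) \<in> M e \<inter> D (hd e)" if "e \<in> E" for e
    using st[OF that] th[OF that] unfolding M_def D_def by (auto simp: dist_commute)

  let ?K = "D ` V \<union> M ` E"
  have Kcomp: "compact K" if "K \<in> ?K" for K
    using that Mco unfolding D_def M_def by (auto intro: compact_continuous_image)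
  have fK: "finite ?K" using fV fE by simp
  have "\<exists>\<delta>>0. \<forall>K\<in>?K. \<forall>L\<in>?K. K \<inter> L = {} \<longrightarrow> (\<forall>x\<in>K. \<forall>y\<in>L. \<delta> \<le> dist x y)"
    by (rule compact_family_separated[OF fK]) (rule Kcomp)
  then obtain \<delta> where \<delta>0: "\<delta> > 0" "\<forall>K\<in>?K. \<forall>L\<in>?K. K \<inter> L = {} \<longrightarrow> (\<forall>x\<in>K. \<forall>y\<in>L. \<delta> \<le> dist x y)"
    by (elim exE conjE)
  have \<delta>: "\<delta> > 0" "\<And>K L x y. K \<in> ?K \<Longrightarrow> L \<in> ?K \<Longrightarrow> K \<inter> L = {} \<Longrightarrow> x \<in> K \<Longrightarrow> y \<in> L \<Longrightarrow> \<delta> \<le> dist x y"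
    using \<delta>0 by simp_all
  have "bounded (\<Union>?K)" using fK Kcomp compact_imp_bounded by (intro bounded_Union) auto
  then have "\<exists>R>0. \<forall>z\<in>\<Union>?K. norm z \<le> R" by (simp only: bounded_pos)
  then obtain R where R0: "R > 0" "\<forall>z\<in>\<Union>?K. norm z \<le> R" by (elim exE conjE)
  have Rb: "R > 0" "\<And>z. z \<in> \<Union>?K \<Longrightarrow> norm z \<le> R" using R0(1) R0(2)[rule_format] .
  define h where "h = \<delta> / 7"
  define n where "n = \<lfloor>2 * R / h\<rfloor> + 1"
  have hpos: "h > 0" "7 * h = \<delta>" using \<delta>(1) unfolding h_def by auto
  interpret mesh R h n by unfold_locales (use Rb hpos n_def in auto)
  let ?G = "tri_edges (grid n)"
  have DK: "D v \<in> ?K" "\<And>z. z \<in> D v \<Longrightarrow> norm z \<le> R" if "v \<in> V" for v using that Rb(2) by blast+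
  have MK: "M e \<in> ?K" "\<And>z. z \<in> M e \<Longrightarrow> norm z \<le> R" if "e \<in> E" for e using that Rb(2) by blast+
  have Dconn: "connected (D v)" for v unfolding D_def by (intro convex_connected) simp
  have Mconn: "connected (M e)" if "e \<in> E" for e
    unfolding M_def by (rule connected_continuous_image[OF Mco[OF that]]) simp
  have apart: "x \<noteq> y \<and> {x, y} \<notin> ?G"
    if "K \<in> ?K" "L \<in> ?K" "K \<inter> L = {}" "x \<in> raster K" "y \<in> raster L" for K L x y
  proof -
    have 1: "norm z \<le> R" if "z \<in> K" for z using Rb(2) that \<open>K \<in> ?K\<close> by blast
    have 2: "norm z \<le> R" if "z \<in> L" for z using Rb(2) that \<open>L \<in> ?K\<close> by blast
    have 3: "7 * h \<le> dist z w" if "z \<in> K" "w \<in> L" for z w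
      using \<delta>(2)[OF \<open>K \<in> ?K\<close> \<open>L \<in> ?K\<close> \<open>K \<inter> L = {}\<close> that] hpos by simp
    show ?thesis using raster_apart[OF 1 2 3 that(4,5)] by blast
  qed
  have Rdis: "raster (D u) \<inter> raster (D v) = {}" if "u \<in> V" "v \<in> V" "u \<noteq> v" for u v
    using apart[OF DK(1)[OF that(1)] DK(1)[OF that(2)] DD[OF that]] by blast
  have "\<forall>e\<in>E. \<exists>Q. Q \<subseteq> raster (M e) - raster (D (hd e)) \<and>
      (\<forall>z\<in>Q. \<exists>a'\<in>raster (D (tl e)). conn {d \<in> ?G. d \<subseteq> Q} a' z) \<and>
      (\<exists>r\<in>Q. \<exists>b'\<in>raster (D (hd e)). {r, b'} \<in> ?G)"
  proof (rule ballI, rule reach_before)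
    fix e assume e: "e \<in> E"
    show "conn {d \<in> ?G. d \<subseteq> raster (M e)} x y" if "x \<in> raster (M e)" "y \<in> raster (M e)" for x y
      by (rule raster_conn[OF Mconn[OF e] MK(2)[OF e] that])
    let ?a = "\<gamma> e (s e)" and ?b = "\<gamma> e (t e)"
    show "(cx ?a, cy ?a) \<in> raster (M e)" "(cx ?a, cy ?a) \<in> raster (D (tl e))"
      using Mtl[OF e] by (auto intro: raster_mem)
    show "(cx ?b, cy ?b) \<in> raster (M e)" "(cx ?b, cy ?b) \<in> raster (D (hd e))"
      using Mhd[OF e] by (auto intro: raster_mem)
    show "raster (D (tl e)) \<inter> raster (D (hd e)) = {}" using Rdis[OF thV[OF e]] th[OF e] by blast
  qed
  from bchoice[OF this] obtain Q where Q0: "\<forall>e\<in>E. Q e \<subseteq> raster (M e) - raster (D (hd e)) \<and>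
      (\<forall>z\<in>Q e. \<exists>a'\<in>raster (D (tl e)). conn {d \<in> ?G. d \<subseteq> Q e} a' z) \<and>
      (\<exists>r\<in>Q e. \<exists>b'\<in>raster (D (hd e)). {r, b'} \<in> ?G)" by (elim exE)
  have Q: "\<And>e. e \<in> E \<Longrightarrow> Q e \<subseteq> raster (M e) - raster (D (hd e))"
    and Qc: "\<And>e z. e \<in> E \<Longrightarrow> z \<in> Q e \<Longrightarrow> \<exists>a'\<in>raster (D (tl e)). conn {d \<in> ?G. d \<subseteq> Q e} a' z"
    and Qe: "\<And>e. e \<in> E \<Longrightarrow> \<exists>r\<in>Q e. \<exists>b'\<in>raster (D (hd e)). {r, b'} \<in> ?G" using Q0 by simp_all
  define B where "B = (\<lambda>v. raster (D v) \<union> (\<Union>e\<in>{e \<in> E. tl e = v}. Q e))"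
  have DB: "raster (D v) \<subseteq> B v" for v unfolding B_def by blast
  have QB: "Q e \<subseteq> B (tl e)" if "e \<in> E" for e using that unfolding B_def by blast
  have BE: "x \<in> raster (D v) \<or> (\<exists>e\<in>E. tl e = v \<and> x \<in> Q e)" if "x \<in> B v" for x v
    using that unfolding B_def by blast
  have near: "{u, v} \<in> E \<and> x \<noteq> y"
    if uv: "u \<in> V" "v \<in> V" "u \<noteq> v" and xy: "x \<in> B u" "y \<in> B v" "x = y \<or> {x, y} \<in> ?G" for u v x y
  proof -
    have DQ: "{u, v} \<in> E \<and> x \<noteq> y"
      if uv: "u \<in> V" "v \<in> V" "u \<noteq> v" and x: "x \<in> raster (D u)" and e: "e \<in> E" "tl e = v" "y \<in> Q e"
        and xy: "x = y \<or> {x, y} \<in> ?G" for u v x y e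
    proof -
      have yM: "y \<in> raster (M e)" "y \<notin> raster (D (hd e))" using Q[OF e(1)] e(3) by auto
      have "D u \<inter> M e \<noteq> {}"
        using apart[OF DK(1)[OF uv(1)] MK(1)[OF e(1)] _ x yM(1)] xy by blast
      then have "u \<in> e" using MD[OF e(1) uv(1)] by blast
      then have "u = hd e" using th[OF e(1)] e(2) uv(3) by auto
      then have "{u, v} = e" "x \<noteq> y" using th[OF e(1)] e(2) x yM(2) by (auto simp: insert_commute)
      then show ?thesis using e(1) by simp
    qed
    from BE[OF xy(1)] BE[OF xy(2)] show ?thesis
    proof (elim disjE bexE conjE)
      assume "x \<in> raster (D u)" "y \<in> raster (D v)"
      then show ?thesis
        using apart[OF DK(1)[OF uv(1)] DK(1)[OF uv(2)] DD[OF uv]] xy(3) by blast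
    next
      fix e assume "x \<in> raster (D u)" "e \<in> E" "tl e = v" "y \<in> Q e"
      then show ?thesis using DQ[OF uv] xy(3) by blast
    next
      fix e assume e: "e \<in> E" "tl e = u" "x \<in> Q e" "y \<in> raster (D v)"
      have "y = x \<or> {y, x} \<in> ?G" using xy(3) by (auto simp: insert_commute)
      from DQ[OF uv(2,1) uv(3)[symmetric] e(4) e(1-3) this] show ?thesis by (auto simp: insert_commute)
    next
      fix e f assume ef: "e \<in> E" "tl e = u" "x \<in> Q e" "f \<in> E" "tl f = v" "y \<in> Q f"
      then have "e \<noteq> f" using uv(3) by blast
      then have "M e \<inter> M f = {}" using MM ef by blast
      moreover have "x \<in> raster (M e)" "y \<in> raster (M f)" using Q[OF ef(1)] Q[OF ef(4)] ef by auto
      ultimately show ?thesis using apart[OF MK(1)[OF ef(1)] MK(1)[OF ef(4)]] xy(3) by blast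
    qed
  qed
  show ?thesis
  proof (intro exI[of _ n] exI[of _ B] conjI ballI allI impI)
    show "1 \<le> n" by (rule n1)
    fix v assume v: "v \<in> V"
    have "p v \<in> D v" using r(1) unfolding D_def by simp
    then show "B v \<noteq> {}" using raster_mem DB by blast
    show "B v \<subseteq> \<Union>(grid n)"
    proof
      fix x assume "x \<in> B v"
      then have "x \<in> raster (D v) \<or> (\<exists>e\<in>E. x \<in> raster (M e))" using BE[of x v] Q by blast
      then show "x \<in> \<Union>(grid n)"
      proof (elim disjE bexE)
        assume "x \<in> raster (D v)"
        moreover have "raster (D v) \<subseteq> \<Union>(grid n)" by (rule raster_sub) (rule DK(2)[OF v])
        ultimately show ?thesis by (rule rev_subsetD)
      next
        fix e assume e: "e \<in> E" "x \<in> raster (M e)"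
        have "raster (M e) \<subseteq> \<Union>(grid n)" by (rule raster_sub) (rule MK(2)[OF e(1)])
        then show ?thesis using e(2) by (rule subsetD)
      qed
    qed
    have root: "\<exists>a\<in>raster (D v). conn {e \<in> ?G. e \<subseteq> B v} a x" if x: "x \<in> B v" for x
    proof (cases "x \<in> raster (D v)")
      case True
      then show ?thesis using conn_refl by blast
    next
      case False
      then obtain e where e: "e \<in> E" "tl e = v" "x \<in> Q e" using BE[OF x] by blast
      from Qc[OF e(1,3)] obtain a where a: "a \<in> raster (D v)" "conn {d \<in> ?G. d \<subseteq> Q e} a x" using e(2) by auto
      have "{d \<in> ?G. d \<subseteq> Q e} \<subseteq> {e \<in> ?G. e \<subseteq> B v}" using QB[OF e(1)] e(2) by auto
      then have "conn {e \<in> ?G. e \<subseteq> B v} a x" by (rule conn_mono[OF a(2)])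
      then show ?thesis using a(1) by blast
    qed
    have inD: "conn {e \<in> ?G. e \<subseteq> B v} a b" if "a \<in> raster (D v)" "b \<in> raster (D v)" for a b
      by (rule conn_mono[OF raster_conn[OF Dconn DK(2)[OF v] that]]) (use DB[of v] in auto)
    fix x y assume xy: "x \<in> B v" "y \<in> B v"
    obtain a where a: "a \<in> raster (D v)" "conn {e \<in> ?G. e \<subseteq> B v} a x" using root[OF xy(1)] by (elim bexE)
    obtain b where b: "b \<in> raster (D v)" "conn {e \<in> ?G. e \<subseteq> B v} b y" using root[OF xy(2)] by (elim bexE)
    show "conn {e \<in> ?G. e \<subseteq> B v} x y"
      by (rule conn_trans[OF conn_sym[OF a(2)] conn_trans[OF inD[OF a(1) b(1)] b(2)]])
  next
    fix u v x assume "u \<in> V" "v \<in> V" "x \<in> B u" "x \<in> B v"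
    then show "u = v" using near[of u v x x] by blast
  next
    fix u v assume uv: "{u, v} \<in> E"
    from Qe[OF uv] obtain q b where qb: "q \<in> B (tl {u, v})" "b \<in> B (hd {u, v})" "{q, b} \<in> ?G"
      using QB[OF uv] DB by blast
    have "{u, v} = {tl {u, v}, hd {u, v}}" using th[OF uv] by blast
    then have "u = tl {u, v} \<and> v = hd {u, v} \<or> u = hd {u, v} \<and> v = tl {u, v}" by (metis doubleton_eq_iff)
    then show "\<exists>x\<in>B u. \<exists>y\<in>B v. {x, y} \<in> ?G" using qb by (metis insert_commute)
  next
    fix u v x y assume "u \<in> V" "v \<in> V" "u \<noteq> v" "x \<in> B u" "y \<in> B v" "{x, y} \<in> ?G"
    then show "{u, v} \<in> E" using near by blast
  qed
qed

theorem planar_good: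
  assumes "planar_graph V E" and pr: "\<And>u v. {u, v} \<in> E \<Longrightarrow> \<phi> u \<noteq> \<phi> v"
  shows "good V E \<phi>"
proof -
  have fV: "finite V" and E2: "\<And>e. e \<in> E \<Longrightarrow> e \<subseteq> V \<and> card e = 2"
    using assms(1) unfolding planar_graph_def simple_graph_def by auto
  obtain n B where n: "1 \<le> n" and B: "\<forall>v\<in>V. B v \<noteq> {} \<and> B v \<subseteq> \<Union>(grid n)"
    "\<forall>u\<in>V. \<forall>v\<in>V. \<forall>x. x \<in> B u \<longrightarrow> x \<in> B v \<longrightarrow> u = v"
    "\<forall>v\<in>V. \<forall>x\<in>B v. \<forall>y\<in>B v. conn {e \<in> tri_edges (grid n). e \<subseteq> B v} x y"
    "\<forall>u v. {u, v} \<in> E \<longrightarrow> (\<exists>x\<in>B u. \<exists>y\<in>B v. {x, y} \<in> tri_edges (grid n))"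
    "\<forall>u\<in>V. \<forall>v\<in>V. u \<noteq> v \<longrightarrow> (\<forall>x\<in>B u. \<forall>y\<in>B v. {x, y} \<in> tri_edges (grid n) \<longrightarrow> {u, v} \<in> E)"
    using planar_branch_sets[OF assms(1)] by (elim exE conjE)
  show ?thesis
  proof (rule minor_good[OF grid_sphere[OF n] fV E2 pr])
    show "B v \<noteq> {} \<and> B v \<subseteq> \<Union>(grid n)" if "v \<in> V" for v using B(1) that by (rule bspec)
    show "u = v" if "u \<in> V" "v \<in> V" "x \<in> B u" "x \<in> B v" for u v x using B(2) that by blast
    show "conn {e \<in> tri_edges (grid n). e \<subseteq> B v} x y" if "v \<in> V" "x \<in> B v" "y \<in> B v" for v x y
      using B(3)[rule_format, OF that] .
    show "\<exists>x\<in>B u. \<exists>y\<in>B v. {x, y} \<in> tri_edges (grid n)" if "{u, v} \<in> E" for u v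
      using B(4)[rule_format, OF that] .
    show "{u, v} \<in> E" if "u \<in> V" "v \<in> V" "u \<noteq> v" "x \<in> B u" "y \<in> B v" "{x, y} \<in> tri_edges (grid n)" for u v x y
      using B(5)[rule_format, OF that] .
  qed
qed

section \<open>Cycles, transversals and cliques\<close>

lemma is_path_prefix:
  assumes "is_path X (as @ bs)" "as \<noteq> []"
  shows "is_path X as"
proof -
  have "{as ! i, as ! Suc i} \<in> X" if "Suc i < length as" for i
  proof -
    have "Suc i < length (as @ bs)" using that by simp
    then have "{(as @ bs) ! i, (as @ bs) ! Suc i} \<in> X" using assms(1) unfolding is_path_def by blast
    then show ?thesis using that by (simp add: nth_append)
  qed
  then show ?thesis using assms unfolding is_path_def by simp
qed

lemma conn_imp_path:
  assumes "conn X x y"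
  shows "\<exists>xs. is_path X xs \<and> hd xs = x \<and> last xs = y"
  using assms
proof (induction rule: conn_induct)
  case refl
  then show ?case by (intro exI[of _ "[x]"]) (simp add: is_path_def)
next
  case (step y z)
  then obtain xs where xs: "is_path X xs" "hd xs = x" "last xs = y" by blast
  show ?case
  proof (cases "z \<in> set xs")
    case True
    then obtain as bs where s: "xs = as @ z # bs" using split_list by metis
    have "is_path X (as @ [z])" by (rule is_path_prefix[of _ _ bs]) (use xs(1) s in simp_all)
    moreover have "hd (as @ [z]) = x" using xs(2) s by (cases as) simp_all
    ultimately show ?thesis by (intro exI[of _ "as @ [z]"]) simp
  next
    case False
    have ne: "xs \<noteq> []" using xs(1) unfolding is_path_def by simp
    have "{(xs @ [z]) ! i, (xs @ [z]) ! Suc i} \<in> X" if i: "Suc i < length (xs @ [z])" for i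
    proof (cases "Suc i < length xs")
      case True
      then have "{xs ! i, xs ! Suc i} \<in> X" using xs(1) unfolding is_path_def by blast
      then show ?thesis using True by (simp add: nth_append)
    next
      case False
      then have "Suc i = length xs" using i by simp
      moreover from this have "i = length xs - 1" by simp
      then have "xs ! i = y" using last_conv_nth[OF ne] xs(3) by simp
      ultimately show ?thesis using step.hyps(2) by (simp add: nth_append)
    qed
    then have "is_path X (xs @ [z])" using xs(1) False unfolding is_path_def by simp
    then show ?thesis using xs(2) ne by (intro exI[of _ "xs @ [z]"]) simp
  qed
qed

lemma path_imp_conn:
  assumes "is_path X xs"
  shows "conn X (hd xs) (last xs)"
proof -
  have ne: "xs \<noteq> []" using assms unfolding is_path_def by simp
  have "conn X (xs ! 0) (xs ! i)" if "i < length xs" for i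
    using that
  proof (induction i)
    case (Suc i)
    have "{xs ! i, xs ! Suc i} \<in> X" using assms Suc.prems unfolding is_path_def by blast
    then show ?case using conn_trans[OF Suc.IH conn_edge] Suc.prems by simp
  qed simp
  from this[of "length xs - 1"] show ?thesis using ne by (simp add: hd_conv_nth last_conv_nth)
qed

lemma is_cycle_iff_path:
  "is_cycle X xs \<longleftrightarrow> 3 \<le> length xs \<and> is_path X xs \<and> {last xs, hd xs} \<in> X"
proof -
  have "cycle_edges xs \<subseteq> X \<longleftrightarrow> (\<forall>i. Suc i < length xs \<longrightarrow> {xs ! i, xs ! Suc i} \<in> X) \<and> {last xs, hd xs} \<in> X"
    if l: "3 \<le> length xs"
  proof -
    have ne: "xs \<noteq> []" using l by auto
    have e: "{xs ! i, xs ! (Suc i mod length xs)} = (if Suc i < length xs then {xs ! i, xs ! Suc i} else {last xs, hd xs})"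
      if "i < length xs" for i
    proof (cases "Suc i < length xs")
      case False
      then have i: "Suc i = length xs" using that by simp
      then have "i = length xs - 1" by simp
      then have "xs ! i = last xs" using last_conv_nth[OF ne] by simp
      moreover have "xs ! (Suc i mod length xs) = hd xs" using hd_conv_nth[OF ne] i by simp
      ultimately show ?thesis using False by simp
    qed simp
    have "length xs - 1 < length xs" "\<not> Suc (length xs - 1) < length xs" using l by simp_all
    moreover have "cycle_edges xs \<subseteq> X \<longleftrightarrow> (\<forall>i<length xs. {xs ! i, xs ! (Suc i mod length xs)} \<in> X)"
      unfolding cycle_edges_def by blast
    moreover have "\<dots> \<longleftrightarrow> (\<forall>i<length xs. (if Suc i < length xs then {xs ! i, xs ! Suc i} else {last xs, hd xs}) \<in> X)"
      using e by simp
    ultimately show ?thesis by (meson Suc_lessD)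
  qed
  then show ?thesis unfolding is_cycle_def is_path_def by (cases xs) auto
qed

lemma acy_iff_forest:
  assumes "\<And>e. e \<in> X \<Longrightarrow> card e = 2"
  shows "acy X \<longleftrightarrow> forest X"
proof
  assume a: "acy X"
  have False if c: "is_cycle X xs" for xs
  proof -
    have l: "3 \<le> length xs" and p: "is_path X xs" and e: "{hd xs, last xs} \<in> X"
      using c unfolding is_cycle_iff_path by (auto simp: insert_commute)
    have ne: "xs \<noteq> []" using l by auto
    have d: "distinct xs" using p unfolding is_path_def by simp
    have "{xs ! i, xs ! Suc i} \<noteq> {hd xs, last xs}" if i: "Suc i < length xs" for i
    proof
      assume "{xs ! i, xs ! Suc i} = {hd xs, last xs}"
      then have "xs ! i = xs ! 0 \<and> xs ! Suc i = xs ! (length xs - 1) \<or> xs ! i = xs ! (length xs - 1) \<and> xs ! Suc i = xs ! 0"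
        using ne by (simp add: doubleton_eq_iff hd_conv_nth last_conv_nth)
      moreover have "i < length xs" "0 < length xs" "length xs - 1 < length xs" using i by linarith+
      ultimately show False using i l d by (auto simp: nth_eq_iff_index_eq)
    qed
    then have "is_path (X - {{hd xs, last xs}}) xs" using p unfolding is_path_def by simp
    then show False using path_imp_conn a e unfolding acy_def by blast
  qed
  then show "forest X" unfolding forest_def by blast
next
  assume f: "forest X"
  show "acy X"
    unfolding acy_def
  proof (intro allI impI notI)
    fix a b assume ab: "{a, b} \<in> X" "conn (X - {{a, b}}) a b"
    have "a \<noteq> b" using assms[OF ab(1)] by auto
    obtain xs where xs: "is_path (X - {{a, b}}) xs" "hd xs = a" "last xs = b"
      using conn_imp_path[OF ab(2)] by blast
    have "xs \<noteq> []" using xs(1) unfolding is_path_def by simp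
    moreover have "length xs \<noteq> 1" using xs(2,3) \<open>a \<noteq> b\<close> by (auto simp: length_Suc_conv)
    moreover have "length xs \<noteq> 2"
    proof
      assume "length xs = 2"
      then have "xs = [a, b]" using xs(2,3) by (auto simp: length_Suc_conv numeral_2_eq_2)
      then show False using xs(1) unfolding is_path_def by auto
    qed
    ultimately have "3 \<le> length xs" by (cases "length xs") auto
    moreover have "is_path X xs" using xs(1) unfolding is_path_def by blast
    moreover have "{last xs, hd xs} \<in> X" using xs ab(1) by (simp add: insert_commute)
    ultimately show False using f unfolding forest_def is_cycle_iff_path by blast
  qed
qed

lemma cycle_vertices:
  assumes "is_cycle X xs"
  shows "set xs \<subseteq> \<Union>X" "xs \<noteq> []" "e \<in> cycle_edges xs \<Longrightarrow> e \<subseteq> set xs"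
proof -
  show ne: "xs \<noteq> []" using assms unfolding is_cycle_def by auto
  have "xs ! i \<in> \<Union>X" if "i < length xs" for i
  proof (rule UnionI)
    show "{xs ! i, xs ! (Suc i mod length xs)} \<in> X"
      using assms that unfolding is_cycle_def cycle_edges_def by blast
  qed simp
  then show "set xs \<subseteq> \<Union>X" by (auto simp: in_set_conv_nth)
  show "e \<in> cycle_edges xs \<Longrightarrow> e \<subseteq> set xs"
    using ne unfolding cycle_edges_def by (auto intro!: nth_mem)
qed

lemma col_acy_iff_acy:
  assumes c2: "\<And>e. e \<in> F \<Longrightarrow> card e = 2" and pr: "\<And>u v. {u, v} \<in> F \<Longrightarrow> \<phi> u \<noteq> \<phi> v"
  shows "col_acy \<phi> F \<longleftrightarrow> (\<forall>p q. p \<noteq> q \<longrightarrow> acy {e \<in> F. \<phi> ` e = {p, q}})"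
proof
  assume ca: "col_acy \<phi> F"
  show "\<forall>p q. p \<noteq> q \<longrightarrow> acy {e \<in> F. \<phi> ` e = {p, q}}"
  proof (intro allI impI)
    fix p q :: 'b assume pq: "p \<noteq> q"
    let ?X = "{e \<in> F. \<phi> ` e = {p, q}}"
    let ?h = "\<lambda>x. (x, if \<phi> x = p then q else p)"
    have inj: "inj ?h" by (rule injI) simp
    have "?h ` e = spl \<phi> e" if e: "e \<in> ?X" for e
    proof -
      have "e \<in> F" using e by simp
      then have "\<exists>u v. e = {u, v}" using c2[of e] by (auto simp: card_2_iff)
      then obtain u v where uv: "e = {u, v}" by (elim exE)
      then have "\<phi> u = p \<and> \<phi> v = q \<or> \<phi> u = q \<and> \<phi> v = p" using e by (simp add: doubleton_eq_iff)
      then show ?thesis using uv pq by auto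
    qed
    then have "image ?h ` ?X = spl \<phi> ` ?X" by (rule image_cong[OF refl])
    then have "acy (image ?h ` ?X)" using col_acy_subset[OF ca, of ?X] by (simp add: col_acy_def)
    then show "acy ?X" by (rule acy_lift) (rule inj_onI, simp add: inj_image_eq_iff[OF inj])
  qed
next
  assume A: "\<forall>p q. p \<noteq> q \<longrightarrow> acy {e \<in> F. \<phi> ` e = {p, q}}"
  show "col_acy \<phi> F"
    unfolding col_acy_def acy_def
  proof (intro allI impI notI)
    fix s t assume st: "{s, t} \<in> spl \<phi> ` F" and co: "conn (spl \<phi> ` F - {{s, t}}) s t"
    obtain a i b k where s: "s = (a, i)" and t: "t = (b, k)" by (cases s, cases t)
    note e = spl_edgeD[OF st[unfolded s t]]
    let ?X = "{e \<in> F. \<phi> ` e = {\<phi> a, \<phi> b}}"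
    have cc: "conn (?X - {{a, b}}) a (fst t)"
      using co
    proof (induction rule: conn_induct)
      case refl
      then show ?case using s by simp
    next
      case (step y z)
      obtain u m w l where yz: "y = (u, m)" "z = (w, l)" by (cases y, cases z)
      have yzF: "{(u, m), (w, l)} \<in> spl \<phi> ` F" using step.hyps(2) yz by simp
      note f = spl_edgeD[OF yzF]
      have "conn (spl \<phi> ` F) (a, i) (u, m)" using step.hyps(1) unfolding s yz by (rule conn_mono) blast
      then have "{\<phi> a, i} = {\<phi> u, m}" by (rule conn_spl_pair)
      then have "{u, w} \<in> ?X" using e f by simp
      moreover have "{u, w} \<noteq> {a, b}"
      proof
        assume "{u, w} = {a, b}"
        then have "{y, z} = {s, t}" unfolding s t yz e(2,3) f(2,3) by (auto simp: doubleton_eq_iff)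
        then show False using step.hyps(2) by simp
      qed
      ultimately have "conn (?X - {{a, b}}) u w" by (intro conn_edge) simp
      then show ?case using conn_trans[OF step.IH] yz by simp
    qed
    have "\<phi> a \<noteq> \<phi> b" by (rule pr[OF e(1)])
    then have "acy ?X" using A by blast
    moreover have "{a, b} \<in> ?X" using e(1) by simp
    ultimately show False using cc t unfolding acy_def by simp
  qed
qed

lemma col_acy_iff_no_cycle:
  fixes \<phi> :: "'a \<Rightarrow> nat"
  assumes c2: "\<And>e. e \<in> F \<Longrightarrow> card e = 2" and pr: "\<And>u v. {u, v} \<in> F \<Longrightarrow> \<phi> u \<noteq> \<phi> v"
  shows "col_acy \<phi> F \<longleftrightarrow> (\<nexists>xs. two_colored_cycle F \<phi> xs)"
proof -
  have ac: "acy {e \<in> F. \<phi> ` e = {p, q}} \<longleftrightarrow> forest {e \<in> F. \<phi> ` e = {p, q}}" for p q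
    by (rule acy_iff_forest) (simp add: c2)
  have 1: "\<exists>p q. p \<noteq> q \<and> is_cycle {e \<in> F. \<phi> ` e = {p, q}} xs" if t: "two_colored_cycle F \<phi> xs" for xs
  proof -
    have cy: "is_cycle F xs" and "card (\<phi> ` set xs) = 2" using t unfolding two_colored_cycle_def by auto
    then have "\<exists>p q. \<phi> ` set xs = {p, q} \<and> p \<noteq> q" by (simp add: card_2_iff)
    then obtain p q where pq: "\<phi> ` set xs = {p, q}" "p \<noteq> q" by (elim exE conjE)
    have "\<phi> ` e = {p, q}" if e: "e \<in> cycle_edges xs" for e
    proof -
      have eF: "e \<in> F" using e cy unfolding is_cycle_def by blast
      have "\<exists>u v. e = {u, v}" using c2[OF eF] by (auto simp: card_2_iff)
      then obtain u v where uv: "e = {u, v}" by (elim exE)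
      have "\<phi> u \<noteq> \<phi> v" using pr eF uv by simp
      moreover have "\<phi> u \<in> {p, q}" "\<phi> v \<in> {p, q}"
        using cycle_vertices(3)[OF cy e] uv unfolding pq(1)[symmetric] by simp_all
      ultimately show ?thesis using uv by auto
    qed
    then have "is_cycle {e \<in> F. \<phi> ` e = {p, q}} xs" using cy unfolding is_cycle_def by blast
    then show ?thesis using pq(2) by blast
  qed
  have 2: "two_colored_cycle F \<phi> xs" if pq: "p \<noteq> q" and cy: "is_cycle {e \<in> F. \<phi> ` e = {p, q}} xs" for p q xs
  proof -
    have sub: "\<phi> ` set xs \<subseteq> {p, q}" using cycle_vertices(1)[OF cy] by blast
    have "{xs ! 0, xs ! (Suc 0 mod length xs)} \<in> cycle_edges xs"
      using cycle_vertices(2)[OF cy] unfolding cycle_edges_def by blast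
    then obtain e where e: "e \<in> cycle_edges xs" by blast
    then have "\<phi> ` e = {p, q}" using cy unfolding is_cycle_def by blast
    then have "\<phi> ` set xs = {p, q}" using sub cycle_vertices(3)[OF cy e] by blast
    then have "card (\<phi> ` set xs) = 2" using pq by simp
    moreover have "is_cycle F xs" using cy unfolding is_cycle_def by blast
    ultimately show ?thesis unfolding two_colored_cycle_def by simp
  qed
  have 3: "col_acy \<phi> F \<longleftrightarrow> (\<forall>p q. p \<noteq> q \<longrightarrow> forest {e \<in> F. \<phi> ` e = {p, q}})"
    using col_acy_iff_acy[OF c2 pr] ac by simp
  show ?thesis
    unfolding 3
  proof
    assume L: "\<forall>p q. p \<noteq> q \<longrightarrow> forest {e \<in> F. \<phi> ` e = {p, q}}"
    show "\<nexists>xs. two_colored_cycle F \<phi> xs"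
    proof (rule notI, elim exE)
      fix xs assume "two_colored_cycle F \<phi> xs"
      from 1[OF this] obtain p q where pq: "p \<noteq> q" "is_cycle {e \<in> F. \<phi> ` e = {p, q}} xs" by (elim exE conjE)
      have "\<exists>xs. is_cycle {e \<in> F. \<phi> ` e = {p, q}} xs" using pq(2) by (rule exI)
      then show False by (rule notE[OF L[rule_format, OF pq(1), unfolded forest_def]])
    qed
  next
    assume R: "\<nexists>xs. two_colored_cycle F \<phi> xs"
    show "\<forall>p q. p \<noteq> q \<longrightarrow> forest {e \<in> F. \<phi> ` e = {p, q}}"
      unfolding forest_def
    proof (intro allI impI notI, elim exE)
      fix p q xs assume pq: "p \<noteq> q" "is_cycle {e \<in> F. \<phi> ` e = {p, q}} xs"
      have "\<exists>xs. two_colored_cycle F \<phi> xs" using 2[OF pq] by (rule exI)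
      then show False by (rule notE[OF R])
    qed
  qed
qed

lemma transversal_iff_col_acy:
  assumes c2: "\<And>e. e \<in> E \<Longrightarrow> card e = 2" and pr: "\<And>u v. {u, v} \<in> E \<Longrightarrow> \<phi> u \<noteq> \<phi> v" and sub: "E' \<subseteq> E"
  shows "transversal_2CC E \<phi> E' \<longleftrightarrow> col_acy \<phi> (E - E')"
proof -
  have "two_colored_cycle (E - E') \<phi> xs \<longleftrightarrow> two_colored_cycle E \<phi> xs \<and> E' \<inter> cycle_edges xs = {}" for xs
    unfolding two_colored_cycle_def is_cycle_def by blast
  moreover have "col_acy \<phi> (E - E') \<longleftrightarrow> (\<nexists>xs. two_colored_cycle (E - E') \<phi> xs)"
    by (rule col_acy_iff_no_cycle) (use c2 pr in auto)
  ultimately show ?thesis using sub unfolding transversal_2CC_def by blast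
qed

lemma planar_graph_subset:
  assumes "planar_graph V E" "B \<subseteq> E"
  shows "planar_graph V B"
proof -
  obtain p \<gamma> where "plane_drawing V E p \<gamma>" using assms(1) unfolding planar_graph_def by blast
  then have "plane_drawing V B p \<gamma>"
    unfolding plane_drawing_def using assms(2) by (meson subsetD)
  moreover have "simple_graph V B" using assms unfolding planar_graph_def simple_graph_def by blast
  ultimately show ?thesis unfolding planar_graph_def by blast
qed

lemma clique_star:
  assumes U: "clique U E" "finite U" "U \<noteq> {}"
  obtains u K where "u \<in> U" "K = (\<lambda>w. {u, w}) ` (U - {u})" "K \<subseteq> E" "acy K" "card K + 1 = card U" "edges_on U K"
    "\<forall>x\<in>U. \<forall>y\<in>U. conn K x y"
proof -
  obtain u where u: "u \<in> U" using U(3) by blast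
  define K where "K = (\<lambda>w. {u, w}) ` (U - {u})"
  have KE: "K \<subseteq> E" using U(1) u unfolding clique_def K_def by auto
  have cu: "conn K u x" if "x \<in> U" for x
  proof (cases "x = u")
    case False
    then show ?thesis using that by (intro conn_edge) (simp add: K_def)
  qed simp
  have co: "conn K x y" if "x \<in> U" "y \<in> U" for x y
    by (rule conn_trans[OF conn_sym[OF cu[OF that(1)]] cu[OF that(2)]])
  have "inj_on (\<lambda>w. {u, w}) (U - {u})" by (rule inj_onI) (auto simp: doubleton_eq_iff)
  then have cK: "card K + 1 = card U"
    unfolding K_def using u U(2) card_gt_0_iff[of U] by (subst card_image) auto
  have eo: "edges_on U K" using u unfolding edges_on_def K_def by auto
  have "acy K" using connected_card_le(2)[OF eo U(2,3) co] cK by simp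
  then show ?thesis by (rule that[OF u K_def KE _ cK eo]) (use co in simp)
qed

text \<open>Refining the colouring by the components of \<^term>\<open>B \<union> K\<close> gives a proper colouring of \<^term>\<open>B\<close> with
  at least one colour per component, and with \<^term>\<open>card U\<close> colours on the component of the clique.\<close>
lemma clique_covering:
  assumes pl: "planar_graph V E" and pr: "\<And>u v. {u, v} \<in> E \<Longrightarrow> \<phi> u \<noteq> \<phi> v"
    and U: "U \<subseteq> V" "clique U E" and BE: "B \<subseteq> E"
    and K: "edges_on V K" "\<And>x y. x \<in> U \<Longrightarrow> y \<in> U \<Longrightarrow> conn K x y"
  shows "\<exists>F\<subseteq>B. col_acy \<phi> F \<and> card B + (card U - 1) \<le> card F + rk V (B \<union> K)"
proof -
  have fV: "finite V" and E2: "\<And>e. e \<in> E \<Longrightarrow> e \<subseteq> V \<and> card e = 2"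
    using pl unfolding planar_graph_def simple_graph_def by auto
  define cl where "cl = (\<lambda>v. {y \<in> V. conn (B \<union> K) v y})"
  define \<psi> where "\<psi> = (\<lambda>v. (cl v, \<phi> v))"
  have "good V B \<psi>"
    by (rule planar_good[OF planar_graph_subset[OF pl BE]]) (use pr BE in \<open>auto simp: \<psi>_def\<close>)
  then obtain F where F: "F \<subseteq> B" "col_acy \<psi> F" "card B + card (\<psi> ` V) \<le> card F + card V"
    unfolding good_def by blast
  have "col_acy \<phi> F"
  proof (rule col_acy_recolor[OF F(2)])
    show "card e = 2" if "e \<in> F" for e using that F(1) BE E2 by blast
    show "\<psi> v = (\<lambda>u j. (cl u, j)) u (\<phi> v)" if uv: "{u, v} \<in> F" for u v
    proof -
      have "{u, v} \<in> E" using uv F(1) BE by blast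
      then have V: "u \<in> V" "v \<in> V" using E2[of "{u, v}"] by auto
      have "conn (B \<union> K) v u" by (rule conn_sym[OF conn_edge]) (use uv F(1) in blast)
      then have "cl v = cl u" unfolding cl_def using comp_eq_iff[OF V(2,1)] by simp
      then show ?thesis unfolding \<psi>_def by simp
    qed
  qed
  moreover have "cc V (B \<union> K) + (card U - 1) \<le> card (\<psi> ` V)"
  proof (cases "U = {}")
    case True
    have "cc V (B \<union> K) = card (fst ` \<psi> ` V)" unfolding cc_def \<psi>_def cl_def image_image by simp
    also have "\<dots> \<le> card (\<psi> ` V)" using fV by (intro card_image_le) simp
    finally show ?thesis using True by simp
  next
    case False
    then obtain u where u: "u \<in> U" by blast
    have fU: "finite U" using fV U(1) finite_subset by blast
    have inj: "inj_on \<phi> U"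
    proof (rule inj_onI, rule ccontr)
      fix x y assume "x \<in> U" "y \<in> U" "\<phi> x = \<phi> y" "x \<noteq> y"
      then show False using U(2) pr[of x y] unfolding clique_def by blast
    qed
    let ?W = "\<psi> ` (U - {u})"
    have "inj_on \<psi> (U - {u})" using inj unfolding \<psi>_def inj_on_def by simp
    then have cW: "card ?W = card U - 1" using card_image u by fastforce
    have same: "cl x = cl u" if "x \<in> U" for x
    proof -
      have "conn (B \<union> K) x u" by (rule conn_mono[OF K(2)[OF that u]]) simp
      then show ?thesis unfolding cl_def using comp_eq_iff[of x V u] U(1) that u by blast
    qed
    have uW: "\<psi> u \<notin> ?W"
    proof
      assume "\<psi> u \<in> ?W"
      then obtain x where x: "\<psi> u = \<psi> x" "x \<in> U - {u}" by (rule imageE)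
      then have "\<phi> x = \<phi> u" unfolding \<psi>_def by simp
      then show False using inj_onD[OF inj, of x u] x(2) u by simp
    qed
    have "cl v \<in> fst ` (\<psi> ` V - ?W)" if v: "v \<in> V" for v
    proof (cases "\<psi> v \<in> ?W")
      case True
      then obtain x where "x \<in> U" "cl v = cl x" unfolding \<psi>_def by auto
      then have "cl v = fst (\<psi> u)" using same unfolding \<psi>_def by simp
      moreover have "\<psi> u \<in> \<psi> ` V - ?W" using uW u U(1) by blast
      ultimately show ?thesis by (rule image_eqI)
    next
      case False
      have "cl v = fst (\<psi> v)" unfolding \<psi>_def by simp
      moreover have "\<psi> v \<in> \<psi> ` V - ?W" using False v by blast
      ultimately show ?thesis by (rule image_eqI)
    qed
    then have "cl ` V \<subseteq> fst ` (\<psi> ` V - ?W)" by blast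
    then have "card (cl ` V) \<le> card (fst ` (\<psi> ` V - ?W))" using fV by (intro card_mono) auto
    also have "\<dots> \<le> card (\<psi> ` V - ?W)" using fV by (intro card_image_le) auto
    also have "\<dots> = card (\<psi> ` V) - card ?W" using fU U(1) by (intro card_Diff_subset) auto
    finally have "cc V (B \<union> K) \<le> card (\<psi> ` V) - (card U - 1)" unfolding cW cc_def cl_def .
    moreover have "card ?W \<le> card (\<psi> ` V)" using fV U(1) by (intro card_mono) auto
    ultimately show ?thesis unfolding cW by linarith
  qed
  moreover have "rk V (B \<union> K) + cc V (B \<union> K) = card V" using cc_le[OF fV] unfolding rk_def by simp
  ultimately show ?thesis using F(1,3) by (intro exI[of _ F]) linarith
qed

lemma spl_Int:
  assumes "\<And>e. e \<in> X \<union> Y \<Longrightarrow> card e = 2"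
  shows "spl c ` (X \<inter> Y) = spl c ` X \<inter> spl c ` Y"
  by (rule inj_on_image_Int[OF spl_inj]) (use assms in auto)

lemma card_spl:
  assumes "\<And>e. e \<in> X \<Longrightarrow> card e = 2"
  shows "card (spl c ` X) = card X"
  by (rule card_image[OF inj_on_subset[OF spl_inj]]) (use assms in auto)

theorem theorem14:
  fixes V U :: "'a set" and E :: "'a set set" and \<phi> :: "'a \<Rightarrow> nat" and n k :: nat
  assumes "planar_graph V E"
    and "card V = n"
    and "proper_coloring V E \<phi>"
    and "card (\<phi> ` V) = k"
    and "U \<subseteq> V"
    and "clique U E"
    and "card U \<le> 3"
  shows "\<exists>E\<^sub>U \<subseteq> E. transversal_2CC E \<phi> E\<^sub>U \<and> U_acyclic U E\<^sub>U \<and>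
           card E\<^sub>U = min_2CC E \<phi> \<and> min_2CC E \<phi> \<le> n - k"
proof -
  have fV: "finite V" and E2: "\<And>e. e \<in> E \<Longrightarrow> e \<subseteq> V \<and> card e = 2"
    using assms(1) unfolding planar_graph_def simple_graph_def by auto
  have c2: "\<And>e. e \<in> E \<Longrightarrow> card e = 2" using E2 by blast
  have pr: "\<And>u v. {u, v} \<in> E \<Longrightarrow> \<phi> u \<noteq> \<phi> v" using assms(3) unfolding proper_coloring_def by blast
  have fE: "finite E" using E2 fV finite_subset[of E "Pow V"] by blast
  have fU: "finite U" using assms(5) fV finite_subset by blast
  have eE: "edges_on V E"
    unfolding edges_on_def
  proof
    fix e assume e: "e \<in> E"
    have "\<exists>a b. e = {a, b}" using c2[OF e] by (auto simp: card_2_iff)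
    then show "\<exists>a\<in>V. \<exists>b\<in>V. e = {a, b}" using E2[OF e] by auto
  qed

  let ?N = "V \<times> \<phi> ` V"
  define r1 where "r1 = (\<lambda>B. rk ?N (spl \<phi> ` B))"
  have fN: "finite ?N" using fV by simp
  have eN: "edges_on ?N (spl \<phi> ` B)" if "B \<subseteq> E" for B
    unfolding edges_on_def
  proof
    fix s assume s: "s \<in> spl \<phi> ` B"
    have "s \<in> spl \<phi> ` E" by (rule subsetD[OF image_mono[OF that] s])
    then obtain e where e: "e \<in> E" "s = spl \<phi> e" by blast
    then obtain a b where "a \<in> V" "b \<in> V" "e = {a, b}" using eE unfolding edges_on_def by blast
    then show "\<exists>a\<in>?N. \<exists>b\<in>?N. s = {a, b}" using e(2) by auto
  qed
  have cs: "card (spl \<phi> ` B) = card B" if "B \<subseteq> E" for B by (rule card_spl) (use c2 that in blast)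
  have ext: "\<exists>F. X \<subseteq> F \<and> F \<subseteq> B \<and> col_acy \<phi> F \<and> card F = r1 B" if XB: "X \<subseteq> B" "B \<subseteq> E" "col_acy \<phi> X" for X B
  proof -
    have "\<exists>Z. spl \<phi> ` X \<subseteq> Z \<and> Z \<subseteq> spl \<phi> ` B \<and> acy Z \<and> card Z = rk ?N (spl \<phi> ` B)"
      by (rule rk_mono_acy_extend[OF eN[OF XB(2)] fN]) (use XB in \<open>auto simp: col_acy_def\<close>)
    then obtain Z where Z: "spl \<phi> ` X \<subseteq> Z" "Z \<subseteq> spl \<phi> ` B" "acy Z" "card Z = r1 B" unfolding r1_def by blast
    let ?F = "{e \<in> B. spl \<phi> e \<in> Z}"
    have ZF: "spl \<phi> ` ?F = Z" using Z(2) by blast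
    have "?F \<subseteq> E" using XB(2) by blast
    then have "card ?F = card Z" using cs[of ?F] unfolding ZF by simp
    moreover have "col_acy \<phi> ?F" unfolding col_acy_def ZF by (rule Z(3))
    moreover have "X \<subseteq> ?F" using Z(1) XB(1) by blast
    ultimately show ?thesis using Z(4) by (intro exI[of _ ?F]) simp
  qed
  have le_r1: "card X \<le> r1 B" if XB: "X \<subseteq> B" "B \<subseteq> E" "col_acy \<phi> X" for X B
  proof -
    obtain F where F: "X \<subseteq> F" "F \<subseteq> B" "card F = r1 B" using ext[OF XB] by blast
    have "finite F" by (rule finite_subset[OF F(2) finite_subset[OF XB(2) fE]])
    then show ?thesis using card_mono[OF _ F(1)] F(3) by simp
  qed

  have "\<exists>K. edges_on V K \<and> acy K \<and> card K = card U - 1 \<and> (\<forall>x\<in>U. \<forall>y\<in>U. conn K x y) \<and>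
    (\<forall>X x y. acy (X \<union> K) \<longrightarrow> X \<inter> K = {} \<longrightarrow> x \<in> U \<longrightarrow> y \<in> U \<longrightarrow> conn X x y \<longrightarrow> x = y)"
  proof (cases "U = {}")
    case True
    then show ?thesis by (intro exI[of _ "{}"]) (simp add: edges_on_def)
  next
    case False
    obtain u K where K: "u \<in> U" "K = (\<lambda>w. {u, w}) ` (U - {u})" "K \<subseteq> E" "acy K" "card K + 1 = card U"
      "edges_on U K" "\<forall>x\<in>U. \<forall>y\<in>U. conn K x y"
      using clique_star[OF assms(6) fU False] .
    have key: False
      if X: "acy (X \<union> K)" "X \<inter> K = {}" and xy: "x \<in> U" "y \<in> U" "x \<noteq> u" "x \<noteq> y" "conn X x y" for X x y
    proof -
      have xK: "{u, x} \<in> K" using K(2) xy by simp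
      let ?Y = "X \<union> K - {{u, x}}"
      have "conn ?Y u y"
      proof (cases "y = u")
        case False
        then have "{u, y} \<in> K" using K(2) xy by simp
        moreover have "{u, y} \<noteq> {u, x}" using xy by (auto simp: doubleton_eq_iff)
        ultimately show ?thesis by (intro conn_edge) simp
      qed simp
      moreover have "conn ?Y y x"
        by (rule conn_sym[OF conn_mono[OF xy(5)]]) (use xK X(2) in blast)
      ultimately have "conn ?Y u x" by (rule conn_trans)
      moreover have "{u, x} \<in> X \<union> K" using xK by simp
      ultimately show False using X(1) unfolding acy_def by blast
    qed
    have "x = y" if X: "acy (X \<union> K)" "X \<inter> K = {}" "x \<in> U" "y \<in> U" "conn X x y" for X x y
    proof (rule ccontr)
      assume ne: "x \<noteq> y"
      show False
      proof (cases "x = u")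
        case True
        then show False using key[OF X(1,2,4,3) _ _ conn_sym[OF X(5)]] ne by blast
      next
        case False
        then show False using key[OF X(1,2,3,4) _ ne X(5)] by blast
      qed
    qed
    moreover have "edges_on V K" by (rule edges_on_subset[OF eE K(3)])
    moreover have "card K = card U - 1" using K(5) by simp
    ultimately show ?thesis using K(4,7) by (intro exI[of _ K]) blast
  qed
  then obtain K where K: "edges_on V K" "acy K" "card K = card U - 1"
    and Kc: "\<And>x y. x \<in> U \<Longrightarrow> y \<in> U \<Longrightarrow> conn K x y"
    and Ks: "\<And>X x y. acy (X \<union> K) \<Longrightarrow> X \<inter> K = {} \<Longrightarrow> x \<in> U \<Longrightarrow> y \<in> U \<Longrightarrow> conn X x y \<Longrightarrow> x = y"
    by (elim exE conjE) blast
  have fK: "finite K" by (rule edges_on_finite[OF K(1) fV])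
  define r2 where "r2 = (\<lambda>B. rk V (B \<union> K) - card K)"
  have eBK: "edges_on V (B \<union> K)" if "B \<subseteq> E" for B
    using eE K(1) that unfolding edges_on_def by blast
  have geK: "card K \<le> rk V (B \<union> K)" if BE: "B \<subseteq> E" for B
  proof -
    have "\<exists>Z. K \<subseteq> Z \<and> Z \<subseteq> B \<union> K \<and> acy Z \<and> card Z = rk V (B \<union> K)"
      by (rule rk_mono_acy_extend[OF eBK[OF BE] fV _ K(2)]) simp
    then obtain Z where Z: "K \<subseteq> Z" "Z \<subseteq> B \<union> K" "card Z = rk V (B \<union> K)" by blast
    have "finite (B \<union> K)" by (rule edges_on_finite[OF eBK[OF BE] fV])
    then have "finite Z" using Z(2) finite_subset by blast
    then show ?thesis using card_mono[OF _ Z(1)] Z(3) by simp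
  qed

  have "\<exists>X\<subseteq>E. card X \<le> r1 X \<and> card (E - X) \<le> r2 (E - X)"
  proof (rule submodular_partition[OF fE])
    fix X Y assume XY: "X \<subseteq> E" "Y \<subseteq> E"
    have I: "spl \<phi> ` (X \<inter> Y) = spl \<phi> ` X \<inter> spl \<phi> ` Y" by (rule spl_Int) (use c2 XY in blast)
    show "r1 (X \<union> Y) + r1 (X \<inter> Y) \<le> r1 X + r1 Y"
      unfolding r1_def I image_Un by (rule rk_submodular[OF eN[OF XY(1)] eN[OF XY(2)] fN])
    have "rk V ((X \<union> K) \<union> (Y \<union> K)) + rk V ((X \<union> K) \<inter> (Y \<union> K)) \<le> rk V (X \<union> K) + rk V (Y \<union> K)"
      by (rule rk_submodular[OF eBK[OF XY(1)] eBK[OF XY(2)] fV])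
    moreover have "(X \<union> K) \<union> (Y \<union> K) = (X \<union> Y) \<union> K" "(X \<union> K) \<inter> (Y \<union> K) = (X \<inter> Y) \<union> K" by auto
    moreover have "X \<union> Y \<subseteq> E" "X \<inter> Y \<subseteq> E" using XY by auto
    ultimately show "r2 (X \<union> Y) + r2 (X \<inter> Y) \<le> r2 X + r2 Y"
      unfolding r2_def using geK[OF XY(1)] geK[OF XY(2)] geK[of "X \<union> Y"] geK[of "X \<inter> Y"] by simp
  next
    fix B assume BE: "B \<subseteq> E"
    have "\<exists>F\<subseteq>B. col_acy \<phi> F \<and> card B + (card U - 1) \<le> card F + rk V (B \<union> K)"
      by (rule clique_covering[OF assms(1) pr assms(5,6) BE K(1)]) (simp_all add: Kc)
    then obtain F where F: "F \<subseteq> B" "col_acy \<phi> F" "card B + (card U - 1) \<le> card F + rk V (B \<union> K)"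
      by (elim exE conjE)
    then show "card B \<le> r1 B + r2 B"
      using le_r1[OF F(1) BE F(2)] geK[OF BE] unfolding r2_def K(3) by linarith
  next
    show "r1 {} = 0" unfolding r1_def by (simp add: rk_empty)
    show "r2 {} = 0" unfolding r2_def using rk_card_acy(1)[OF K(1) fV] by simp
  qed
  then obtain X where X: "X \<subseteq> E" "card X \<le> r1 X" "card (E - X) \<le> r2 (E - X)" by blast
  have cX: "col_acy \<phi> X"
    unfolding col_acy_def using rk_card_acy[OF eN[OF X(1)] fN] X(2) cs[OF X(1)] unfolding r1_def by simp
  have EX: "E - X \<subseteq> E" by blast
  have un: "card (E - X) + card K \<le> rk V ((E - X) \<union> K)" using X(3) geK[OF EX] unfolding r2_def by linarith
  have Xrk: "rk V ((E - X) \<union> K) \<le> card ((E - X) \<union> K)" "rk V ((E - X) \<union> K) = card ((E - X) \<union> K) \<longleftrightarrow> acy ((E - X) \<union> K)"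
    by (rule rk_card_acy[OF eBK[OF EX] fV])+
  have cu: "card ((E - X) \<union> K) + card ((E - X) \<inter> K) = card (E - X) + card K"
    using card_Un_Int[of "E - X" K] fE fK by simp
  have aX: "acy ((E - X) \<union> K)" using Xrk un cu by linarith
  have "card ((E - X) \<inter> K) = 0" using Xrk(1) un cu by linarith
  then have dX: "(E - X) \<inter> K = {}" using fK by simp

  obtain F where F: "X \<subseteq> F" "F \<subseteq> E" "col_acy \<phi> F" "card F = r1 E" using ext[OF X(1) order_refl cX] by blast
  have tr: "transversal_2CC E \<phi> E' \<longleftrightarrow> col_acy \<phi> (E - E')" if "E' \<subseteq> E" for E'
    by (rule transversal_iff_col_acy[OF c2 pr that])
  have EF: "E - (E - F) = F" using F(2) by blast
  have tF: "transversal_2CC E \<phi> (E - F)" using tr[of "E - F"] EF F(3) by simp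
  have cEF: "card (E - F) = card E - r1 E" "r1 E \<le> card E"
    using card_Diff_subset[OF finite_subset[OF F(2) fE] F(2)] card_mono[OF fE F(2)] F(4) by simp_all
  have m: "card (E - F) = min_2CC E \<phi>"
  proof (rule antisym)
    show "min_2CC E \<phi> \<le> card (E - F)" unfolding min_2CC_def by (rule Least_le) (use tF in blast)
    obtain E' where E': "transversal_2CC E \<phi> E'" "card E' = min_2CC E \<phi>" using min_2CC_attained by blast
    have sub: "E' \<subseteq> E" using E'(1) unfolding transversal_2CC_def by simp
    have "card (E - E') \<le> r1 E" by (rule le_r1[OF _ order_refl]) (use tr[OF sub] E'(1) in auto)
    moreover have "card (E - E') = card E - card E'" by (rule card_Diff_subset[OF finite_subset[OF sub fE] sub])
    ultimately show "card (E - F) \<le> min_2CC E \<phi>" using E'(2) cEF by linarith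
  qed
  have "good V E \<phi>" by (rule planar_good[OF assms(1) pr])
  then obtain F0 where F0: "F0 \<subseteq> E" "col_acy \<phi> F0" "card E + card (\<phi> ` V) \<le> card F0 + card V"
    unfolding good_def by blast
  have mn: "min_2CC E \<phi> \<le> n - k"
    using le_r1[OF F0(1) order_refl F0(2)] F0(3) cEF m assms(2,4) by linarith
  have sub: "E - F \<subseteq> E - X" using F(1) by blast
  have "acy (E - F)" by (rule acy_subset[OF aX]) (use sub in blast)
  then have "forest (E - F)" using acy_iff_forest[of "E - F"] c2 by simp
  moreover have False if xs: "is_path (E - F) xs" "hd xs \<in> U" "last xs \<in> U" "hd xs \<noteq> last xs" for xs
  proof -
    have "conn (E - X) (hd xs) (last xs)" by (rule conn_mono[OF path_imp_conn[OF xs(1)] sub])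
    then show False using Ks[OF aX dX xs(2,3)] xs(4) by blast
  qed
  ultimately have "U_acyclic U (E - F)" unfolding U_acyclic_def by blast
  then show ?thesis using tF m mn by (intro exI[of _ "E - F"]) simp
qed

end
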